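(* Let $N\ge1$, $1<p<m$ and $\sigma>0$. Let $u_0\in C(\mathbb{R}^N)\cap L^\infty(\mathbb{R}^N)$ satisfy $u_0\ge0$, $u_0\not\equiv0$ and have compact support. Let $u$ be a solution to the Cauchy problem $$\partial_t u=\Delta u^m+|x|^\sigma u^p,\qquad u(x,0)=u_0(x),\ x\in\mathbb{R}^N,$$ having a blow-up time $T\in(0,\infty)$. Let $$\zeta(t):=\sup\{|x|:u(x,t)>0\},\qquad t\in(0,T),$$ be the edge of the support of $u(t)$. Then $\lim\limits_{t\to T}\zeta(t)=\infty$.
   Context: $Q_T:=\mathbb{R}^N\times(0,T)$, and $u(t)$ denotes the map $x\mapsto u(x,t)$. Solutions are non-negative functions. Weak solution: given $u_0\in C(\mathbb{R}^N)\cap L^\infty(\mathbb{R}^N)$, $u_0\ge0$, $u_0\not\equiv0$, a function $u\ge 0$ is a (weak) solution to the Cauchy problem $\partial_tu=\Delta u^m+|x|^\sigma u^p$, $u(\cdot,0)=u_0$, in $Q_T$ if $u\in C(\mathbb{R}^N\times(0,t))$ for any $t\in(0,T)$ and if, for any bounded domain $\Omega\subset\mathbb{R}^N$ (with smooth boundary, outer unit normal $n$) and any test function $\varphi\in C^{2,1}(\overline\Omega\times[0,T))$ with $\varphi=0$ on $\partial\Omega\times(0,T)$, $$\int_\Omega u(x,t)\varphi(x,t)\,dx-\int_\Omega u_0(x)\varphi(x,0)\,dx=\int_0^t\!\!\int_\Omega\left(u\,\partial_s\varphi+u^m\Delta\varphi+|x|^\sigma u^p\varphi\right)dx\,ds-\int_0^t\!\!\int_{\partial\Omega}u^m\,\partial_n\varphi\,dS\,ds$$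 for any $t\in(0,T)$. Blow-up time: $T\in(0,\infty)$ is the blow-up time of $u$ if $u(t)\in L^\infty(\mathbb{R}^N)$ for any $t\in(0,T)$ but $u(T)\notin L^\infty(\mathbb{R}^N)$, i.e. $\|u(t)\|_{L^\infty(\mathbb{R}^N)}$ does not remain bounded as $t\to T$. *)

theory Defs
  imports "HOL-Analysis.Analysis" "HOL-Probability.Essential_Supremum"
begin

text \<open>
  The space $R^N$ is an arbitrary type of class \<^class>\<open>euclidean_space\<close>, so that $N$ is its dimension
  (automatically at least one).
\<close>

section \<open>Bounded domains with smooth boundary\<close>

text \<open>\<open>Ck_on k f U\<close>: for open \<open>U\<close>, the function \<open>f\<close> is of class $C^k$ on \<open>U\<close>.\<close>

fun Ck_on :: "nat \<Rightarrow> ('a::euclidean_space \<Rightarrow> real) \<Rightarrow> 'a set \<Rightarrow> bool" where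
  "Ck_on 0 f U \<longleftrightarrow> continuous_on U f"
| "Ck_on (Suc k) f U \<longleftrightarrow>
     (\<exists>g. (\<forall>x\<in>U. GDERIV f x :> g x) \<and> (\<forall>b\<in>Basis. Ck_on k (\<lambda>x. g x \<bullet> b) U))"

definition smooth_on :: "('a::euclidean_space \<Rightarrow> real) \<Rightarrow> 'a set \<Rightarrow> bool" where
  "smooth_on f U \<longleftrightarrow> (\<forall>k. Ck_on k f U)"

text \<open>
  Near its boundary point \<open>x\<close> the set \<open>\<Omega>\<close> is the strict sublevel set of the smooth function \<open>\<rho>\<close>, whose
  gradient \<open>g\<close> has no zero; then $g/|g|$ is the outer unit normal.
\<close>

definition local_defining_function ::
    "'a::euclidean_space set \<Rightarrow> 'a \<Rightarrow> 'a set \<Rightarrow> ('a \<Rightarrow> real) \<Rightarrow> ('a \<Rightarrow> 'a) \<Rightarrow> bool" where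
  "local_defining_function \<Omega> x U \<rho> g \<longleftrightarrow>
     open U \<and> x \<in> U \<and> smooth_on \<rho> U \<and>
     (\<forall>y\<in>U. GDERIV \<rho> y :> g y \<and> g y \<noteq> 0) \<and>
     \<Omega> \<inter> U = {y \<in> U. \<rho> y < 0}"

definition smooth_bounded_domain :: "'a::euclidean_space set \<Rightarrow> bool" where
  "smooth_bounded_domain \<Omega> \<longleftrightarrow>
     open \<Omega> \<and> connected \<Omega> \<and> \<Omega> \<noteq> {} \<and> bounded \<Omega> \<and>
     (\<forall>x\<in>frontier \<Omega>. \<exists>U \<rho> g. local_defining_function \<Omega> x U \<rho> g)"

text \<open>The value does not depend on the choice of the defining function.\<close>

lemma outer_normal_unique:
  assumes 1: "local_defining_function \<Omega> x U \<rho> g" and 2: "local_defining_function \<Omega> x V \<eta> h"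
    and x: "x \<in> frontier \<Omega>" and op: "open \<Omega>"
  shows "g x /\<^sub>R norm (g x) = h x /\<^sub>R norm (h x)"
proof (rule ccontr)
  assume ne: "\<not> ?thesis"
  have zero: "\<rho> x = 0" if "local_defining_function \<Omega> x U \<rho> g" for U \<rho> g
  proof -
    note D = that[unfolded local_defining_function_def]
    have "\<not> \<rho> x < 0" using D x op by (auto simp: frontier_def interior_open)
    moreover have "\<not> \<rho> x > 0"
    proof
      assume pos: "\<rho> x > 0"
      have "isCont \<rho> x"
        using D by (auto simp: gderiv_def intro: has_derivative_continuous)
      then have "\<forall>\<^sub>F y in nhds x. \<rho> y > 0"
        using pos by (auto simp: isCont_def tendsto_nhds_iff intro: order_tendstoD)
      moreover have "\<forall>\<^sub>F y in nhds x. y \<in> U" using D eventually_nhds_in_open by blast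
      ultimately have "\<forall>\<^sub>F y in nhds x. y \<notin> \<Omega>"
      proof eventually_elim
        case (elim y)
        have "y \<in> \<Omega> \<inter> U \<longleftrightarrow> y \<in> U \<and> \<rho> y < 0" using D by blast
        then show ?case using elim by auto
      qed
      then obtain W where "open W" "x \<in> W" "\<forall>y\<in>W. y \<notin> \<Omega>"
        by (auto simp: eventually_nhds)
      then show False using x by (auto simp: frontier_def closure_iff_nhds_not_empty)
    qed
    ultimately show ?thesis by simp
  qed
  define a where "a = g x /\<^sub>R norm (g x)"
  define b where "b = h x /\<^sub>R norm (h x)"
  define v where "v = b - a"
  note D1 = 1[unfolded local_defining_function_def]
  note D2 = 2[unfolded local_defining_function_def]
  have gn: "g x \<noteq> 0" "h x \<noteq> 0" using D1 D2 by auto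
  have nn: "norm a = 1" "norm b = 1" using gn by (auto simp: a_def b_def)
  have "norm v > 0" using ne by (simp add: v_def a_def b_def)
  then have "v \<bullet> v > 0" by simp
  moreover have "v \<bullet> v = 2 - 2 * (a \<bullet> b)"
    using nn by (simp add: v_def inner_diff_left inner_diff_right inner_commute norm_eq_1)
  ultimately have "a \<bullet> b < 1" by simp
  then have va: "v \<bullet> a < 0" and vb: "v \<bullet> b > 0"
    using nn by (simp_all add: v_def inner_diff_left inner_commute[of b a] norm_eq_1)
  have "g x = norm (g x) *\<^sub>R a" "h x = norm (h x) *\<^sub>R b" using gn by (auto simp: a_def b_def)
  then have vg: "v \<bullet> g x < 0" and vh: "v \<bullet> h x > 0"
    using va vb gn by (metis inner_scaleR_right mult_pos_neg zero_less_norm_iff,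
        metis inner_scaleR_right mult_pos_pos zero_less_norm_iff)
  have line: "((\<lambda>t. f (x + t *\<^sub>R v)) has_real_derivative (v \<bullet> k)) (at 0)"
    if "GDERIV f x :> k" for f k
  proof -
    have "((\<lambda>t. x + t *\<^sub>R v) has_derivative (\<lambda>t. t *\<^sub>R v)) (at (0::real))"
      by (auto intro!: derivative_eq_intros)
    from has_derivative_compose[OF this, of f "\<lambda>h. h \<bullet> k"] that
    show ?thesis
      by (simp add: gderiv_def has_field_derivative_def mult_commute_abs)
  qed
  obtain d1 where d1: "d1 > 0" "\<And>t. 0 < t \<Longrightarrow> t < d1 \<Longrightarrow> \<rho> (x + t *\<^sub>R v) < 0"
    using DERIV_neg_dec_right[OF line[of \<rho> "g x"] vg] D1 zero[OF 1] by auto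
  obtain d2 where d2: "d2 > 0" "\<And>t. 0 < t \<Longrightarrow> t < d2 \<Longrightarrow> \<eta> (x + t *\<^sub>R v) > 0"
    using DERIV_pos_inc_right[OF line[of \<eta> "h x"] vh] D2 zero[OF 2] by auto
  have "((\<lambda>t. x + t *\<^sub>R v) \<longlongrightarrow> x) (at_right 0)"
    by (auto intro!: tendsto_eq_intros)
  then have "\<forall>\<^sub>F t in at_right 0. x + t *\<^sub>R v \<in> U \<inter> V"
    using D1 D2 by (intro topological_tendstoD) auto
  moreover have "\<forall>\<^sub>F t in at_right (0::real). t \<in> {0<..<min d1 d2}"
    using d1 d2 by (intro eventually_at_right_real) auto
  ultimately have "\<forall>\<^sub>F t in at_right (0::real). False"
  proof eventually_elim
    case (elim t)
    then have "x + t *\<^sub>R v \<in> \<Omega>" using d1(2)[of t] D1 by auto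
    moreover have "x + t *\<^sub>R v \<notin> \<Omega>" using elim d2(2)[of t] D2 by force
    ultimately show ?case by simp
  qed
  then show False by simp
qed

definition outer_normal :: "'a::euclidean_space set \<Rightarrow> 'a \<Rightarrow> 'a" where
  "outer_normal \<Omega> x =
     (THE n. \<exists>U \<rho> g. local_defining_function \<Omega> x U \<rho> g \<and> n = g x /\<^sub>R norm (g x))"

section \<open>Surface measure\<close>

text \<open>
  $k$-dimensional Hausdorff measure, normalised so that it is the surface measure $dS$ on smooth
  $k$-dimensional surfaces (for \<open>k = 0\<close>: counting measure). The empty set is treated separately because
  \<open>0 ^ 0 = 1\<close>, and boundedness is required because \<^const>\<open>diameter\<close> is unspecified on unbounded sets.
\<close>

definition hausdorff_gauge :: "nat \<Rightarrow> 'a::euclidean_space set \<Rightarrow> ennreal" where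
  "hausdorff_gauge k C =
     (if C = {} then 0 else ennreal (unit_ball_vol (real k) * (diameter C / 2) ^ k))"

definition hausdorff_content :: "nat \<Rightarrow> real \<Rightarrow> 'a::euclidean_space set \<Rightarrow> ennreal" where
  "hausdorff_content k \<delta> A =
     (INF C\<in>{C :: nat \<Rightarrow> 'a set. A \<subseteq> (\<Union>i. C i) \<and> (\<forall>i. bounded (C i) \<and> diameter (C i) \<le> \<delta>)}.
        \<Sum>i. hausdorff_gauge k (C i))"

definition hausdorff_outer :: "nat \<Rightarrow> 'a::euclidean_space set \<Rightarrow> ennreal" where
  "hausdorff_outer k A = (SUP \<delta>\<in>{0<..}. hausdorff_content k \<delta> A)"

definition hausdorff_measure :: "nat \<Rightarrow> 'a::euclidean_space measure" where
  "hausdorff_measure k = measure_of UNIV (sets borel) (hausdorff_outer k)"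

text \<open>The outer measure is a metric outer measure, so Borel sets are measurable for it.\<close>

lemma hausdorff_content_le:
  assumes "A \<subseteq> (\<Union>i. C i)" "\<And>i. bounded (C i)" "\<And>i. diameter (C i) \<le> \<delta>"
  shows "hausdorff_content k \<delta> A \<le> (\<Sum>i. hausdorff_gauge k (C i))"
  unfolding hausdorff_content_def by (rule INF_lower) (use assms in auto)

lemma hausdorff_content_le_outer: "\<delta> > 0 \<Longrightarrow> hausdorff_content k \<delta> A \<le> hausdorff_outer k A"
  unfolding hausdorff_outer_def by (rule SUP_upper) auto

lemma hausdorff_content_mono: "A \<subseteq> B \<Longrightarrow> hausdorff_content k \<delta> A \<le> hausdorff_content k \<delta> B"
  unfolding hausdorff_content_def by (rule INF_superset_mono) auto

lemma hausdorff_content_antimono: "\<delta> \<le> \<epsilon> \<Longrightarrow> hausdorff_content k \<epsilon> A \<le> hausdorff_content k \<delta> A"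
  unfolding hausdorff_content_def by (rule INF_superset_mono) (auto intro: order_trans)

lemma hausdorff_outer_mono: "A \<subseteq> B \<Longrightarrow> hausdorff_outer k A \<le> hausdorff_outer k B"
  unfolding hausdorff_outer_def by (rule SUP_mono) (blast intro: hausdorff_content_mono)

lemma hausdorff_outer_empty: "hausdorff_outer k ({} :: 'a::euclidean_space set) = 0"
proof -
  have "hausdorff_content k \<delta> ({} :: 'a set) \<le> 0" if "\<delta> > 0" for \<delta>
    using hausdorff_content_le[of "{}" "\<lambda>_. {} :: 'a set" \<delta> k] that by (simp add: hausdorff_gauge_def)
  then show ?thesis
    unfolding hausdorff_outer_def by (auto intro!: antisym SUP_least)
qed

lemma hausdorff_content_UN:
  fixes A :: "nat \<Rightarrow> 'a::euclidean_space set"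
  shows "hausdorff_content k \<delta> (\<Union>n. A n) \<le> (\<Sum>n. hausdorff_content k \<delta> (A n))"
proof (rule ennreal_le_epsilon)
  fix e :: real assume fin: "(\<Sum>n. hausdorff_content k \<delta> (A n)) < top" and e: "0 < e"
  have "\<exists>C. A n \<subseteq> (\<Union>i. C i) \<and> (\<forall>i. bounded (C i) \<and> diameter (C i) \<le> \<delta>) \<and>
            (\<Sum>i. hausdorff_gauge k (C i)) \<le> hausdorff_content k \<delta> (A n) + ennreal (e * (1/2)^Suc n)" for n
  proof -
    have "hausdorff_content k \<delta> (A n) < top"
      using fin ennreal_suminf_lessD by blast
    moreover have "ennreal (e * (1/2)^Suc n) > 0" using e by simp
    ultimately have "hausdorff_content k \<delta> (A n) < hausdorff_content k \<delta> (A n) + ennreal (e * (1/2)^Suc n)"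
      by (simp add: ennreal_add_left_cancel_less[of _ 0, simplified])
    then show ?thesis
      unfolding hausdorff_content_def[of k \<delta> "A n"] INF_less_iff by (auto intro: less_imp_le)
  qed
  then obtain C where C: "\<And>n. A n \<subseteq> (\<Union>i. C n i)" "\<And>n i. bounded (C n i)" "\<And>n i. diameter (C n i) \<le> \<delta>"
    "\<And>n. (\<Sum>i. hausdorff_gauge k (C n i)) \<le> hausdorff_content k \<delta> (A n) + ennreal (e * (1/2)^Suc n)"
    by metis
  define B where "B j = (case prod_decode j of (n, i) \<Rightarrow> C n i)" for j
  have "(\<Union>n. A n) \<subseteq> (\<Union>j. B j)"
  proof
    fix x assume "x \<in> (\<Union>n. A n)"
    then obtain n i where "x \<in> C n i" using C(1) by blast
    then have "x \<in> B (prod_encode (n, i))" by (simp add: B_def)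
    then show "x \<in> (\<Union>j. B j)" by blast
  qed
  then have "hausdorff_content k \<delta> (\<Union>n. A n) \<le> (\<Sum>j. hausdorff_gauge k (B j))"
    by (rule hausdorff_content_le) (auto simp: B_def C split: prod.split)
  also have "\<dots> = (\<Sum>n. \<Sum>i. hausdorff_gauge k (C n i))"
    using suminf_ennreal_2dimen[of "\<lambda>n. \<Sum>i. hausdorff_gauge k (C n i)" "\<lambda>(n, i). hausdorff_gauge k (C n i)"]
    by (simp add: B_def case_prod_beta)
  also have "\<dots> \<le> (\<Sum>n. hausdorff_content k \<delta> (A n) + ennreal (e * (1/2)^Suc n))"
    by (intro suminf_le C(4)) auto
  also have "\<dots> = (\<Sum>n. hausdorff_content k \<delta> (A n)) + (\<Sum>n. ennreal (e * (1/2)^Suc n))"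
    by (rule suminf_add[symmetric]) auto
  also have "(\<Sum>n. ennreal (e * (1/2)^Suc n)) = ennreal e"
    using sums_mult[OF power_half_series, of e] e
    by (intro suminf_ennreal_eq) auto
  finally show "hausdorff_content k \<delta> (\<Union>n. A n) \<le> (\<Sum>n. hausdorff_content k \<delta> (A n)) + ennreal e" .
qed

lemma hausdorff_outer_UN:
  fixes A :: "nat \<Rightarrow> 'a::euclidean_space set"
  shows "hausdorff_outer k (\<Union>n. A n) \<le> (\<Sum>n. hausdorff_outer k (A n))"
  unfolding hausdorff_outer_def[of k "\<Union>n. A n"]
proof (rule SUP_least)
  fix \<delta> :: real assume "\<delta> \<in> {0<..}"
  then show "hausdorff_content k \<delta> (\<Union>n. A n) \<le> (\<Sum>n. hausdorff_outer k (A n))"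
    by (intro order_trans[OF hausdorff_content_UN] suminf_le hausdorff_content_le_outer) auto
qed

lemma hausdorff_outer_Un:
  fixes A :: "'a::euclidean_space set"
  shows "hausdorff_outer k (A \<union> B) \<le> hausdorff_outer k A + hausdorff_outer k B"
proof -
  define S where "S n = (if n = 0 then A else if n = 1 then B else {})" for n :: nat
  have "A \<union> B = S 0 \<union> S 1" by (simp add: S_def)
  also have "\<dots> \<subseteq> (\<Union>n. S n)" by blast
  finally have "hausdorff_outer k (A \<union> B) \<le> hausdorff_outer k (\<Union>n. S n)"
    by (rule hausdorff_outer_mono)
  also have "\<dots> \<le> (\<Sum>n. hausdorff_outer k (S n))" by (rule hausdorff_outer_UN)
  also have "\<dots> = (\<Sum>n\<in>{0,1}. hausdorff_outer k (S n))"
    by (rule suminf_finite) (auto simp: S_def hausdorff_outer_empty)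
  also have "\<dots> = hausdorff_outer k A + hausdorff_outer k B" by (simp add: S_def)
  finally show ?thesis .
qed

lemma hausdorff_outer_metric:
  fixes A :: "'a::euclidean_space set"
  assumes d: "d > 0" and sep: "\<And>x y. x \<in> A \<Longrightarrow> y \<in> B \<Longrightarrow> dist x y \<ge> d"
  shows "hausdorff_outer k A + hausdorff_outer k B \<le> hausdorff_outer k (A \<union> B)"
proof -
  have split: "hausdorff_content k \<delta> A + hausdorff_content k \<delta> B \<le> hausdorff_content k \<delta> (A \<union> B)"
    if \<delta>: "0 < \<delta>" "\<delta> < d" for \<delta>
    unfolding hausdorff_content_def[of k \<delta> "A \<union> B"]
  proof (rule INF_greatest)
    fix C :: "nat \<Rightarrow> 'a set"
    assume "C \<in> {C. A \<union> B \<subseteq> (\<Union>i. C i) \<and> (\<forall>i. bounded (C i) \<and> diameter (C i) \<le> \<delta>)}"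
    then have C: "A \<union> B \<subseteq> (\<Union>i. C i)" "\<And>i. bounded (C i)" "\<And>i. diameter (C i) \<le> \<delta>" by auto
    have disj: "C i \<inter> A = {} \<or> C i \<inter> B = {}" for i
    proof (rule ccontr)
      assume "\<not> ?thesis"
      then obtain x y where xy: "x \<in> C i" "x \<in> A" "y \<in> C i" "y \<in> B" by blast
      then show False
        using diameter_bounded_bound[of "C i" x y] C(2,3)[of i] sep[of x y] \<delta> by fastforce
    qed
    define P where "P S i = (if C i \<inter> S = {} then {} else C i)" for S i
    have le: "hausdorff_content k \<delta> S \<le> (\<Sum>i. hausdorff_gauge k (P S i))" if sub: "S \<subseteq> A \<union> B" for S
    proof (rule hausdorff_content_le)
      show "S \<subseteq> (\<Union>i. P S i)"
      proof
        fix x assume "x \<in> S"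
        then obtain i where "x \<in> C i" using sub C(1) by blast
        then have "x \<in> P S i" using \<open>x \<in> S\<close> by (auto simp: P_def)
        then show "x \<in> (\<Union>i. P S i)" by blast
      qed
    qed (use C \<delta> in \<open>auto simp: P_def\<close>)
    have "hausdorff_content k \<delta> A + hausdorff_content k \<delta> B
        \<le> (\<Sum>i. hausdorff_gauge k (P A i)) + (\<Sum>i. hausdorff_gauge k (P B i))"
      by (intro add_mono le) auto
    also have "\<dots> = (\<Sum>i. hausdorff_gauge k (P A i) + hausdorff_gauge k (P B i))"
      by (rule suminf_add) auto
    also have "\<dots> \<le> (\<Sum>i. hausdorff_gauge k (C i))"
    proof (rule suminf_le)
      show "hausdorff_gauge k (P A i) + hausdorff_gauge k (P B i) \<le> hausdorff_gauge k (C i)" for i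
        using disj[of i] by (auto simp: P_def hausdorff_gauge_def)
    qed auto
    finally show "hausdorff_content k \<delta> A + hausdorff_content k \<delta> B \<le> (\<Sum>i. hausdorff_gauge k (C i))" .
  qed
  have "hausdorff_content k \<delta> A + hausdorff_content k \<epsilon> B \<le> hausdorff_outer k (A \<union> B)"
    if "\<delta> > 0" "\<epsilon> > 0" for \<delta> \<epsilon>
  proof -
    define r where "r = min (min \<delta> \<epsilon>) (d/2)"
    have r: "0 < r" "r < d" "r \<le> \<delta>" "r \<le> \<epsilon>" using that d by (auto simp: r_def)
    have "hausdorff_content k \<delta> A + hausdorff_content k \<epsilon> B \<le> hausdorff_content k r A + hausdorff_content k r B"
      using r by (intro add_mono hausdorff_content_antimono)
    also have "\<dots> \<le> hausdorff_outer k (A \<union> B)"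
      using split[of r] hausdorff_content_le_outer[of r k "A \<union> B"] r by (meson order_trans)
    finally show ?thesis .
  qed
  then have "(SUP \<delta>\<in>{0<..}. hausdorff_content k \<delta> A + hausdorff_content k \<epsilon> B) \<le> hausdorff_outer k (A \<union> B)"
    if "\<epsilon> > 0" for \<epsilon> using that by (intro SUP_least) auto
  then have "hausdorff_outer k A + hausdorff_content k \<epsilon> B \<le> hausdorff_outer k (A \<union> B)"
    if "\<epsilon> > 0" for \<epsilon>
    unfolding hausdorff_outer_def[of k A] using that
    by (subst (asm) ennreal_SUP_add_left) auto
  then have "(SUP \<epsilon>\<in>{0<..}. hausdorff_outer k A + hausdorff_content k \<epsilon> B) \<le> hausdorff_outer k (A \<union> B)"
    by (intro SUP_least) auto
  moreover have "(SUP \<epsilon>\<in>{0<..}. hausdorff_outer k A + hausdorff_content k \<epsilon> B) =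
      hausdorff_outer k A + hausdorff_outer k B"
    unfolding hausdorff_outer_def[of k B] add.commute[of "hausdorff_outer k A"]
    by (rule ennreal_SUP_add_left) auto
  ultimately show ?thesis by simp
qed

lemma hausdorff_outer_closed:
  fixes F :: "'a::euclidean_space set"
  assumes F: "closed F"
  shows "hausdorff_outer k (X \<inter> F) + hausdorff_outer k (X - F) \<le> hausdorff_outer k X"
proof (cases "F = {} \<or> hausdorff_outer k X = top")
  case True
  then show ?thesis by (auto simp: hausdorff_outer_empty)
next
  case False
  let ?H = "hausdorff_outer k"
  have F0: "F \<noteq> {}" and fin: "?H X < top" using False by (auto simp: less_top)
  define P where "P j = {x \<in> X. infdist x F \<ge> 1 / real (Suc j)}" for j
  define R where "R j = P (Suc j) - P j" for j
  have PX: "P j \<subseteq> X" and RX: "R j \<subseteq> X" for j by (auto simp: P_def R_def)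
  have lip: "infdist x F \<le> infdist y F + dist x y" for x y by (rule infdist_triangle)
  have 1: "?H (X \<inter> F) + ?H (P j) \<le> ?H X" for j
  proof -
    have "?H (X \<inter> F) + ?H (P j) \<le> ?H (X \<inter> F \<union> P j)"
    proof (rule hausdorff_outer_metric[of "1 / real (Suc j)"])
      fix x y assume "x \<in> X \<inter> F" "y \<in> P j"
      then show "1 / real (Suc j) \<le> dist x y"
        using infdist_le[of x F y] by (auto simp: P_def dist_commute)
    qed simp
    also have "\<dots> \<le> ?H X" using PX by (intro hausdorff_outer_mono) auto
    finally show ?thesis .
  qed
  have sums: "(\<Sum>j<n. ?H (R (2 * j + c))) \<le> ?H (\<Union>j<n. R (2 * j + c))" for n c
  proof (induction n)
    case (Suc n)
    show ?case
    proof (cases n)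
      case 0 then show ?thesis by (simp add: lessThan_Suc)
    next
      case (Suc n')
      define d where "d = 1 / real (2 * n' + c + 2) - 1 / real (2 * n' + c + 3)"
      have "1 / real (2 * n' + c + 3) < 1 / real (2 * n' + c + 2)"
        by (intro divide_strict_left_mono) auto
      then have d0: "d > 0" by (simp add: d_def)
      have "?H (\<Union>j<n. R (2 * j + c)) + ?H (R (2 * n + c)) \<le> ?H ((\<Union>j<n. R (2 * j + c)) \<union> R (2 * n + c))"
      proof (rule hausdorff_outer_metric[OF d0])
        fix x y assume "x \<in> (\<Union>j<n. R (2 * j + c))" and y: "y \<in> R (2 * n + c)"
        then obtain j where j: "j < n" "x \<in> R (2 * j + c)" by auto
        have "infdist x F \<ge> 1 / real (2 * j + c + 2)" "infdist y F < 1 / real (2 * n + c + 1)"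
          using j y by (auto simp: R_def P_def)
        moreover have "1 / real (2 * j + c + 2) \<ge> 1 / real (2 * n' + c + 2)"
          using j Suc by (intro divide_left_mono) auto
        moreover have "1 / real (2 * n + c + 1) = 1 / real (2 * n' + c + 3)" using Suc by simp
        ultimately show "d \<le> dist x y" using lip[of x y] unfolding d_def by linarith
      qed
      moreover have "(\<Union>j<n. R (2 * j + c)) \<union> R (2 * n + c) = (\<Union>j<Suc n. R (2 * j + c))"
        by (auto simp: lessThan_Suc)
      ultimately have le: "?H (\<Union>j<n. R (2 * j + c)) + ?H (R (2 * n + c)) \<le> ?H (\<Union>j<Suc n. R (2 * j + c))"
        by (simp only:)
      have "(\<Sum>j<n. ?H (R (2 * j + c))) + ?H (R (2 * n + c)) \<le> ?H (\<Union>j<Suc n. R (2 * j + c))"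
        using add_right_mono[OF Suc.IH] le by (rule order_trans)
      then show ?thesis by simp
    qed
  qed (simp add: hausdorff_outer_empty)
  have half: "(\<Sum>j<n. ?H (R (2 * j + c))) \<le> ?H X" for n c
    by (rule order_trans[OF sums hausdorff_outer_mono]) (use RX in blast)
  have "(\<Sum>j<n. ?H (R j)) \<le> ?H X + ?H X" for n
  proof -
    have "(\<Sum>j<n. ?H (R j)) \<le> (\<Sum>j<2*n. ?H (R j))" by (intro sum_mono2) auto
    also have "\<dots> = (\<Sum>j<n. ?H (R (2 * j + 0))) + (\<Sum>j<n. ?H (R (2 * j + 1)))"
      by (induction n) (auto simp: ac_simps)
    also have "\<dots> \<le> ?H X + ?H X" by (intro add_mono half)
    finally show ?thesis .
  qed
  then have "(\<Sum>j. ?H (R j)) \<le> ?H X + ?H X"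
    by (intro suminf_le_const) auto
  also have "\<dots> < top" using fin by simp
  finally have finR: "(\<Sum>j. ?H (R j)) < top" .
  have cover: "X - F \<subseteq> P n \<union> (\<Union>j. R (j + n))" for n
  proof
    fix x assume x: "x \<in> X - F"
    then have "infdist x F > 0"
      using F F0 in_closed_iff_infdist_zero infdist_nonneg by (metis DiffD2 less_eq_real_def)
    then obtain i where i: "inverse (real (Suc i)) < infdist x F" using reals_Archimedean by blast
    have ex: "x \<in> P i" using x i by (auto simp: P_def inverse_eq_divide)
    show "x \<in> P n \<union> (\<Union>j. R (j + n))"
    proof (cases "x \<in> P n")
      case nP: False
      have mono: "P a \<subseteq> P b" if "a \<le> b" for a b
      proof -
        have "1 / real (Suc b) \<le> 1 / real (Suc a)" using that by (intro divide_left_mono) auto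
        then show ?thesis by (auto simp: P_def)
      qed
      define l where "l = (LEAST l. x \<in> P l)"
      have l: "x \<in> P l" unfolding l_def using ex by (rule LeastI)
      have "n < l" using nP l mono[of l n] by (meson not_less subsetD)
      then obtain q where q: "l = Suc q" by (cases l) auto
      have "x \<notin> P q" using not_less_Least[of q "\<lambda>l. x \<in> P l"] q l_def by auto
      then have "x \<in> R ((q - n) + n)" using l q \<open>n < l\<close> by (auto simp: R_def)
      then show ?thesis by blast
    qed simp
  qed
  have bound: "?H (X \<inter> F) + ?H (X - F) \<le> ?H X + (\<Sum>j. ?H (R (j + n)))" for n
  proof -
    have "?H (X - F) \<le> ?H (P n) + (\<Sum>j. ?H (R (j + n)))"
      using hausdorff_outer_mono[OF cover[of n], of k] hausdorff_outer_Un[of k "P n" "\<Union>j. R (j + n)"]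
        hausdorff_outer_UN[of k "\<lambda>j. R (j + n)"]
      by (meson add_left_mono order_trans)
    then have "?H (X \<inter> F) + ?H (X - F) \<le> (?H (X \<inter> F) + ?H (P n)) + (\<Sum>j. ?H (R (j + n)))"
      by (simp add: add.assoc add_left_mono)
    also have "\<dots> \<le> ?H X + (\<Sum>j. ?H (R (j + n)))" using 1 by (intro add_right_mono)
    finally show ?thesis .
  qed
  have "(\<lambda>n. \<Sum>j. ?H (R (j + n))) \<longlonglongrightarrow> 0"
  proof -
    define S where "S = (\<Sum>j. ?H (R j))"
    have "(\<Sum>j. ?H (R (j + n))) = S - (\<Sum>j<n. ?H (R j))" for n
    proof -
      have "S = (\<Sum>j. ?H (R (j + n))) + (\<Sum>j<n. ?H (R j))"
        unfolding S_def by (rule suminf_offset) auto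
      moreover have "(\<Sum>j<n. ?H (R j)) < top"
        by (rule order.strict_trans1[OF sum_le_suminf finR]) auto
      ultimately show ?thesis by (metis ennreal_add_diff_cancel_right less_top infinity_ennreal_def)
    qed
    moreover have "(\<lambda>n. S - (\<Sum>j<n. ?H (R j))) \<longlonglongrightarrow> S - S"
      unfolding S_def using finR
      by (intro tendsto_diff_ennreal tendsto_const summable_LIMSEQ) auto
    moreover have "S - S = 0" using finR by (simp add: S_def ennreal_minus_cancel_iff diff_eq_0_iff_ennreal)
    ultimately show ?thesis by simp
  qed
  then have "(\<lambda>n. ?H X + (\<Sum>j. ?H (R (j + n)))) \<longlonglongrightarrow> ?H X + 0"
    by (intro tendsto_add) auto
  then show ?thesis
    by (intro LIMSEQ_le_const[where X="\<lambda>n. ?H X + (\<Sum>j. ?H (R (j + n)))"]) (use bound in auto)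
qed

lemma emeasure_hausdorff_measure:
  fixes A :: "'a::euclidean_space set"
  assumes "A \<in> sets borel"
  shows "emeasure (hausdorff_measure k) A = hausdorff_outer k A"
proof -
  let ?H = "hausdorff_outer k :: 'a set \<Rightarrow> ennreal"
  let ?L = "lambda_system UNIV (Pow UNIV) ?H"
  interpret P: sigma_algebra UNIV "Pow UNIV :: 'a set set" by (rule sigma_algebra_Pow)
  have "outer_measure_space (Pow UNIV) ?H"
    by (auto simp: outer_measure_space_def positive_def increasing_def countably_subadditive_def
        hausdorff_outer_empty hausdorff_outer_mono hausdorff_outer_UN)
  then have ms: "measure_space UNIV ?L ?H" by (rule P.caratheodory_lemma)
  have "F \<in> ?L" if "closed F" for F
  proof -
    have "?H (X \<inter> F) + ?H (X - F) = ?H X" for X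
      using hausdorff_outer_closed[OF that, of k X] hausdorff_outer_Un[of k "X \<inter> F" "X - F"]
      by (simp add: Int_Diff_Un)
    then show ?thesis unfolding P.lambda_system_eq by blast
  qed
  then have "sigma_sets UNIV {F :: 'a set. closed F} \<subseteq> ?L"
    using ms by (intro sigma_algebra.sigma_sets_subset) (auto simp: measure_space_def)
  then have "sets (borel :: 'a measure) \<subseteq> ?L" by (simp add: borel_eq_closed)
  then have "measure_space UNIV (sets (borel :: 'a measure)) ?H"
    by (intro measure_down[OF ms]) (use sets.sigma_algebra_axioms[of "borel :: 'a measure"] in auto)
  then show ?thesis
    unfolding hausdorff_measure_def using assms
    by (intro emeasure_measure_of_sigma) (auto simp: measure_space_def)
qed

definition surface_measure :: "'a::euclidean_space measure" where
  "surface_measure = hausdorff_measure (DIM('a) - 1)"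

section \<open>Weak solutions\<close>

text \<open>
  $\varphi \in C^{2,1}(\overline\Omega\times[0,T))$ with time derivative \<open>\<phi>t\<close>, spatial gradient \<open>D\<close> and
  spatial Hessian \<open>H\<close>: the derivatives exist in the open cylinder, and together with \<open>\<phi>\<close> they extend
  continuously to $\overline\Omega\times[0,T)$. The values of \<open>\<phi>t\<close>, \<open>D\<close>, \<open>H\<close> on the boundary of the cylinder
  are those of the continuous extensions.
\<close>

definition C21_function ::
    "'a::euclidean_space set \<Rightarrow> real \<Rightarrow> ('a \<Rightarrow> real \<Rightarrow> real) \<Rightarrow>
     ('a \<Rightarrow> real \<Rightarrow> real) \<Rightarrow> ('a \<Rightarrow> real \<Rightarrow> 'a) \<Rightarrow> ('a \<Rightarrow> real \<Rightarrow> 'a \<Rightarrow>\<^sub>L 'a) \<Rightarrow> bool" where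
  "C21_function \<Omega> T \<phi> \<phi>t D H \<longleftrightarrow>
     (\<forall>x\<in>\<Omega>. \<forall>s\<in>{0<..<T}.
        ((\<lambda>r. \<phi> x r) has_real_derivative \<phi>t x s) (at s) \<and>
        GDERIV (\<lambda>y. \<phi> y s) x :> D x s \<and>
        ((\<lambda>y. D y s) has_derivative blinfun_apply (H x s)) (at x)) \<and>
     continuous_on (closure \<Omega> \<times> {0..<T}) (\<lambda>(x, s). \<phi> x s) \<and>
     continuous_on (closure \<Omega> \<times> {0..<T}) (\<lambda>(x, s). \<phi>t x s) \<and>
     continuous_on (closure \<Omega> \<times> {0..<T}) (\<lambda>(x, s). D x s) \<and>
     continuous_on (closure \<Omega> \<times> {0..<T}) (\<lambda>(x, s). H x s)"

definition blinfun_trace :: "('a::euclidean_space \<Rightarrow>\<^sub>L 'a) \<Rightarrow> real" where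
  "blinfun_trace A = (\<Sum>b\<in>Basis. blinfun_apply A b \<bullet> b)"

text \<open>The integral over \<open>\<Omega>\<close> at time \<open>s\<close>; \<open>blinfun_trace (H x s)\<close> is $\Delta\varphi(x,s)$.\<close>

definition bulk_term ::
    "real \<Rightarrow> real \<Rightarrow> real \<Rightarrow> ('a::euclidean_space \<Rightarrow> real \<Rightarrow> real) \<Rightarrow> 'a set \<Rightarrow>
     ('a \<Rightarrow> real \<Rightarrow> real) \<Rightarrow> ('a \<Rightarrow> real \<Rightarrow> real) \<Rightarrow> ('a \<Rightarrow> real \<Rightarrow> 'a \<Rightarrow>\<^sub>L 'a) \<Rightarrow> real \<Rightarrow> real" where
  "bulk_term m p \<sigma> u \<Omega> \<phi> \<phi>t H s =
     (LINT x:\<Omega>|lborel. u x s * \<phi>t x s + u x s powr m * blinfun_trace (H x s)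
                       + norm x powr \<sigma> * u x s powr p * \<phi> x s)"

definition boundary_term ::
    "real \<Rightarrow> ('a::euclidean_space \<Rightarrow> real \<Rightarrow> real) \<Rightarrow> 'a set \<Rightarrow> ('a \<Rightarrow> real \<Rightarrow> 'a) \<Rightarrow> real \<Rightarrow> real" where
  "boundary_term m u \<Omega> D s =
     (LINT x:frontier \<Omega>|surface_measure. u x s powr m * (D x s \<bullet> outer_normal \<Omega> x))"

text \<open>
  \<open>u\<close> is a weak solution in $R^N\times(0,T)$ of $u_t = \Delta u^m + |x|^\sigma u^p$, $u(\cdot,0)=u_0$; the initial
  datum enters only through the integral identity, and the values \<open>u x s\<close> with \<open>s\<close> outside $(0,T)$ are
  irrelevant. For \<open>s > 0\<close> the integrands of the inner integrals are continuous on the compact sets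
  $\overline\Omega$ and $\partial\Omega$; as \<open>u\<close>
  is not assumed continuous up to \<open>s = 0\<close>, existence of the time integrals has to be demanded, because
  the integral of a non-integrable function is \<open>0\<close> here.
\<close>

definition weak_solution ::
    "real \<Rightarrow> real \<Rightarrow> real \<Rightarrow> ('a::euclidean_space \<Rightarrow> real) \<Rightarrow> real \<Rightarrow> ('a \<Rightarrow> real \<Rightarrow> real) \<Rightarrow> bool" where
  "weak_solution m p \<sigma> u0 T u \<longleftrightarrow>
     (\<forall>x. \<forall>s\<in>{0<..<T}. u x s \<ge> 0) \<and>
     (\<forall>t\<in>{0<..<T}. continuous_on (UNIV \<times> {0<..<t}) (\<lambda>(x, s). u x s)) \<and>
     (\<forall>\<Omega> \<phi> \<phi>t D H.
        smooth_bounded_domain \<Omega> \<longrightarrow> C21_function \<Omega> T \<phi> \<phi>t D H \<longrightarrow>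
        (\<forall>x\<in>frontier \<Omega>. \<forall>s\<in>{0<..<T}. \<phi> x s = 0) \<longrightarrow>
        (\<forall>t\<in>{0<..<T}.
           set_integrable lborel {0<..<t} (bulk_term m p \<sigma> u \<Omega> \<phi> \<phi>t H) \<and>
           set_integrable lborel {0<..<t} (boundary_term m u \<Omega> D) \<and>
           (LINT x:\<Omega>|lborel. u x t * \<phi> x t) - (LINT x:\<Omega>|lborel. u0 x * \<phi> x 0) =
             (LINT s:{0<..<t}|lborel. bulk_term m p \<sigma> u \<Omega> \<phi> \<phi>t H s)
             - (LINT s:{0<..<t}|lborel. boundary_term m u \<Omega> D s)))"

section \<open>Blow-up time and edge of the support\<close>

definition Linf_norm :: "('a::euclidean_space \<Rightarrow> real) \<Rightarrow> ereal" where
  "Linf_norm f = esssup lebesgue (\<lambda>x. ereal \<bar>f x\<bar>)"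

definition Linf :: "('a::euclidean_space \<Rightarrow> real) set" where
  "Linf = {f \<in> borel_measurable lebesgue. Linf_norm f < \<infinity>}"

definition blow_up_time :: "('a::euclidean_space \<Rightarrow> real \<Rightarrow> real) \<Rightarrow> real \<Rightarrow> bool" where
  "blow_up_time u T \<longleftrightarrow>
     0 < T \<and> (\<forall>t\<in>{0<..<T}. (\<lambda>x. u x t) \<in> Linf) \<and>
     \<not> (\<exists>C::real. \<forall>\<^sub>F t in at_left T. Linf_norm (\<lambda>x. u x t) \<le> ereal C)"

text \<open>Extended-real valued, as the support of \<open>u(t)\<close> is not known to be bounded a priori.\<close>

definition support_edge :: "('a::euclidean_space \<Rightarrow> real \<Rightarrow> real) \<Rightarrow> real \<Rightarrow> ereal" where
  "support_edge u t = (SUP x\<in>{x. u x t > 0}. ereal (norm x))"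

end

theory Submission
  imports Defs
begin

text \<open>
  If the edge of the support does not tend to infinity, then supports stay in a fixed ball: a point at
  which \<open>u\<close> is positive keeps this property, by comparison from below with an explicit subsolution of
  the porous medium equation. In that ball $|x|^\sigma u^p$ is dominated by the diffusion because
  $p < m$, and a stationary supersolution bounds \<open>u\<close> up to time \<open>T\<close>, contradicting blow-up.

  Both comparisons are between a continuous very weak solution and an explicit function. They are
  proved by duality. Mollifying in space only, $u_\varepsilon = \kappa_\varepsilon * u$ satisfies
  $\partial_t u_\varepsilon = \Delta (u^m)_\varepsilon + \dots$ pointwise; the Laplacian is replaced by a
  finite difference $\Delta_\delta$, and $(u^m)_\varepsilon$ by $u^m$ up to an error under
  $\Delta_\delta$. The dual problem $\psi_t + \alpha\Delta_\delta\psi = 0$ is solved by an explicit Euler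
  scheme, which preserves positivity and satisfies the energy estimate
  $\int\!\!\int \alpha|\Delta_\delta\psi|^2 \le \int |\nabla_\delta\psi(t_1)|^2$; this controls the errors,
  so no existence theory for parabolic equations is needed.
\<close>

section \<open>Discrete Laplacian and the dual scheme\<close>

text \<open>The dual coefficient is the quotient of the difference of the m-th powers by the
  difference of the functions. It is only measurable and bounded, and it degenerates where both
  functions are small. A dual partial differential equation would require smoothing it first; the
  explicit scheme uses nothing but its bounds. This dictates the order of the choices in the
  comparison: first the regularisation of the coefficient, then the mollification error, which must
  be small relative to it, then the mesh width \<delta>, and last the time step, of order \<delta>
  squared.

  The source never enters a comparison as a nonlinearity. From below it is dropped, being
  nonnegative. From above it is replaced by a constant, which is legitimate as long as u obeys a
  provisional bound. The barrier then returns a bound smaller by the factor two, so that the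
  provisional bound is never reached. Making the constants of this loop consistent is possible
  because the source grows sublinearly as a function of the m-th power of u.\<close>

lemma bounded_subset_cball_ex: "bounded (X::'a::euclidean_space set) \<Longrightarrow> \<exists>r. X \<subseteq> cball 0 r"
  by (auto simp: bounded_iff subset_iff)

definition discrete_laplacian :: "real \<Rightarrow> ('a::euclidean_space \<Rightarrow> real) \<Rightarrow> 'a \<Rightarrow> real" where
  "discrete_laplacian \<delta> f x = (\<Sum>b\<in>Basis. f (x + \<delta> *\<^sub>R b) + f (x - \<delta> *\<^sub>R b) - 2 * f x) / \<delta>\<^sup>2"

lemma discrete_laplacian_measurable [measurable]:
  fixes f :: "'a::euclidean_space \<Rightarrow> real"
  assumes [measurable]: "f \<in> borel_measurable borel"
  shows "discrete_laplacian \<delta> f \<in> borel_measurable borel"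
  unfolding discrete_laplacian_def[abs_def] by measurable

lemma discrete_laplacian_add: "discrete_laplacian \<delta> (\<lambda>y. f y + g y) x = discrete_laplacian \<delta> f x + discrete_laplacian \<delta> g x"
proof -
  have "discrete_laplacian \<delta> (\<lambda>y. f y + g y) x
      = (\<Sum>b\<in>Basis. (f (x + \<delta> *\<^sub>R b) + f (x - \<delta> *\<^sub>R b) - 2 * f x)
          + (g (x + \<delta> *\<^sub>R b) + g (x - \<delta> *\<^sub>R b) - 2 * g x)) / \<delta>\<^sup>2"
    unfolding discrete_laplacian_def by (intro arg_cong2[where f="(/)"] sum.cong) auto
  then show ?thesis by (simp add: discrete_laplacian_def sum.distrib add_divide_distrib)
qed

lemma discrete_laplacian_cmult: "discrete_laplacian \<delta> (\<lambda>y. c * f y) x = c * discrete_laplacian \<delta> f x"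
proof -
  have "discrete_laplacian \<delta> (\<lambda>y. c * f y) x
      = (\<Sum>b\<in>Basis. c * (f (x + \<delta> *\<^sub>R b) + f (x - \<delta> *\<^sub>R b) - 2 * f x)) / \<delta>\<^sup>2"
    unfolding discrete_laplacian_def by (intro arg_cong2[where f="(/)"] sum.cong) (auto simp: algebra_simps)
  then show ?thesis by (simp add: discrete_laplacian_def sum_distrib_left[symmetric])
qed

lemma discrete_laplacian_const: "discrete_laplacian \<delta> (\<lambda>y. c) x = 0"
  by (simp add: discrete_laplacian_def)

lemma discrete_laplacian_diff: "discrete_laplacian \<delta> (\<lambda>y. f y - g y) x = discrete_laplacian \<delta> f x - discrete_laplacian \<delta> g x"
  using discrete_laplacian_add[of \<delta> f "\<lambda>y. (-1) * g y" x] discrete_laplacian_cmult[of \<delta> "-1" g x] by simp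

section \<open>Summation by parts and the discrete Dirichlet form\<close>

lemma integral_shift:
  fixes f :: "'a::euclidean_space \<Rightarrow> real"
  assumes [measurable]: "f \<in> borel_measurable borel"
  shows "(LINT x|lborel. f (x + c)) = (LINT x|lborel. f x)"
proof -
  have "(LINT x|lborel. f x) = (LINT x|distr lborel borel ((+) c). f x)"
    by (simp add: lborel_distr_plus)
  also have "\<dots> = (LINT x|lborel. f (c + x))" by (rule integral_distr) auto
  finally show ?thesis by (simp add: add.commute)
qed

text \<open>Solutions are controlled only on bounded sets, so just one factor, the test function, is
  bounded everywhere and supported in \<open>X\<close>.\<close>

lemma integrable_mult_bounded_support:
  fixes f g :: "'a::euclidean_space \<Rightarrow> real"
  assumes [measurable]: "f \<in> borel_measurable borel" "g \<in> borel_measurable borel"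
    and f: "\<And>x. x \<in> X \<Longrightarrow> \<bar>f x\<bar> \<le> P" and g: "\<And>x. \<bar>g x\<bar> \<le> Q" "\<And>x. x \<notin> X \<Longrightarrow> g x = 0"
    and X: "bounded X"
  shows "integrable lborel (\<lambda>x. f x * g x)"
proof -
  obtain r where r: "X \<subseteq> cball 0 r" using X bounded_subset_cball_ex by blast
  show ?thesis
  proof (rule integrableI_bounded_set[where A="cball 0 r" and B="\<bar>P\<bar> * \<bar>Q\<bar>"])
    show "AE x in lborel. x \<in> cball 0 r \<longrightarrow> norm (f x * g x) \<le> \<bar>P\<bar> * \<bar>Q\<bar>"
    proof (intro AE_I2 impI)
      fix x :: 'a
      show "norm (f x * g x) \<le> \<bar>P\<bar> * \<bar>Q\<bar>"
      proof (cases "x \<in> X")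
        case True
        then show ?thesis using f[of x] g(1)[of x] by (auto simp: abs_mult intro!: mult_mono)
      qed (simp add: g)
    qed
    show "emeasure lborel (cball 0 r :: 'a set) < \<infinity>"
      by (intro emeasure_bounded_finite) auto
    show "AE x in lborel. x \<notin> cball 0 r \<longrightarrow> f x * g x = 0"
    proof (intro AE_I2 impI)
      fix x :: 'a assume "x \<notin> cball 0 r"
      then have "g x = 0" using r g(2) by blast
      then show "f x * g x = 0" by simp
    qed
  qed auto
qed

text \<open>Translation invariance of Lebesgue measure moves each shift from one factor to the
  other; the stencil is symmetric, so the operator is its own adjoint. \<open>X\<close> has to
  contain all neighbours of \<open>\<Omega>\<close>, because the discrete Laplacian of \<psi>
  spreads that far.\<close>

lemma discrete_laplacian_by_parts:
  fixes f \<psi> :: "'a::euclidean_space \<Rightarrow> real"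
  assumes [measurable]: "f \<in> borel_measurable borel" "\<psi> \<in> borel_measurable borel"
    and f: "\<And>x. x \<in> X \<Longrightarrow> \<bar>f x\<bar> \<le> P" and \<psi>: "\<And>x. \<bar>\<psi> x\<bar> \<le> Q" "\<And>x. x \<notin> \<Omega> \<Longrightarrow> \<psi> x = 0"
    and X: "bounded X" "\<Omega> \<subseteq> X"
    and nb: "\<And>x b. x \<in> \<Omega> \<Longrightarrow> b \<in> Basis \<Longrightarrow> x + \<delta> *\<^sub>R b \<in> X"
      "\<And>x b. x \<in> \<Omega> \<Longrightarrow> b \<in> Basis \<Longrightarrow> x - \<delta> *\<^sub>R b \<in> X"
  shows "integrable lborel (\<lambda>x. discrete_laplacian \<delta> f x * \<psi> x)" "integrable lborel (\<lambda>x. f x * discrete_laplacian \<delta> \<psi> x)"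
    "(LINT x|lborel. discrete_laplacian \<delta> f x * \<psi> x) = (LINT x|lborel. f x * discrete_laplacian \<delta> \<psi> x)"
proof -
  have b\<Omega>: "bounded \<Omega>" using X bounded_subset by blast
  have i1: "integrable lborel (\<lambda>x. f (x + \<delta> *\<^sub>R b) * \<psi> x)" if "b \<in> Basis" for b
    by (rule integrable_mult_bounded_support[where X=\<Omega> and P=P and Q=Q])
      (use that f \<psi> b\<Omega> nb in auto)
  have i2: "integrable lborel (\<lambda>x. f (x - \<delta> *\<^sub>R b) * \<psi> x)" if "b \<in> Basis" for b
    by (rule integrable_mult_bounded_support[where X=\<Omega> and P=P and Q=Q])
      (use that f \<psi> b\<Omega> nb in auto)
  have j1: "integrable lborel (\<lambda>x. f x * \<psi> (x + \<delta> *\<^sub>R b))" if "b \<in> Basis" for b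
  proof (rule integrable_mult_bounded_support[where X=X and P=P and Q=Q])
    show "\<psi> (x + \<delta> *\<^sub>R b) = 0" if "x \<notin> X" for x
      using nb(2)[of "x + \<delta> *\<^sub>R b" b] that \<open>b \<in> Basis\<close> \<psi>(2) by fastforce
  qed (use that f \<psi> X in auto)
  have j2: "integrable lborel (\<lambda>x. f x * \<psi> (x - \<delta> *\<^sub>R b))" if "b \<in> Basis" for b
  proof (rule integrable_mult_bounded_support[where X=X and P=P and Q=Q])
    show "\<psi> (x - \<delta> *\<^sub>R b) = 0" if "x \<notin> X" for x
      using nb(1)[of "x - \<delta> *\<^sub>R b" b] that \<open>b \<in> Basis\<close> \<psi>(2) by fastforce
  qed (use that f \<psi> X in auto)
  have k: "integrable lborel (\<lambda>x. f x * \<psi> x)"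
    by (rule integrable_mult_bounded_support[where X=X and P=P and Q=Q]) (use f \<psi> X in auto)
  have e1: "discrete_laplacian \<delta> f x * \<psi> x = (\<Sum>b\<in>Basis. f (x + \<delta> *\<^sub>R b) * \<psi> x + f (x - \<delta> *\<^sub>R b) * \<psi> x
      - 2 * (f x * \<psi> x)) / \<delta>\<^sup>2" for x
    unfolding discrete_laplacian_def times_divide_eq_left sum_distrib_right
    by (intro arg_cong2[where f="(/)"] sum.cong) (auto simp: algebra_simps)
  have e2: "f x * discrete_laplacian \<delta> \<psi> x = (\<Sum>b\<in>Basis. f x * \<psi> (x + \<delta> *\<^sub>R b) + f x * \<psi> (x - \<delta> *\<^sub>R b)
      - 2 * (f x * \<psi> x)) / \<delta>\<^sup>2" for x
    unfolding discrete_laplacian_def times_divide_eq_right sum_distrib_left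
    by (intro arg_cong2[where f="(/)"] sum.cong) (auto simp: algebra_simps)
  show "integrable lborel (\<lambda>x. discrete_laplacian \<delta> f x * \<psi> x)"
    unfolding e1 using i1 i2 k by auto
  show "integrable lborel (\<lambda>x. f x * discrete_laplacian \<delta> \<psi> x)"
    unfolding e2 using j1 j2 k by auto
  have s1: "(LINT x|lborel. f (x + \<delta> *\<^sub>R b) * \<psi> x) = (LINT x|lborel. f x * \<psi> (x - \<delta> *\<^sub>R b))" for b
    using integral_shift[of "\<lambda>x. f x * \<psi> (x - \<delta> *\<^sub>R b)" "\<delta> *\<^sub>R b"] by simp
  have s2: "(LINT x|lborel. f (x - \<delta> *\<^sub>R b) * \<psi> x) = (LINT x|lborel. f x * \<psi> (x + \<delta> *\<^sub>R b))" for b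
    using integral_shift[of "\<lambda>x. f x * \<psi> (x + \<delta> *\<^sub>R b)" "- (\<delta> *\<^sub>R b)"] by simp
  have "(LINT x|lborel. discrete_laplacian \<delta> f x * \<psi> x) = (\<Sum>b\<in>Basis. (LINT x|lborel. f (x + \<delta> *\<^sub>R b) * \<psi> x)
      + (LINT x|lborel. f (x - \<delta> *\<^sub>R b) * \<psi> x) - 2 * (LINT x|lborel. f x * \<psi> x)) / \<delta>\<^sup>2"
    unfolding e1 using i1 i2 k by (simp add: integral_sum)
  also have "\<dots> = (LINT x|lborel. f x * discrete_laplacian \<delta> \<psi> x)"
    unfolding e2 using j1 j2 k by (simp add: integral_sum s1 s2 add.commute)
  finally show "(LINT x|lborel. discrete_laplacian \<delta> f x * \<psi> x) = (LINT x|lborel. f x * discrete_laplacian \<delta> \<psi> x)" .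
qed

text \<open>For bounded measurable \<psi> of bounded support this is the integral of the squared
  forward difference quotients, summed over the coordinate directions. The form without a gradient
  expands bilinearly in the Euler step.\<close>

definition dirichlet_form :: "real \<Rightarrow> ('a::euclidean_space \<Rightarrow> real) \<Rightarrow> real" where
  "dirichlet_form \<delta> \<psi> = - (LINT x|lborel. \<psi> x * discrete_laplacian \<delta> \<psi> x)"

text \<open>Pointwise, the integrand lies between combinations of squares of \<phi> at
  \<open>x\<close> and its neighbours, by completing squares. All shifted squares have the same
  integral, so the lower combination integrates to 0 and the upper one contributes 4 per direction.
  The upper constant is the one in the step restriction of the scheme.\<close>

lemma dirichlet_form_bounds:
  fixes \<phi> :: "'a::euclidean_space \<Rightarrow> real"
  assumes [measurable]: "\<phi> \<in> borel_measurable borel"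
    and \<phi>: "\<And>x. \<bar>\<phi> x\<bar> \<le> Q" "\<And>x. x \<notin> \<Omega> \<Longrightarrow> \<phi> x = 0" and \<Omega>: "bounded \<Omega>"
  shows "0 \<le> dirichlet_form \<delta> \<phi>" "dirichlet_form \<delta> \<phi> \<le> 4 * DIM('a) / \<delta>\<^sup>2 * (LINT x|lborel. (\<phi> x)\<^sup>2)"
proof -
  obtain r where r: "\<Omega> \<subseteq> cball 0 r" using \<Omega> bounded_subset_cball_ex by blast
  define X where "X = cball (0::'a) (r + \<bar>\<delta>\<bar>)"
  have z: "\<phi> x = 0" if "x \<notin> cball 0 r" for x using that r \<phi>(2) by blast
  have nb: "x + \<delta> *\<^sub>R b \<in> X" "x - \<delta> *\<^sub>R b \<in> X" if "x \<in> cball 0 r" "b \<in> Basis" for x b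
    using that norm_triangle_ineq[of x "\<delta> *\<^sub>R b"] norm_triangle_ineq4[of x "\<delta> *\<^sub>R b"]
    by (auto simp: X_def)
  have iq: "integrable lborel (\<lambda>x. (\<phi> x)\<^sup>2)"
    unfolding power2_eq_square
    by (rule integrable_mult_bounded_support[where X=\<Omega> and P=Q and Q=Q]) (use \<phi> \<Omega> in auto)
  have is1: "integrable lborel (\<lambda>x. (\<phi> (x + c))\<^sup>2)" for c
    unfolding power2_eq_square
  proof (rule integrable_mult_bounded_support[where X="(\<lambda>x. x - c) ` \<Omega>" and P=Q and Q=Q])
    show "\<phi> (x + c) = 0" if "x \<notin> (\<lambda>x. x - c) ` \<Omega>" for x
      using that \<phi>(2)[of "x + c"] by (metis add_diff_cancel_right' image_eqI)
    show "bounded ((\<lambda>x. x - c) ` \<Omega>)" using \<Omega> bounded_translation_minus by blast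
  qed (use \<phi> in auto)
  have is2: "(LINT x|lborel. (\<phi> (x + c))\<^sup>2) = (LINT x|lborel. (\<phi> x)\<^sup>2)" for c
    by (rule integral_shift) measurable
  have is1': "integrable lborel (\<lambda>x. (\<phi> (x - c))\<^sup>2)" for c using is1[of "-c"] by simp
  have is2': "(LINT x|lborel. (\<phi> (x - c))\<^sup>2) = (LINT x|lborel. (\<phi> x)\<^sup>2)" for c using is2[of "-c"] by simp
  let ?g = "\<lambda>x. (\<Sum>b\<in>Basis. (\<phi> (x + \<delta> *\<^sub>R b))\<^sup>2 / 2 + (\<phi> (x - \<delta> *\<^sub>R b))\<^sup>2 / 2 + 3 * (\<phi> x)\<^sup>2) / \<delta>\<^sup>2"
  have le: "- (\<phi> x * discrete_laplacian \<delta> \<phi> x) \<le> ?g x" for x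
  proof -
    have t: "- (a * (b + c - 2 * a)) \<le> b\<^sup>2 / 2 + c\<^sup>2 / 2 + 3 * a\<^sup>2" for a b c :: real
    proof -
      have "0 \<le> (a + b)\<^sup>2 + (a + c)\<^sup>2" by simp
      then show ?thesis by (simp add: power2_eq_square algebra_simps)
    qed
    have "- (\<phi> x * discrete_laplacian \<delta> \<phi> x) =
        (\<Sum>b\<in>Basis. - (\<phi> x * (\<phi> (x + \<delta> *\<^sub>R b) + \<phi> (x - \<delta> *\<^sub>R b) - 2 * \<phi> x))) / \<delta>\<^sup>2"
      by (simp add: discrete_laplacian_def sum_distrib_left sum_negf)
    also have "\<dots> \<le> ?g x" by (intro divide_right_mono sum_mono t) auto
    finally show ?thesis .
  qed
  let ?k = "\<lambda>x. (\<Sum>b\<in>Basis. (\<phi> x)\<^sup>2 - (\<phi> (x + \<delta> *\<^sub>R b))\<^sup>2 / 2 - (\<phi> (x - \<delta> *\<^sub>R b))\<^sup>2 / 2) / \<delta>\<^sup>2"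
  have ge: "?k x \<le> - (\<phi> x * discrete_laplacian \<delta> \<phi> x)" for x
  proof -
    have t: "a\<^sup>2 - b\<^sup>2 / 2 - c\<^sup>2 / 2 \<le> - (a * (b + c - 2 * a))" for a b c :: real
    proof -
      have "0 \<le> (a - b)\<^sup>2 + (a - c)\<^sup>2" by simp
      then show ?thesis by (simp add: power2_eq_square algebra_simps)
    qed
    have "?k x \<le> (\<Sum>b\<in>Basis. - (\<phi> x * (\<phi> (x + \<delta> *\<^sub>R b) + \<phi> (x - \<delta> *\<^sub>R b) - 2 * \<phi> x))) / \<delta>\<^sup>2"
      by (intro divide_right_mono sum_mono t) auto
    also have "\<dots> = - (\<phi> x * discrete_laplacian \<delta> \<phi> x)"
      by (simp add: discrete_laplacian_def sum_distrib_left sum_negf)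
    finally show ?thesis .
  qed
  have i: "integrable lborel (\<lambda>x. \<phi> x * discrete_laplacian \<delta> \<phi> x)"
    by (rule discrete_laplacian_by_parts(2)[where X=X and P=Q and Q=Q and \<Omega>="cball 0 r"])
      (use \<phi> z nb in \<open>auto simp: X_def\<close>)
  have "(LINT x|lborel. ?k x) \<le> dirichlet_form \<delta> \<phi>"
    unfolding dirichlet_form_def integral_minus[symmetric]
    using is1 is1' iq i by (intro integral_mono ge) (auto intro!: Bochner_Integration.integrable_sum)
  moreover have "(LINT x|lborel. ?k x) = 0"
    using is1 is1' iq by (simp add: integral_sum is2 is2')
  ultimately show "0 \<le> dirichlet_form \<delta> \<phi>" by (simp only:)
  from i have "dirichlet_form \<delta> \<phi> \<le> (LINT x|lborel. ?g x)"
    unfolding dirichlet_form_def integral_minus[symmetric]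
    using is1 is1' iq by (intro integral_mono le) (auto intro!: Bochner_Integration.integrable_sum)
  also have "\<dots> = (\<Sum>b\<in>(Basis::'a set). 4 * (LINT x|lborel. (\<phi> x)\<^sup>2)) / \<delta>\<^sup>2"
    using is1 is1' iq by (simp add: integral_sum is2 is2')
  finally show "dirichlet_form \<delta> \<phi> \<le> 4 * DIM('a) / \<delta>\<^sup>2 * (LINT x|lborel. (\<phi> x)\<^sup>2)"
    by (simp add: mult_ac)
qed

text \<open>
  One backward explicit Euler step of the dual equation $\psi_t + \alpha\Delta\psi = 0$ with Dirichlet
  condition. Errors that enter the primal equation under the Laplacian are paid for by the decrease of
  the Dirichlet form, because $\alpha \ge \nu > 0$; the upper bound on \<open>h\<close> gives both
  positivity and this decrease.
\<close>
lemma dual_step: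
  fixes \<psi> \<zeta> \<zeta>' Y z Z \<alpha> :: "'a::euclidean_space \<Rightarrow> real"
    and R \<Theta> \<nu> A h \<delta> \<eta> \<mu> B P :: real
  defines "\<Omega> \<equiv> ball 0 R" and "X \<equiv> cball 0 (R + 1)"
  assumes meas [measurable]: "\<psi> \<in> borel_measurable borel" "\<zeta> \<in> borel_measurable borel"
      "\<zeta>' \<in> borel_measurable borel" "Y \<in> borel_measurable borel" "\<alpha> \<in> borel_measurable borel"
    and \<psi>: "\<And>x. 0 \<le> \<psi> x" "\<And>x. \<psi> x \<le> \<Theta>" "\<And>x. x \<notin> \<Omega> \<Longrightarrow> \<psi> x = 0"
    and \<alpha>: "\<And>x. x \<in> \<Omega> \<Longrightarrow> \<nu> \<le> \<alpha> x" "\<And>x. x \<in> \<Omega> \<Longrightarrow> \<alpha> x \<le> A" and \<nu>: "0 < \<nu>"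
    and h: "0 < h" "h * (4 * DIM('a) * A) \<le> \<delta>\<^sup>2" and \<delta>: "0 < \<delta>" "\<delta> \<le> 1" and \<eta>: "0 \<le> \<eta>" and \<mu>: "0 < \<mu>"
    and z: "\<And>x. x \<in> X \<Longrightarrow> \<bar>z x\<bar> \<le> B" and Z: "\<And>x. x \<in> \<Omega> \<Longrightarrow> Z x = (\<alpha> x - \<nu>) * z x"
    and Zneg: "\<And>x. x \<in> X - \<Omega> \<Longrightarrow> Z x \<le> 0"
    and bdd: "\<And>x. x \<in> X \<Longrightarrow> \<bar>\<zeta>' x\<bar> \<le> P" "\<And>x. x \<in> X \<Longrightarrow> \<bar>Y x\<bar> \<le> P"
    and \<zeta>z: "\<And>x. x \<in> X \<Longrightarrow> \<bar>\<zeta> x - z x\<bar> \<le> \<eta>" and YZ: "\<And>x. x \<in> X \<Longrightarrow> \<bar>Y x - Z x\<bar> \<le> \<eta>"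
    and evol: "\<And>x. x \<in> \<Omega> \<Longrightarrow> \<zeta>' x - \<zeta> x \<le> h * (discrete_laplacian \<delta> Y x + \<eta>)"
  defines "E \<equiv> 2 * \<eta> + A * \<eta> + \<nu> * B" and "V \<equiv> measure lborel \<Omega>"
  defines "\<psi>' \<equiv> \<lambda>x. if x \<in> \<Omega> then \<psi> x + h * \<alpha> x * discrete_laplacian \<delta> \<psi> x else 0"
  shows "\<psi>' \<in> borel_measurable borel" "\<And>x. 0 \<le> \<psi>' x" "\<And>x. \<psi>' x \<le> \<Theta>" "\<And>x. x \<notin> \<Omega> \<Longrightarrow> \<psi>' x = 0"
    "(LINT x|lborel. \<zeta>' x * \<psi> x) \<le> (LINT x|lborel. \<zeta> x * \<psi>' x)
       + h * (E * \<mu> * V / 2 + \<eta> * \<Theta> * V) + E / (2 * \<nu> * \<mu>) * (dirichlet_form \<delta> \<psi> - dirichlet_form \<delta> \<psi>')"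
proof -
  define N where "N = real DIM('a)"
  have N: "N > 0" by (simp add: N_def)
  have h2: "h * (4 * N * A) \<le> \<delta>\<^sup>2" using h(2) by (simp add: N_def)
  have [measurable]: "\<Omega> \<in> sets borel" by (simp add: \<Omega>_def)
  show m' [measurable]: "\<psi>' \<in> borel_measurable borel" unfolding \<psi>'_def by measurable
  show off: "\<psi>' x = 0" if "x \<notin> \<Omega>" for x using that by (simp add: \<psi>'_def)
  have \<Theta>: "0 \<le> \<Theta>" using \<psi>(1,2)[of 0] by linarith
  \<comment> \<open>The new value is a combination of the old values at \<open>x\<close> and its 2N
    neighbours with weights \<open>1 - 2 * N * c\<close> and \<open>c\<close>. The step restriction
    makes these nonnegative; they sum to 1, so the bounds 0 and \<Theta> persist.\<close>
  have conv: "0 \<le> \<psi>' x \<and> \<psi>' x \<le> \<Theta>" for x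
  proof (cases "x \<in> \<Omega>")
    case x: True
    define S where "S = (\<Sum>b\<in>Basis. \<psi> (x + \<delta> *\<^sub>R b) + \<psi> (x - \<delta> *\<^sub>R b))"
    define c where "c = h * \<alpha> x / \<delta>\<^sup>2"
    have "discrete_laplacian \<delta> \<psi> x = (S - 2 * N * \<psi> x) / \<delta>\<^sup>2"
      by (simp add: discrete_laplacian_def S_def sum_subtractf N_def)
    then have "\<psi>' x = \<psi> x + h * \<alpha> x * ((S - 2 * N * \<psi> x) / \<delta>\<^sup>2)" using x by (simp add: \<psi>'_def)
    then have eq: "\<psi>' x = \<psi> x * (1 - 2 * N * c) + c * S"
      by (simp add: c_def diff_divide_distrib algebra_simps)
    have c0: "0 \<le> c" using h \<alpha>(1)[OF x] \<nu> by (simp add: c_def)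
    have "h * (4 * N * \<alpha> x) \<le> h * (4 * N * A)" using h \<alpha>(2)[OF x] N by (intro mult_left_mono) auto
    with h2 have "h * (4 * N * \<alpha> x) \<le> \<delta>\<^sup>2" by linarith
    then have "4 * N * (h * \<alpha> x) \<le> \<delta>\<^sup>2" by (simp add: mult_ac)
    then have "4 * N * c \<le> 1" using \<delta> by (simp add: c_def field_simps)
    then have c1: "0 \<le> 1 - 2 * N * c" using N c0 mult_nonneg_nonneg[of N c] by linarith
    have S0: "0 \<le> S" unfolding S_def using \<psi>(1) by (intro sum_nonneg add_nonneg_nonneg) auto
    have "S \<le> (\<Sum>b\<in>(Basis::'a set). \<Theta> + \<Theta>)" unfolding S_def using \<psi>(2) by (intro sum_mono add_mono) auto
    then have S1: "S \<le> 2 * N * \<Theta>" by (simp add: N_def)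
    have "\<psi>' x \<le> \<Theta> * (1 - 2 * N * c) + c * (2 * N * \<Theta>)"
      unfolding eq using c0 c1 S1 \<psi>(2)[of x] by (intro add_mono mult_right_mono mult_left_mono) auto
    also have "\<dots> = \<Theta>" by (simp add: algebra_simps)
    finally have "\<psi>' x \<le> \<Theta>" .
    moreover have "0 \<le> \<psi>' x" unfolding eq using c0 c1 S0 \<psi>(1)[of x] by simp
    ultimately show ?thesis by simp
  qed (use off \<Theta> in auto)
  then show "0 \<le> \<psi>' x" "\<psi>' x \<le> \<Theta>" for x by auto
  have b\<Omega>: "bounded \<Omega>" and bX: "bounded X" and sub: "\<Omega> \<subseteq> X" by (auto simp: \<Omega>_def X_def)
  have nb: "x + \<delta> *\<^sub>R b \<in> X" "x - \<delta> *\<^sub>R b \<in> X" if "x \<in> \<Omega>" "b \<in> Basis" for x b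
    using that norm_triangle_ineq[of x "\<delta> *\<^sub>R b"] norm_triangle_ineq4[of x "\<delta> *\<^sub>R b"] \<delta>
    by (auto simp: X_def \<Omega>_def)
  have a\<psi>: "\<bar>\<psi> x\<bar> \<le> \<Theta>" for x using \<psi>(1,2)[of x] by simp
  have a\<psi>': "\<bar>\<psi>' x\<bar> \<le> \<Theta>" for x using conv[of x] by simp
  define s where "s = discrete_laplacian \<delta> \<psi>"
  have [measurable]: "s \<in> borel_measurable borel" by (simp add: s_def)
  define \<phi> where "\<phi> x = (if x \<in> \<Omega> then \<alpha> x * s x else 0)" for x
  have [measurable]: "\<phi> \<in> borel_measurable borel" unfolding \<phi>_def[abs_def] by measurable
  have \<psi>'\<phi>: "\<psi>' x = \<psi> x + h * \<phi> x" for x using \<psi>(3) by (simp add: \<psi>'_def \<phi>_def s_def)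
  have \<phi>off: "\<phi> x = 0" if "x \<notin> \<Omega>" for x using that by (simp add: \<phi>_def)
  have a\<phi>: "\<bar>\<phi> x\<bar> \<le> \<Theta> / h" for x
  proof -
    have "\<bar>h * \<phi> x\<bar> \<le> \<Theta>" using \<psi>'\<phi>[of x] \<psi>(1,2)[of x] conv[of x] by linarith
    then show ?thesis using h by (simp add: abs_mult field_simps)
  qed
  note bp = discrete_laplacian_by_parts[where X=X and \<Omega>=\<Omega> and \<delta>=\<delta>, OF _ _ _ _ _ bX sub nb]
  have i\<psi>s: "integrable lborel (\<lambda>x. \<psi> x * s x)" unfolding s_def
    by (rule bp(2)[where P=\<Theta> and Q=\<Theta>]) (use \<psi> a\<psi> in auto)
  have i\<phi>s: "integrable lborel (\<lambda>x. \<phi> x * s x)" unfolding s_def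
    by (rule bp(2)[where P="\<Theta>/h" and Q=\<Theta>]) (use \<psi> a\<psi> a\<phi> in auto)
  have i\<psi>\<phi>: "integrable lborel (\<lambda>x. \<psi> x * discrete_laplacian \<delta> \<phi> x)"
    by (rule bp(2)[where Q="\<Theta>/h" and P=\<Theta>]) (use \<phi>off a\<psi> a\<phi> in auto)
  have i\<phi>\<phi>: "integrable lborel (\<lambda>x. \<phi> x * discrete_laplacian \<delta> \<phi> x)"
    by (rule bp(2)[where P="\<Theta>/h" and Q="\<Theta>/h"]) (use \<phi>off a\<phi> in auto)
  have sym: "(LINT x|lborel. \<psi> x * discrete_laplacian \<delta> \<phi> x) = (LINT x|lborel. \<phi> x * s x)"
    unfolding s_def
    by (subst bp(3)[symmetric, where P=\<Theta> and Q="\<Theta>/h"])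
      (use \<phi>off a\<psi> a\<phi> in \<open>auto simp: mult.commute\<close>)
  have i\<phi>2: "integrable lborel (\<lambda>x. (\<phi> x)\<^sup>2)" unfolding power2_eq_square
    by (rule integrable_mult_bounded_support[where X=\<Omega> and P="\<Theta>/h" and Q="\<Theta>/h"]) (use \<phi>off a\<phi> b\<Omega> in auto)
  define J where "J = (LINT x|lborel. \<phi> x * s x)"
  \<comment> \<open>Expanding the form at \<open>\<psi> + h \<phi>\<close> gives a decrease
    \<open>2 * h * J\<close> and a quadratic remainder. The step restriction, which has room for
    this, bounds the remainder by \<open>h * J\<close>, so one of the two copies survives.\<close>
  have energy: "h * J \<le> dirichlet_form \<delta> \<psi> - dirichlet_form \<delta> \<psi>'"
  proof -
    have "\<psi>' x * discrete_laplacian \<delta> \<psi>' x = \<psi> x * s x + h * (\<phi> x * s x) + h * (\<psi> x * discrete_laplacian \<delta> \<phi> x) + h * (h * (\<phi> x * discrete_laplacian \<delta> \<phi> x))" for x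
      unfolding \<psi>'\<phi>[abs_def] discrete_laplacian_add discrete_laplacian_cmult s_def by (simp add: algebra_simps)
    then have "dirichlet_form \<delta> \<psi>' = dirichlet_form \<delta> \<psi> - 2 * h * J + h * (h * dirichlet_form \<delta> \<phi>)"
      using i\<psi>s i\<phi>s i\<psi>\<phi> i\<phi>\<phi> sym by (simp add: dirichlet_form_def J_def s_def)
    moreover have "h * dirichlet_form \<delta> \<phi> \<le> J"
    proof -
      have "h * dirichlet_form \<delta> \<phi> \<le> h * (4 * N / \<delta>\<^sup>2 * (LINT x|lborel. (\<phi> x)\<^sup>2))"
        using dirichlet_form_bounds(2)[of \<phi> "\<Theta>/h" \<Omega> \<delta>] \<phi>off a\<phi> b\<Omega> h
        by (intro mult_left_mono) (auto simp: N_def)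
      also have "\<dots> = (LINT x|lborel. h * 4 * N / \<delta>\<^sup>2 * (\<phi> x)\<^sup>2)" by simp
      also have "\<dots> \<le> J" unfolding J_def
      proof (rule integral_mono)
        fix x
        show "h * 4 * N / \<delta>\<^sup>2 * (\<phi> x)\<^sup>2 \<le> \<phi> x * s x"
        proof (cases "x \<in> \<Omega>")
          case x: True
          have "h * (4 * N * \<alpha> x) \<le> h * (4 * N * A)" using h \<alpha>(2)[OF x] N by (intro mult_left_mono) auto
          with h2 have "h * (4 * N * \<alpha> x) \<le> \<delta>\<^sup>2" by linarith
          then have "h * 4 * N / \<delta>\<^sup>2 * \<alpha> x \<le> 1" using \<delta> by (simp add: field_simps)
          moreover have "0 \<le> \<alpha> x * (s x)\<^sup>2" using \<alpha>(1)[OF x] \<nu> by simp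
          ultimately have "(h * 4 * N / \<delta>\<^sup>2 * \<alpha> x) * (\<alpha> x * (s x)\<^sup>2) \<le> 1 * (\<alpha> x * (s x)\<^sup>2)"
            by (intro mult_right_mono)
          then show ?thesis using x by (simp add: \<phi>_def power2_eq_square algebra_simps)
        qed (simp add: \<phi>off)
      qed (use i\<phi>2 i\<phi>s in auto)
      finally show ?thesis .
    qed
    then have "h * (h * dirichlet_form \<delta> \<phi>) \<le> h * J" using h by (intro mult_left_mono) auto
    ultimately show ?thesis by linarith
  qed
  \<comment> \<open>Lowering \<open>Y\<close> by \<eta> leaves its discrete Laplacian unchanged and
    makes it nonpositive on the collar \<open>X - \<Omega>\<close>, where \<open>Z\<close> is
    nonpositive and \<open>Y\<close> is within \<eta> of \<open>Z\<close>.\<close>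
  define Y' where "Y' x = Y x - \<eta>" for x
  have [measurable]: "Y' \<in> borel_measurable borel" unfolding Y'_def[abs_def] by measurable
  have bY': "\<bar>Y' x\<bar> \<le> P + \<eta>" if "x \<in> X" for x using bdd(2)[OF that] \<eta> by (auto simp: Y'_def)
  have b\<zeta>: "\<bar>\<zeta> x\<bar> \<le> B + \<eta>" if "x \<in> X" for x using z[OF that] \<zeta>z[OF that] by linarith
  have sdY': "discrete_laplacian \<delta> Y' x = discrete_laplacian \<delta> Y x" for x by (simp add: Y'_def[abs_def] discrete_laplacian_diff discrete_laplacian_const)
  have i_1: "integrable lborel (\<lambda>x. \<zeta>' x * \<psi> x)"
    by (rule integrable_mult_bounded_support[where X=\<Omega> and P="P" and Q="\<Theta>"])
      (use bdd b\<zeta> a\<psi> a\<phi> \<psi>(3) \<phi>off b\<Omega> sub in auto)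
  have i_2: "integrable lborel (\<lambda>x. \<zeta> x * \<psi> x)"
    by (rule integrable_mult_bounded_support[where X=\<Omega> and P="B + \<eta>" and Q="\<Theta>"])
      (use bdd b\<zeta> a\<psi> a\<phi> \<psi>(3) \<phi>off b\<Omega> sub in auto)
  have i_3: "integrable lborel (\<lambda>x. \<zeta> x * \<phi> x)"
    by (rule integrable_mult_bounded_support[where X=\<Omega> and P="B + \<eta>" and Q="\<Theta> / h"])
      (use bdd b\<zeta> a\<psi> a\<phi> \<psi>(3) \<phi>off b\<Omega> sub in auto)
  have i_4: "integrable lborel (\<lambda>x. 1 * \<psi> x)"
    by (rule integrable_mult_bounded_support[where X=\<Omega> and P="1" and Q="\<Theta>"])
      (use bdd b\<zeta> a\<psi> a\<phi> \<psi>(3) \<phi>off b\<Omega> sub in auto)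
  note i1 = i_1 i_2 i_3 i_4
  have i2: "integrable lborel (\<lambda>x. discrete_laplacian \<delta> Y' x * \<psi> x)" "integrable lborel (\<lambda>x. Y' x * s x)"
    "(LINT x|lborel. discrete_laplacian \<delta> Y' x * \<psi> x) = (LINT x|lborel. Y' x * s x)"
    unfolding s_def by (rule bp[where P="P+\<eta>" and Q=\<Theta>], use bY' a\<psi> \<psi>(3) in auto)+
  have step: "(LINT x|lborel. \<zeta>' x * \<psi> x) - (LINT x|lborel. \<zeta> x * \<psi> x)
      \<le> h * (LINT x|lborel. Y' x * s x) + h * \<eta> * (LINT x|lborel. \<psi> x)"
  proof -
    have "(LINT x|lborel. \<zeta>' x * \<psi> x) - (LINT x|lborel. \<zeta> x * \<psi> x) = (LINT x|lborel. \<zeta>' x * \<psi> x - \<zeta> x * \<psi> x)"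
      using i1 by simp
    also have "\<dots> \<le> (LINT x|lborel. h * (discrete_laplacian \<delta> Y' x * \<psi> x) + h * \<eta> * \<psi> x)"
    proof (rule integral_mono)
      fix x
      show "\<zeta>' x * \<psi> x - \<zeta> x * \<psi> x \<le> h * (discrete_laplacian \<delta> Y' x * \<psi> x) + h * \<eta> * \<psi> x"
      proof (cases "x \<in> \<Omega>")
        case True
        from mult_right_mono[OF evol[OF True] \<psi>(1)[of x]] show ?thesis
          by (simp add: sdY' algebra_simps)
      qed (simp add: \<psi>)
    qed (use i1 i2 in auto)
    also have "\<dots> = h * (LINT x|lborel. Y' x * s x) + h * \<eta> * (LINT x|lborel. \<psi> x)"
      using i1 i2 by simp
    finally show ?thesis .
  qed
  have ind: "integrable lborel (\<lambda>x. indicator \<Omega> x :: real)" "(LINT x|lborel. indicator \<Omega> x :: real) = V"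
    using emeasure_bounded_finite[OF b\<Omega>] by (auto simp: V_def)
  have \<psi>V: "(LINT x|lborel. \<psi> x) \<le> \<Theta> * V"
  proof -
    have "(LINT x|lborel. \<psi> x) \<le> (LINT x|lborel. \<Theta> * (indicator \<Omega> x :: real))"
      using i1 ind \<psi> by (intro integral_mono) (auto simp: indicator_def)
    then show ?thesis using ind by simp
  qed
  \<comment> \<open>A point of \<open>\<Omega>\<close> is needed to see that \<open>A\<close> is
    nonnegative. For \<open>R \<le> 0\<close> the ball is empty; this is why \<open>K0\<close> below
    has a second case.\<close>
  have E0: "0 \<le> E" if "x \<in> \<Omega>" for x
  proof -
    have "0 \<le> A" "0 \<le> B" using \<alpha>[OF that] \<nu> z[of x] that sub by force+
    then show ?thesis using \<eta> \<nu> by (simp add: E_def)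
  qed
  \<comment> \<open>Inside \<open>\<Omega>\<close> the integrand is \<open>s\<close> times a
    residual of size at most \<open>E\<close>: mollification errors plus the cost of \<nu>. Young's
    inequality with weight \<mu> separates residual and \<open>s\<close>, and
    \<open>1 \<le> \<alpha> / \<nu>\<close> turns the square of \<open>s\<close> into the density of
    \<open>J\<close>, which the energy decrease pays for.\<close>
  have main: "(LINT x|lborel. Y' x * s x) - (LINT x|lborel. \<zeta> x * \<phi> x) \<le> E * \<mu> * V / 2 + E / (2 * \<nu> * \<mu>) * J"
  proof -
    have "(LINT x|lborel. Y' x * s x) - (LINT x|lborel. \<zeta> x * \<phi> x) = (LINT x|lborel. Y' x * s x - \<zeta> x * \<phi> x)"
      using i1 i2 by simp
    also have "\<dots> \<le> (LINT x|lborel. E * \<mu> / 2 * indicator \<Omega> x + E / (2 * \<nu> * \<mu>) * (\<phi> x * s x))"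
    proof (rule integral_mono)
      fix x
      show "Y' x * s x - \<zeta> x * \<phi> x \<le> E * \<mu> / 2 * indicator \<Omega> x + E / (2 * \<nu> * \<mu>) * (\<phi> x * s x)"
      proof (cases "x \<in> \<Omega>")
        case x: True
        then have xX: "x \<in> X" using sub by blast
        have A0: "0 \<le> \<alpha> x" "0 < \<alpha> x" using \<alpha>(1)[OF x] \<nu> by auto
        have "Y' x - \<alpha> x * \<zeta> x = (Y x - Z x) - \<eta> - \<alpha> x * (\<zeta> x - z x) - \<nu> * z x"
          using Z[OF x] by (simp add: Y'_def algebra_simps)
        moreover have "\<bar>\<alpha> x * (\<zeta> x - z x)\<bar> \<le> A * \<eta>"
          unfolding abs_mult using \<alpha>(2)[OF x] A0 \<zeta>z[OF xX] by (intro mult_mono) auto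
        moreover have "\<bar>\<nu> * z x\<bar> \<le> \<nu> * B" using \<nu> z[OF xX] by (auto simp: abs_mult)
        ultimately have br: "\<bar>Y' x - \<alpha> x * \<zeta> x\<bar> \<le> E" using YZ[OF xX] by (simp add: E_def abs_le_iff)
        have "Y' x * s x - \<zeta> x * \<phi> x = (Y' x - \<alpha> x * \<zeta> x) * s x" using x by (simp add: \<phi>_def algebra_simps)
        also have "\<dots> \<le> \<bar>Y' x - \<alpha> x * \<zeta> x\<bar> * \<bar>s x\<bar>" by (simp add: abs_mult[symmetric])
        also have "\<dots> \<le> E * \<bar>s x\<bar>" using br by (intro mult_right_mono) auto
        also have "\<dots> \<le> E * (\<mu> / 2 + (s x)\<^sup>2 / (2 * \<mu>))"
        proof (rule mult_left_mono)
          have "0 \<le> (\<mu> - \<bar>s x\<bar>)\<^sup>2" by simp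
          then show "\<bar>s x\<bar> \<le> \<mu> / 2 + (s x)\<^sup>2 / (2 * \<mu>)"
            using \<mu> by (simp add: field_simps power2_eq_square)
        qed (use E0 x in auto)
        also have "\<dots> \<le> E * (\<mu> / 2 + (\<alpha> x / \<nu>) * (s x)\<^sup>2 / (2 * \<mu>))"
        proof -
          have "1 * (s x)\<^sup>2 \<le> (\<alpha> x / \<nu>) * (s x)\<^sup>2" using \<alpha>(1)[OF x] \<nu> by (intro mult_right_mono) auto
          then show ?thesis using E0 x \<mu> by (intro mult_left_mono add_left_mono divide_right_mono) auto
        qed
        also have "\<dots> = E * \<mu> / 2 + E / (2 * \<nu> * \<mu>) * (\<phi> x * s x)"
          using x \<mu> \<nu> by (simp add: \<phi>_def field_simps power2_eq_square)
        finally show ?thesis using x by simp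
      next
        case x: False
        \<comment> \<open>This is the boundary term of the Dirichlet problem. Off
          \<open>\<Omega>\<close> the nonnegative \<psi> vanishes, so its discrete Laplacian is
          nonnegative there, and it is zero beyond the collar.\<close>
        have "Y' x * s x \<le> 0"
        proof (cases "x \<in> X")
          case True
          have "Y' x \<le> 0" using Zneg[of x] YZ[of x] True x by (auto simp: Y'_def abs_le_iff)
          moreover have "0 \<le> s x" unfolding s_def discrete_laplacian_def using \<psi>(1) \<psi>(3)[OF x]
            by (intro divide_nonneg_nonneg sum_nonneg) auto
          ultimately show ?thesis by (rule mult_nonpos_nonneg)
        next
          case False
          have "\<psi> (x + \<delta> *\<^sub>R b) = 0" "\<psi> (x - \<delta> *\<^sub>R b) = 0" if "b \<in> Basis" for b
            using nb(2)[of "x + \<delta> *\<^sub>R b" b] nb(1)[of "x - \<delta> *\<^sub>R b" b] that False \<psi>(3) by force+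
          then have "s x = 0" using \<psi>(3)[OF x] by (simp add: s_def discrete_laplacian_def)
          then show ?thesis by simp
        qed
        then show ?thesis using x by (simp add: \<phi>off)
      qed
    qed (use i1 i2 ind i\<phi>s in auto)
    also have "\<dots> = E * \<mu> * V / 2 + E / (2 * \<nu> * \<mu>) * J" using ind i\<phi>s by (simp add: J_def)
    finally show ?thesis .
  qed
  have \<zeta>\<psi>': "(LINT x|lborel. \<zeta> x * \<psi>' x) = (LINT x|lborel. \<zeta> x * \<psi> x) + h * (LINT x|lborel. \<zeta> x * \<phi> x)"
  proof -
    have "\<zeta> x * \<psi>' x = \<zeta> x * \<psi> x + h * (\<zeta> x * \<phi> x)" for x by (simp add: \<psi>'\<phi> algebra_simps)
    then show ?thesis using i1 by simp
  qed
  have K0: "0 \<le> E / (2 * \<nu> * \<mu>) \<or> \<Omega> = {}" using E0 \<nu> \<mu> by (cases "\<Omega> = {}") auto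
  have J': "E / (2 * \<nu> * \<mu>) * (h * J) \<le> E / (2 * \<nu> * \<mu>) * (dirichlet_form \<delta> \<psi> - dirichlet_form \<delta> \<psi>')"
    using K0
  proof
    assume "\<Omega> = {}"
    then have "\<psi>' = \<psi>" "\<phi> = (\<lambda>x. 0)" using \<psi>(3) off \<phi>off by auto
    then show ?thesis by (simp add: J_def)
  qed (rule mult_left_mono[OF energy])
  have "h * ((LINT x|lborel. Y' x * s x) - (LINT x|lborel. \<zeta> x * \<phi> x))
      \<le> h * (E * \<mu> * V / 2 + E / (2 * \<nu> * \<mu>) * J)"
    using h main by (intro mult_left_mono) auto
  moreover have "h * \<eta> * (LINT x|lborel. \<psi> x) \<le> h * \<eta> * (\<Theta> * V)"
    using h \<eta> \<psi>V by (intro mult_left_mono) auto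
  ultimately show "(LINT x|lborel. \<zeta>' x * \<psi> x) \<le> (LINT x|lborel. \<zeta> x * \<psi>' x)
       + h * (E * \<mu> * V / 2 + \<eta> * \<Theta> * V) + E / (2 * \<nu> * \<mu>) * (dirichlet_form \<delta> \<psi> - dirichlet_form \<delta> \<psi>')"
    using step \<zeta>\<psi>' J' by (simp add: algebra_simps)
qed

section \<open>Polynomial bump functions\<close>

text \<open>The cube makes the bump twice continuously differentiable.\<close>
definition bump :: "real \<Rightarrow> 'a::euclidean_space \<Rightarrow> real" where
  "bump r x = (max 0 (r\<^sup>2 - x \<bullet> x)) ^ 3"

definition bump_grad :: "real \<Rightarrow> 'a::euclidean_space \<Rightarrow> 'a" where
  "bump_grad r x = (- 6 * (max 0 (r\<^sup>2 - x \<bullet> x))\<^sup>2) *\<^sub>R x"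

definition bump_hess :: "real \<Rightarrow> 'a::euclidean_space \<Rightarrow> 'a \<Rightarrow>\<^sub>L 'a" where
  "bump_hess r x = (- 6 * (max 0 (r\<^sup>2 - x \<bullet> x))\<^sup>2) *\<^sub>R id_blinfun
     + (24 * max 0 (r\<^sup>2 - x \<bullet> x)) *\<^sub>R (blinfun_scaleR_left x o\<^sub>L blinfun_inner_right x)"

definition lap_bump :: "real \<Rightarrow> 'a::euclidean_space \<Rightarrow> real" where
  "lap_bump r x = blinfun_trace (bump_hess r x)"

lemma max_0_power_has_derivative:
  fixes s :: real
  assumes "n \<ge> 1"
  shows "((\<lambda>s. max 0 s ^ Suc n) has_real_derivative real (Suc n) * max 0 s ^ n) (at s)"
proof -
  consider "s > 0" | "s < 0" | "s = 0" by linarith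
  then show ?thesis
  proof cases
    case 1
    have "((\<lambda>s. s ^ Suc n) has_real_derivative real (Suc n) * s ^ n) (at s)"
      using DERIV_pow[of "Suc n" s] by simp
    then have "((\<lambda>s. max 0 s ^ Suc n) has_real_derivative real (Suc n) * s ^ n) (at s)"
      by (rule has_field_derivative_transform_within_open[where S="{0<..}"]) (use 1 in auto)
    then show ?thesis using 1 by simp
  next
    case 2
    have "((\<lambda>s. 0) has_real_derivative 0) (at s)" by simp
    then have "((\<lambda>s. max 0 s ^ Suc n) has_real_derivative 0) (at s)"
      by (rule has_field_derivative_transform_within_open[where S="{..<0}"]) (use 2 in auto)
    then show ?thesis using 2 assms by (simp add: power_0_left)
  next
    case 3
    have "((\<lambda>h::real. max 0 h ^ n) \<longlongrightarrow> 0) (at 0)"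
      using assms by (auto intro!: tendsto_eq_intros simp: power_0_left)
    \<comment> \<open>At 0 the difference quotient is again a power of the positive part, also for
      negative \<open>h\<close>, where both sides are 0 because \<open>n\<close> is
      positive.\<close>
    moreover have "\<forall>\<^sub>F h::real in at 0. max 0 h ^ n = (max 0 (0 + h) ^ Suc n - max 0 0 ^ Suc n) / h"
      using assms by (auto simp: eventually_at_filter max_def intro!: always_eventually)
    ultimately have "((\<lambda>h::real. (max 0 (0 + h) ^ Suc n - max 0 0 ^ Suc n) / h) \<longlongrightarrow> 0) (at 0)"
      by (rule Lim_transform_eventually)
    then show ?thesis using 3 assms by (simp add: DERIV_def power_0_left)
  qed
qed

lemma max_has_derivative:
  fixes x :: "'a::euclidean_space"
  assumes "n \<ge> 1"
  shows "((\<lambda>x. max 0 (r\<^sup>2 - x \<bullet> x) ^ Suc n) has_derivative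
     (\<lambda>h. real (Suc n) * max 0 (r\<^sup>2 - x \<bullet> x) ^ n * (- 2 * (x \<bullet> h)))) (at x)"
proof -
  have "((\<lambda>x. r\<^sup>2 - x \<bullet> x) has_derivative (\<lambda>h. - 2 * (x \<bullet> h))) (at x)"
    by (auto intro!: derivative_eq_intros simp: inner_commute)
  from has_derivative_compose[OF this max_0_power_has_derivative[OF assms, unfolded has_field_derivative_def]]
  show ?thesis by simp
qed

lemma bump_GDERIV: "GDERIV (bump r) x :> bump_grad r x"
proof -
  have "(bump r has_derivative (\<lambda>h. 3 * max 0 (r\<^sup>2 - x \<bullet> x) ^ 2 * (- 2 * (x \<bullet> h)))) (at x)"
    using max_has_derivative[of 2 r x] unfolding bump_def[abs_def] by (simp add: numeral_3_eq_3)
  then show ?thesis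
    by (simp add: gderiv_def bump_grad_def inner_commute algebra_simps)
qed

lemma bump_hess_apply: "bump_hess r x v = (- 6 * (max 0 (r\<^sup>2 - x \<bullet> x))\<^sup>2) *\<^sub>R v
     + (24 * max 0 (r\<^sup>2 - x \<bullet> x) * (x \<bullet> v)) *\<^sub>R x"
  by (simp add: bump_hess_def blinfun.bilinear_simps algebra_simps)

lemma bump_grad_has_derivative: "(bump_grad r has_derivative bump_hess r x) (at x)"
proof -
  have "((\<lambda>x. max 0 (r\<^sup>2 - x \<bullet> x) ^ 2) has_derivative
     (\<lambda>h. 2 * max 0 (r\<^sup>2 - x \<bullet> x) * (- 2 * (x \<bullet> h)))) (at x)"
    using max_has_derivative[of 1 r x] by (simp add: numeral_2_eq_2)
  from has_derivative_scaleR[OF has_derivative_mult_right[OF this, of "- 6"] has_derivative_ident]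
  show ?thesis unfolding bump_grad_def[abs_def]
    by (rule has_derivative_eq_rhs) (auto simp: bump_hess_apply algebra_simps)
qed

lemma continuous_bump [continuous_intros]:
  "continuous_on S (bump r)" "continuous_on S (bump_grad r)" "continuous_on S (bump_hess r)"
  "continuous_on S (lap_bump r)"
  unfolding bump_def[abs_def] bump_grad_def[abs_def] bump_hess_def[abs_def] lap_bump_def[abs_def]
    blinfun_trace_def
  by (auto intro!: continuous_intros)

lemma bump_measurable [measurable]:
  "bump r \<in> borel_measurable borel" "lap_bump r \<in> borel_measurable borel"
  by (auto intro!: borel_measurable_continuous_onI continuous_bump)

lemma bump_outside:
  assumes "r \<ge> 0" "norm x \<ge> r"
  shows "bump r x = 0" "bump_grad r x = 0" "bump_hess r x = 0" "lap_bump r x = 0"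
proof -
  have "r\<^sup>2 \<le> x \<bullet> x" using power_mono[of r "norm x" 2] assms by (simp add: power2_norm_eq_inner)
  then show "bump r x = 0" "bump_grad r x = 0" "bump_hess r x = 0" "lap_bump r x = 0"
    by (auto simp: bump_def bump_grad_def bump_hess_def lap_bump_def blinfun_trace_def)
qed

lemma bump_nonneg: "0 \<le> bump r x" and bump_le: "bump r x \<le> (r\<^sup>2)^3"
  unfolding bump_def by (simp, rule power_mono) auto

lemma bump_pos: "norm x < r \<Longrightarrow> 0 < bump r x"
  using power_strict_mono[of "norm x" r 2]
  by (auto simp: bump_def power2_norm_eq_inner[symmetric] intro!: zero_less_power)

lemma lap_bump_eq:
  fixes x :: "'a::euclidean_space"
  shows "lap_bump r x = - 6 * DIM('a) * (max 0 (r\<^sup>2 - x \<bullet> x))\<^sup>2 + 24 * max 0 (r\<^sup>2 - x \<bullet> x) * (x \<bullet> x)"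
proof -
  have "lap_bump r x = (\<Sum>b\<in>(Basis::'a set). - 6 * (max 0 (r\<^sup>2 - x \<bullet> x))\<^sup>2
      + 24 * max 0 (r\<^sup>2 - x \<bullet> x) * ((x \<bullet> b) * (x \<bullet> b)))"
    unfolding lap_bump_def blinfun_trace_def
    by (intro sum.cong) (auto simp: bump_hess_apply inner_add_left inner_diff_left mult_ac)
  also have "\<dots> = - 6 * DIM('a) * (max 0 (r\<^sup>2 - x \<bullet> x))\<^sup>2 + 24 * max 0 (r\<^sup>2 - x \<bullet> x) * (x \<bullet> x)"
    unfolding euclidean_inner[of x x]
    by (simp add: sum_subtractf sum_distrib_left)
  finally show ?thesis .
qed

text \<open>Taylor's formula for the even function \<open>g s + g (- s)\<close>, whose first
  derivative vanishes at 0. The error is measured by the oscillation of the second derivative, since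
  the bump has no continuous third derivative.\<close>

lemma second_difference:
  fixes g g' g'' :: "real \<Rightarrow> real"
  assumes \<delta>: "0 < \<delta>"
    and g: "\<And>s. (g has_real_derivative g' s) (at s)" "\<And>s. (g' has_real_derivative g'' s) (at s)"
    and e: "\<And>s. \<bar>s\<bar> \<le> \<delta> \<Longrightarrow> \<bar>g'' s - g'' 0\<bar> \<le> e"
  shows "\<bar>g \<delta> + g (- \<delta>) - 2 * g 0 - \<delta>\<^sup>2 * g'' 0\<bar> \<le> \<delta>\<^sup>2 * e"
proof -
  define diff where "diff n = (if n = 0 then (\<lambda>s. g s + g (- s)) else
     if n = 1 then (\<lambda>s. g' s - g' (- s)) else (\<lambda>s. g'' s + g'' (- s)))" for n :: nat
  have neg: "((\<lambda>s. f (- s)) has_real_derivative - f' (- s)) (at s)"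
    if "\<And>s. (f has_real_derivative f' s) (at s)" for f f' :: "real \<Rightarrow> real" and s
    using DERIV_chain2[where f=f and g=uminus and x=s and Db="-1" and s=UNIV, OF that DERIV_minus[OF DERIV_ident]] by simp
  have "\<forall>m t. m < 2 \<and> 0 \<le> t \<and> t \<le> \<delta> \<longrightarrow> (diff m has_real_derivative diff (Suc m) t) (at t)"
    using g neg[of g g'] neg[of g' g'']
    by (auto simp: diff_def less_2_cases_iff intro!: derivative_eq_intros)
  from Maclaurin[OF \<delta>, of 2 diff "diff 0", OF _ _ this]
  obtain t where t: "0 < t" "t < \<delta>" and eq: "diff 0 \<delta> = (\<Sum>m<2. diff m 0 / fact m * \<delta> ^ m) + diff 2 t / fact 2 * \<delta>\<^sup>2"
    by auto
  have "g \<delta> + g (- \<delta>) - 2 * g 0 - \<delta>\<^sup>2 * g'' 0 = \<delta>\<^sup>2 * (((g'' t - g'' 0) + (g'' (- t) - g'' 0)) / 2)"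
    using eq by (simp add: diff_def numeral_2_eq_2 field_simps)
  moreover have "\<bar>((g'' t - g'' 0) + (g'' (- t) - g'' 0)) / 2\<bar> \<le> e"
    using e[of t] e[of "- t"] t by (auto simp: abs_le_iff)
  ultimately show ?thesis by (simp only: abs_mult abs_power2) (rule mult_left_mono, auto)
qed

text \<open>The Hessian is continuous with compact support, hence uniformly continuous, and each of
  the N directions contributes at most \<open>\<eta> / N\<close>. Uniformity in \<open>x\<close> is
  what allows the exchange of the two Laplacians under an integral.\<close>

lemma discrete_laplacian_bump_tendsto:
  assumes r: "0 \<le> r" and \<eta>: "0 < \<eta>"
  shows "\<exists>\<delta>0>0. \<forall>\<delta>. 0 < \<delta> \<and> \<delta> < \<delta>0 \<longrightarrow> (\<forall>x::'a::euclidean_space. \<bar>discrete_laplacian \<delta> (bump r) x - lap_bump r x\<bar> \<le> \<eta>)"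
proof -
  define N where "N = real DIM('a)"
  have N: "N > 0" by (simp add: N_def)
  let ?K = "cball (0::'a) (r + 2)"
  have "uniformly_continuous_on ?K (bump_hess r)"
    by (intro compact_uniformly_continuous continuous_bump) auto
  then obtain d where d: "d > 0" "\<And>x y. x \<in> ?K \<Longrightarrow> y \<in> ?K \<Longrightarrow> dist y x < d \<Longrightarrow> dist (bump_hess r y) (bump_hess r x) < \<eta> / N"
    unfolding uniformly_continuous_on_def using \<eta> N by (metis divide_pos_pos)
  define \<delta>0 where "\<delta>0 = min 1 d"
  \<comment> \<open>Within distance \<open>r + 1\<close> of the origin the compact ball of radius
    \<open>r + 2\<close> contains both points; farther out both Hessians are zero.\<close>
  have close: "dist (bump_hess r y) (bump_hess r x) \<le> \<eta> / N" if "dist y x < \<delta>0" for x y :: 'a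
  proof (cases "norm x \<le> r + 1")
    case True
    then have "norm y \<le> r + 2" using that norm_triangle_ineq2[of y x] by (simp add: \<delta>0_def dist_norm)
    then show ?thesis using d(2)[of x y] that True by (simp add: \<delta>0_def)
  next
    case False
    then have "norm y \<ge> r" using that norm_triangle_ineq3[of y x] by (auto simp: \<delta>0_def dist_norm abs_le_iff)
    then show ?thesis using False r \<eta> N by (simp add: bump_outside)
  qed
  have "\<bar>discrete_laplacian \<delta> (bump r) x - lap_bump r x\<bar> \<le> \<eta>" if \<delta>: "0 < \<delta>" "\<delta> < \<delta>0" for \<delta> and x :: 'a
  proof -
    have one: "\<bar>(bump r (x + \<delta> *\<^sub>R b) + bump r (x - \<delta> *\<^sub>R b) - 2 * bump r x) - \<delta>\<^sup>2 * (bump_hess r x b \<bullet> b)\<bar> \<le> \<delta>\<^sup>2 * (\<eta> / N)"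
      if b: "b \<in> Basis" for b
    proof -
      have line: "((\<lambda>s. x + s *\<^sub>R b) has_derivative (\<lambda>h. h *\<^sub>R b)) (at s)" for s
        by (auto intro!: derivative_eq_intros)
      have g1: "((\<lambda>s. bump r (x + s *\<^sub>R b)) has_real_derivative (bump_grad r (x + s *\<^sub>R b) \<bullet> b)) (at s)" for s
        using has_derivative_compose[OF line bump_GDERIV[unfolded gderiv_def]]
        by (simp add: has_field_derivative_def inner_commute mult_commute_abs)
      have g2: "((\<lambda>s. bump_grad r (x + s *\<^sub>R b) \<bullet> b) has_real_derivative (bump_hess r (x + s *\<^sub>R b) b \<bullet> b)) (at s)" for s
        using bounded_linear.has_derivative[OF bounded_linear_inner_left[of b] has_derivative_compose[OF line bump_grad_has_derivative]]
        by (simp add: has_field_derivative_def blinfun.scaleR_right mult_commute_abs)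
      have e: "\<bar>bump_hess r (x + s *\<^sub>R b) b \<bullet> b - bump_hess r (x + 0 *\<^sub>R b) b \<bullet> b\<bar> \<le> \<eta> / N" if "\<bar>s\<bar> \<le> \<delta>" for s
      proof -
        have "\<bar>bump_hess r (x + s *\<^sub>R b) b \<bullet> b - bump_hess r (x + 0 *\<^sub>R b) b \<bullet> b\<bar>
            = \<bar>blinfun_apply (bump_hess r (x + s *\<^sub>R b) - bump_hess r x) b \<bullet> b\<bar>"
          by (simp add: blinfun.diff_left inner_diff_left)
        also have "\<dots> \<le> norm (blinfun_apply (bump_hess r (x + s *\<^sub>R b) - bump_hess r x) b)"
          using Cauchy_Schwarz_ineq2[of "blinfun_apply (bump_hess r (x + s *\<^sub>R b) - bump_hess r x) b" b] b by simp
        also have "\<dots> \<le> norm (bump_hess r (x + s *\<^sub>R b) - bump_hess r x)"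
          using norm_blinfun[of "bump_hess r (x + s *\<^sub>R b) - bump_hess r x" b] b by simp
        also have "\<dots> \<le> \<eta> / N"
          using close[of "x + s *\<^sub>R b" x] that \<delta> b by (simp add: dist_norm)
        finally show ?thesis .
      qed
      from second_difference[OF \<delta>(1) g1 g2 e] show ?thesis by simp
    qed
    have "\<delta>\<^sup>2 * (discrete_laplacian \<delta> (bump r) x - lap_bump r x) =
        (\<Sum>b\<in>Basis. (bump r (x + \<delta> *\<^sub>R b) + bump r (x - \<delta> *\<^sub>R b) - 2 * bump r x) - \<delta>\<^sup>2 * (bump_hess r x b \<bullet> b))"
    proof -
      have "\<delta>\<^sup>2 * discrete_laplacian \<delta> (bump r) x = (\<Sum>b\<in>Basis. bump r (x + \<delta> *\<^sub>R b) + bump r (x - \<delta> *\<^sub>R b) - 2 * bump r x)"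
        using \<delta> by (simp add: discrete_laplacian_def)
      moreover have "\<delta>\<^sup>2 * lap_bump r x = (\<Sum>b\<in>Basis. \<delta>\<^sup>2 * (bump_hess r x b \<bullet> b))"
        by (simp add: lap_bump_def blinfun_trace_def sum_distrib_left)
      ultimately show ?thesis by (simp only: right_diff_distrib sum_subtractf)
    qed
    then have "\<bar>\<delta>\<^sup>2 * (discrete_laplacian \<delta> (bump r) x - lap_bump r x)\<bar> \<le> (\<Sum>b\<in>(Basis::'a set). \<delta>\<^sup>2 * (\<eta> / N))"
      using one by (simp only:) (rule order_trans[OF sum_abs sum_mono])
    also have "\<dots> = \<delta>\<^sup>2 * \<eta>" using N by (simp add: N_def)
    finally show ?thesis using \<delta> by (simp add: abs_mult)
  qed
  then show ?thesis using d(1) by (intro exI[of _ \<delta>0]) (auto simp: \<delta>0_def)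
qed

text \<open>Balls are the only domains on which the weak formulation is tested.\<close>

lemma smooth_bounded_domain_ball:
  fixes c :: "'a::euclidean_space"
  assumes "0 < r"
  shows "smooth_bounded_domain (ball c r)"
proof -
  \<comment> \<open>The defining function is quadratic: its gradient is affine and its second
    derivatives are constant, so regularity of every order ends here.\<close>
  have const: "Ck_on k (\<lambda>x::'a. a) U" for k a U
  proof (induction k arbitrary: a)
    case (Suc k)
    then show ?case by (auto intro!: exI[of _ "\<lambda>_. 0"] GDERIV_const)
  qed simp
  have lin: "Ck_on k (\<lambda>x::'a. (2 *\<^sub>R (x - c)) \<bullet> b) U" for k b U
  proof (cases k)
    case 0
    then show ?thesis by (auto intro!: continuous_intros)
  next
    case (Suc l)
    have "GDERIV (\<lambda>x::'a. (2 *\<^sub>R (x - c)) \<bullet> b) x :> 2 *\<^sub>R b" for x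
      unfolding gderiv_def by (auto intro!: derivative_eq_intros simp: inner_commute)
    then show ?thesis unfolding Suc using const[of l "2 *\<^sub>R b \<bullet> _" U] by (auto intro!: exI[of _ "\<lambda>_. 2 *\<^sub>R b"] const)
  qed
  define \<rho> where "\<rho> x = (x - c) \<bullet> (x - c) - r\<^sup>2" for x
  have grad: "GDERIV \<rho> x :> 2 *\<^sub>R (x - c)" for x
    unfolding gderiv_def \<rho>_def by (auto intro!: derivative_eq_intros simp: inner_commute algebra_simps)
  have sm: "smooth_on \<rho> U" for U
    unfolding smooth_on_def
  proof
    fix k show "Ck_on k \<rho> U"
    proof (cases k)
      case 0
      then show ?thesis by (auto simp: \<rho>_def[abs_def] intro!: continuous_intros)
    next
      case (Suc l)
      then show ?thesis using grad lin by (auto intro!: exI[of _ "\<lambda>x. 2 *\<^sub>R (x - c)"])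
    qed
  qed
  \<comment> \<open>The centre is removed because it is the only zero of the gradient.\<close>
  have "local_defining_function (ball c r) x (- {c}) \<rho> (\<lambda>x. 2 *\<^sub>R (x - c))" if "x \<in> frontier (ball c r)" for x
  proof -
    have "x \<noteq> c" using that assms by (auto simp: frontier_ball)
    moreover have "y \<in> ball c r \<longleftrightarrow> \<rho> y < 0" for y
    proof -
      have "\<rho> y < 0 \<longleftrightarrow> (norm (y - c))\<^sup>2 < r\<^sup>2" by (simp add: \<rho>_def power2_norm_eq_inner)
      also have "\<dots> \<longleftrightarrow> norm (y - c) < r" 
        using power2_less_imp_less[of "norm (y - c)" r] power_strict_mono[of "norm (y - c)" r 2] assms by auto
      finally show ?thesis by (simp add: dist_norm norm_minus_commute)
    qed
    ultimately show ?thesis using sm grad by (auto simp: local_defining_function_def)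
  qed
  then show ?thesis using assms unfolding smooth_bounded_domain_def
    by (auto simp del: frontier_ball) 
qed

section \<open>Testing the weak formulation with bumps\<close>

lemma C21_function_bump:
  "C21_function \<Omega> T (\<lambda>y s. bump r (y - x)) (\<lambda>y s. 0) (\<lambda>y s. bump_grad r (y - x)) (\<lambda>y s. bump_hess r (y - x))"
proof -
  have sh: "((\<lambda>y. y - x) has_derivative (\<lambda>h. h)) (at y)" for y
    by (auto intro!: derivative_eq_intros)
  have c: "continuous_on (S :: ('a \<times> real) set) (\<lambda>(y, s). f (y - x))"
    if "continuous_on UNIV f" for f :: "'a \<Rightarrow> 'b::topological_space" and S
    unfolding case_prod_beta by (rule continuous_on_compose2[OF that]) (auto intro!: continuous_intros)
  have "GDERIV (\<lambda>y. bump r (y - x)) y :> bump_grad r (y - x)" for y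
    using has_derivative_compose[OF sh bump_GDERIV[unfolded gderiv_def]] by (simp add: gderiv_def)
  moreover have "((\<lambda>y. bump_grad r (y - x)) has_derivative bump_hess r (y - x)) (at y)" for y
    using has_derivative_compose[OF sh bump_grad_has_derivative] by simp
  ultimately show ?thesis unfolding C21_function_def
    by (intro conjI ballI c continuous_bump) auto
qed

text \<open>The bump and its gradient vanish on the boundary of the ball of radius \<epsilon> about
  \<open>x\<close>, so the surface integral drops out and the domain integrals extend to the whole
  space. Subtracting the identities at the times \<open>s\<close> and \<open>t\<close> removes the
  initial datum.\<close>

lemma weak_solution_bump:
  fixes u :: "'a::euclidean_space \<Rightarrow> real \<Rightarrow> real" and x :: 'a and m p \<sigma> \<epsilon> s t T :: real
  assumes ws: "weak_solution m p \<sigma> u0 T u" and st: "0 < s" "s < t" "t < T" and \<epsilon>: "0 < \<epsilon>"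
  defines "I \<equiv> \<lambda>r. LINT y|lborel. u y r powr m * lap_bump \<epsilon> (y - x)
                      + norm y powr \<sigma> * u y r powr p * bump \<epsilon> (y - x)"
  shows "set_integrable lborel {s..<t} I"
    "(LINT y|lborel. u y t * bump \<epsilon> (y - x)) - (LINT y|lborel. u y s * bump \<epsilon> (y - x))
       = (LINT r:{s..<t}|lborel. I r)"
proof -
  let ?\<Omega> = "ball x \<epsilon>"
  let ?\<phi> = "\<lambda>y (s::real). bump \<epsilon> (y - x)"
  let ?D = "\<lambda>y (s::real). bump_grad \<epsilon> (y - x)"
  let ?H = "\<lambda>y (s::real). bump_hess \<epsilon> (y - x)"
  have out: "bump \<epsilon> (y - x) = 0" "bump_grad \<epsilon> (y - x) = 0" "lap_bump \<epsilon> (y - x) = 0" if "y \<notin> ?\<Omega>" for y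
    using that \<epsilon> by (auto simp: bump_outside dist_norm norm_minus_commute)
  have fr: "y \<notin> ?\<Omega>" if "y \<in> frontier ?\<Omega>" for y using that \<epsilon> by auto
  have set_eq: "(LINT y:?\<Omega>|lborel. f y) = (LINT y|lborel. f y)" if "\<And>y. y \<notin> ?\<Omega> \<Longrightarrow> f y = 0" for f :: "'a \<Rightarrow> real"
    unfolding set_lebesgue_integral_def
    by (rule Bochner_Integration.integral_cong) (use that in \<open>auto simp: indicator_def\<close>)
  have bulk: "bulk_term m p \<sigma> u ?\<Omega> ?\<phi> (\<lambda>_ _. 0) ?H = I"
    unfolding bulk_term_def I_def lap_bump_def[symmetric]
    by (rule ext, subst set_eq) (use out in auto)
  have bdry: "boundary_term m u ?\<Omega> ?D = (\<lambda>s. 0)"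
  proof
    fix s
    have "(\<lambda>y. indicator (frontier ?\<Omega>) y *\<^sub>R (u y s powr m * (?D y s \<bullet> outer_normal ?\<Omega> y))) = (\<lambda>y. 0)"
    proof
      fix y show "indicator (frontier ?\<Omega>) y *\<^sub>R (u y s powr m * (?D y s \<bullet> outer_normal ?\<Omega> y)) = 0"
        using fr[of y] out(2)[of y] by (cases "y \<in> frontier ?\<Omega>") simp_all
    qed
    then show "boundary_term m u ?\<Omega> ?D s = 0"
      unfolding boundary_term_def set_lebesgue_integral_def by simp
  qed
  have vanish: "\<forall>y\<in>frontier ?\<Omega>. \<forall>s\<in>{0<..<T}. bump \<epsilon> (y - x) = 0" using fr out by blast
  have id: "set_integrable lborel {0<..<t'} I \<and>
      (LINT y|lborel. u y t' * bump \<epsilon> (y - x)) - (LINT y|lborel. u0 y * bump \<epsilon> (y - x)) = (LINT r:{0<..<t'}|lborel. I r)"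
    if t': "0 < t'" "t' < T" for t'
  proof -
    have "set_integrable lborel {0<..<t'} (bulk_term m p \<sigma> u ?\<Omega> ?\<phi> (\<lambda>_ _. 0) ?H) \<and>
           set_integrable lborel {0<..<t'} (boundary_term m u ?\<Omega> ?D) \<and>
           (LINT x:?\<Omega>|lborel. u x t' * ?\<phi> x t') - (LINT x:?\<Omega>|lborel. u0 x * ?\<phi> x 0) =
             (LINT s:{0<..<t'}|lborel. bulk_term m p \<sigma> u ?\<Omega> ?\<phi> (\<lambda>_ _. 0) ?H s)
             - (LINT s:{0<..<t'}|lborel. boundary_term m u ?\<Omega> ?D s)"
      by (rule conjunct2[OF conjunct2[OF ws[unfolded weak_solution_def]], THEN spec[of _ ?\<Omega>],
            THEN spec[of _ ?\<phi>], THEN spec[of _ "\<lambda>_ _. 0"], THEN spec[of _ ?D], THEN spec[of _ ?H], THEN mp,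
            OF smooth_bounded_domain_ball[OF \<epsilon>, of x], THEN mp, OF C21_function_bump, THEN mp, OF vanish,
            THEN bspec[of _ _ t']]) (use t' in auto)
    moreover have "(LINT y:?\<Omega>|lborel. u y t' * ?\<phi> y t') = (LINT y|lborel. u y t' * bump \<epsilon> (y - x))"
      "(LINT y:?\<Omega>|lborel. u0 y * ?\<phi> y 0) = (LINT y|lborel. u0 y * bump \<epsilon> (y - x))"
      by (rule set_eq; simp add: out)+
    ultimately show ?thesis unfolding bulk bdry by simp
  qed
  have Un: "{0<..<t} = {0<..<s} \<union> {s..<t}" using st by auto
  have it: "set_integrable lborel {0<..<t} I" using id[of t] st by simp
  show ist: "set_integrable lborel {s..<t} I"
    by (rule set_integrable_subset[OF it]) (use st in auto)
  have "(LINT r:{0<..<t}|lborel. I r) = (LINT r:{0<..<s}|lborel. I r) + (LINT r:{s..<t}|lborel. I r)"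
    unfolding Un by (rule set_integral_Un) (use ist id[of s] st in auto)
  then show "(LINT y|lborel. u y t * bump \<epsilon> (y - x)) - (LINT y|lborel. u y s * bump \<epsilon> (y - x))
       = (LINT r:{s..<t}|lborel. I r)"
    using id[of s] id[of t] st by simp
qed

lemma integral_bump_pos:
  assumes "0 < r"
  shows "0 < (LINT y|lborel. bump r (y::'a::euclidean_space))"
proof -
  let ?B = "ball (0::'a) (r / 2)"
  have b: "(3 / 4 * r\<^sup>2) ^ 3 \<le> bump r y" if "y \<in> ?B" for y :: 'a
  proof -
    have "y \<bullet> y \<le> (r / 2)\<^sup>2" using that power_mono[of "norm y" "r/2" 2] by (simp add: power2_norm_eq_inner)
    then have "3 / 4 * r\<^sup>2 \<le> r\<^sup>2 - y \<bullet> y" by (simp add: power2_eq_square)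
    also have "\<dots> \<le> max 0 (r\<^sup>2 - y \<bullet> y)" by simp
    finally show ?thesis unfolding bump_def by (intro power_mono) auto
  qed
  have fin: "emeasure lborel ?B < \<infinity>" by (intro emeasure_bounded_finite) auto
  have "0 < (3 / 4 * r\<^sup>2) ^ 3 * measure lborel ?B"
    using assms content_ball_pos[of "r/2" "0::'a"] by simp
  also have "\<dots> = (LINT y|lborel. (3 / 4 * r\<^sup>2) ^ 3 * indicator ?B y)" using fin by simp
  also have "\<dots> \<le> (LINT y|lborel. 1 * bump r (y::'a))"
  proof (rule integral_mono)
    show "integrable lborel (\<lambda>y. 1 * bump r (y::'a))"
      by (rule integrable_mult_bounded_support[where X="cball 0 r" and P=1 and Q="(r\<^sup>2)^3"])
        (use assms bump_le[of r] in \<open>auto simp: bump_outside abs_of_nonneg[OF bump_nonneg]\<close>)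
    show "(3 / 4 * r\<^sup>2) ^ 3 * indicator ?B y \<le> 1 * bump r y" for y :: 'a
      using b[of y] bump_nonneg[of r y] by (auto simp: indicator_def)
  qed (use fin in auto)
  finally show ?thesis by simp
qed

text \<open>A shift of \<open>x\<close> is the opposite shift of the kernel, and the stencil
  contains both. \<open>X\<close> must contain the ball of radius
  \<open>\<epsilon> + \<delta>\<close>, the support of all shifted kernels, because \<open>g\<close>
  is bounded only there.\<close>

lemma discrete_laplacian_integral_kernel:
  fixes g k :: "'a::euclidean_space \<Rightarrow> real"
  assumes [measurable]: "g \<in> borel_measurable borel" "k \<in> borel_measurable borel"
    and g: "\<And>y. y \<in> X \<Longrightarrow> \<bar>g y\<bar> \<le> P" and k: "\<And>y. \<bar>k y\<bar> \<le> Q" "\<And>y. norm y > \<epsilon> \<Longrightarrow> k y = 0"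
    and X: "bounded X" "cball x (\<epsilon> + \<delta>) \<subseteq> X" and \<delta>: "0 \<le> \<delta>"
  shows "discrete_laplacian \<delta> (\<lambda>x. LINT y|lborel. g y * k (y - x)) x = (LINT y|lborel. g y * discrete_laplacian \<delta> k (y - x))"
proof -
  have int: "integrable lborel (\<lambda>y. g y * k (y - x'))" if "norm (x' - x) \<le> \<delta>" for x'
  proof (rule integrable_mult_bounded_support[where X=X and P=P and Q=Q])
    show "k (y - x') = 0" if "y \<notin> X" for y
    proof -
      have "dist x y > \<epsilon> + \<delta>" using that X(2) by (meson mem_cball not_le subsetD)
      then have "norm (y - x') > \<epsilon>"
        using \<open>norm (x' - x) \<le> \<delta>\<close> norm_triangle_ineq[of "y - x'" "x' - x"] by (simp add: dist_norm norm_minus_commute)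
      then show ?thesis by (rule k)
    qed
  qed (use g k X in auto)
  have i: "integrable lborel (\<lambda>y. g y * k (y - (x + \<delta> *\<^sub>R b)))" "integrable lborel (\<lambda>y. g y * k (y - (x - \<delta> *\<^sub>R b)))"
    if "b \<in> Basis" for b using that \<delta> by (auto intro!: int)
  have i0: "integrable lborel (\<lambda>y. g y * k (y - x))" using \<delta> by (auto intro!: int)
  have "(LINT y|lborel. g y * discrete_laplacian \<delta> k (y - x)) = (LINT y|lborel. (\<Sum>b\<in>Basis. g y * k (y - (x + \<delta> *\<^sub>R b))
       + g y * k (y - (x - \<delta> *\<^sub>R b)) - 2 * (g y * k (y - x))) / \<delta>\<^sup>2)"
    unfolding discrete_laplacian_def times_divide_eq_right sum_distrib_left
    by (intro Bochner_Integration.integral_cong arg_cong2[where f="(/)"] sum.cong) (auto simp: algebra_simps)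
  also have "\<dots> = discrete_laplacian \<delta> (\<lambda>x. LINT y|lborel. g y * k (y - x)) x"
    unfolding discrete_laplacian_def using i i0 by (simp add: integral_sum)
  finally show ?thesis by simp
qed

section \<open>Regularisation in space and its errors\<close>

lemma bump_average_close:
  fixes g :: "'a::euclidean_space \<Rightarrow> real"
  assumes [measurable]: "g \<in> borel_measurable borel" and \<epsilon>: "0 < \<epsilon>"
    and g: "\<And>y. dist y x < \<epsilon> \<Longrightarrow> \<bar>g y - a\<bar> \<le> \<eta>"
  shows "\<bar>(LINT y|lborel. g y * bump \<epsilon> (y - x)) / (LINT y|lborel. bump \<epsilon> (y::'a)) - a\<bar> \<le> \<eta>"
proof -
  define c where "c = (LINT y|lborel. bump \<epsilon> (y::'a))"
  have c: "0 < c" unfolding c_def by (rule integral_bump_pos[OF \<epsilon>])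
  have c': "(LINT y|lborel. bump \<epsilon> (y - x)) = c"
    using integral_shift[of "bump \<epsilon>" "- x"] by (simp add: c_def)
  have ab: "\<bar>bump \<epsilon> (y - x)\<bar> \<le> (\<epsilon>\<^sup>2)^3" for y
    using bump_nonneg[of \<epsilon> "y - x"] bump_le[of \<epsilon> "y - x"] by simp
  have out: "bump \<epsilon> (y - x) = 0" if "y \<notin> ball x \<epsilon>" for y
    using that \<epsilon> by (auto simp: bump_outside dist_norm norm_minus_commute)
  have i: "integrable lborel (\<lambda>y. (g y - a) * bump \<epsilon> (y - x))"
    by (rule integrable_mult_bounded_support[where X="ball x \<epsilon>" and P=\<eta> and Q="(\<epsilon>\<^sup>2)^3"])
      (use g ab out in \<open>auto simp: dist_commute\<close>)
  have i1: "integrable lborel (\<lambda>y. 1 * bump \<epsilon> (y - x))"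
    by (rule integrable_mult_bounded_support[where X="ball x \<epsilon>" and P=1 and Q="(\<epsilon>\<^sup>2)^3"])
      (use ab out in auto)
  have gg: "g y * bump \<epsilon> (y - x) = (g y - a) * bump \<epsilon> (y - x) + a * bump \<epsilon> (y - x)" for y
    by (simp add: algebra_simps)
  have eq: "(LINT y|lborel. g y * bump \<epsilon> (y - x)) = (LINT y|lborel. (g y - a) * bump \<epsilon> (y - x)) + a * c"
    unfolding gg using i i1 by (simp add: c')
  have "\<bar>LINT y|lborel. (g y - a) * bump \<epsilon> (y - x)\<bar> \<le> (LINT y|lborel. \<eta> * bump \<epsilon> (y - x))"
  proof (rule integral_abs_bound_integral)
    fix y
    show "\<bar>(g y - a) * bump \<epsilon> (y - x)\<bar> \<le> \<eta> * bump \<epsilon> (y - x)"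
      using g[of y] out[of y] bump_nonneg[of \<epsilon> "y - x"]
      by (cases "y \<in> ball x \<epsilon>") (auto simp: abs_mult dist_commute intro!: mult_right_mono)
  qed (use i i1 in auto)
  then have "\<bar>LINT y|lborel. (g y - a) * bump \<epsilon> (y - x)\<bar> \<le> \<eta> * c" by (simp add: c')
  moreover have "(LINT y|lborel. g y * bump \<epsilon> (y - x)) / c - a = (LINT y|lborel. (g y - a) * bump \<epsilon> (y - x)) / c"
    using c by (simp add: eq field_simps)
  ultimately show ?thesis unfolding c_def[symmetric] using c by (simp add: field_simps)
qed

text \<open>The collar of width 1 around the ball of radius \<open>R\<close> leaves room for the
  shifts by \<delta> at most 1 in the dual scheme.\<close>

definition approximates ::
    "real \<Rightarrow> real \<Rightarrow> real \<Rightarrow> real \<Rightarrow> ('a::euclidean_space \<Rightarrow> real \<Rightarrow> real) \<Rightarrow> ('a \<Rightarrow> real \<Rightarrow> real) \<Rightarrow> bool" where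
  "approximates R t0 t1 \<eta> \<zeta> z \<longleftrightarrow>
     (\<forall>t\<in>{t0..t1}. (\<lambda>x. \<zeta> x t) \<in> borel_measurable borel \<and> (\<forall>x\<in>cball 0 (R + 1). \<bar>\<zeta> x t - z x t\<bar> \<le> \<eta>))"

text \<open>The threshold \<open>h0\<close> for the time step comes after \<delta>: the explicit
  scheme fixes the mesh first and then takes steps of order \<delta> squared.\<close>

definition eventually_steps ::
    "real \<Rightarrow> real \<Rightarrow> real \<Rightarrow> (real \<Rightarrow> real \<Rightarrow> real \<Rightarrow> 'a::euclidean_space \<Rightarrow> bool) \<Rightarrow> bool" where
  "eventually_steps R t0 t1 P \<longleftrightarrow> (\<exists>\<delta>0>0. \<forall>\<delta>. 0 < \<delta> \<longrightarrow> \<delta> < \<delta>0 \<longrightarrow>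
     (\<exists>h0>0. \<forall>s t x. t0 \<le> s \<longrightarrow> s < t \<longrightarrow> t \<le> t1 \<longrightarrow> t - s < h0 \<longrightarrow> x \<in> cball 0 R \<longrightarrow> P \<delta> s t x))"

lemma eventually_steps_mono:
  assumes P: "eventually_steps R t0 t1 P" and \<delta>1: "0 < \<delta>1"
    and imp: "\<And>\<delta> s t x. 0 < \<delta> \<Longrightarrow> \<delta> < \<delta>1 \<Longrightarrow> t0 \<le> s \<Longrightarrow> s < t \<Longrightarrow> t \<le> t1 \<Longrightarrow> x \<in> cball 0 R \<Longrightarrow> P \<delta> s t x \<Longrightarrow> Q \<delta> s t x"
  shows "eventually_steps R t0 t1 Q"
proof -
  obtain \<delta>0 where \<delta>0: "0 < \<delta>0" "\<forall>\<delta>. 0 < \<delta> \<longrightarrow> \<delta> < \<delta>0 \<longrightarrow>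
     (\<exists>h0>0. \<forall>s t x. t0 \<le> s \<longrightarrow> s < t \<longrightarrow> t \<le> t1 \<longrightarrow> t - s < h0 \<longrightarrow> x \<in> cball 0 R \<longrightarrow> P \<delta> s t x)"
    using P unfolding eventually_steps_def by blast
  show ?thesis unfolding eventually_steps_def
  proof (rule exI[of _ "min \<delta>0 \<delta>1"], intro conjI allI impI)
    show "0 < min \<delta>0 \<delta>1" using \<delta>0 \<delta>1 by simp
    fix \<delta> assume \<delta>: "0 < \<delta>" "\<delta> < min \<delta>0 \<delta>1"
    then obtain h0 where "0 < h0" "\<forall>s t x. t0 \<le> s \<longrightarrow> s < t \<longrightarrow> t \<le> t1 \<longrightarrow> t - s < h0 \<longrightarrow> x \<in> cball 0 R \<longrightarrow> P \<delta> s t x"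
      using \<delta>0(2) by auto
    then show "\<exists>h0>0. \<forall>s t x. t0 \<le> s \<longrightarrow> s < t \<longrightarrow> t \<le> t1 \<longrightarrow> t - s < h0 \<longrightarrow> x \<in> cball 0 R \<longrightarrow> Q \<delta> s t x"
      using imp[of \<delta>] \<delta> by (intro exI[of _ h0]) auto
  qed
qed

lemma weak_solution_nonneg: "weak_solution m p \<sigma> u0 T u \<Longrightarrow> 0 < s \<Longrightarrow> s < T \<Longrightarrow> 0 \<le> u x s"
  by (auto simp: weak_solution_def)

lemma weak_solution_continuous:
  assumes "weak_solution m p \<sigma> u0 T u" "0 < t0" "t1 < T"
  shows "continuous_on (X \<times> {t0..t1}) (\<lambda>(x, s). u x s)"
proof (cases "t0 \<le> t1")
  case True
  then obtain t where t: "t1 < t" "t < T" "0 < t" using assms dense[of t1 T] by auto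
  have "\<forall>t\<in>{0<..<T}. continuous_on (UNIV \<times> {0<..<t}) (\<lambda>(x, s). u x s)"
    using assms(1) unfolding weak_solution_def by (elim conjE)
  then have "continuous_on (UNIV \<times> {0<..<t}) (\<lambda>(x, s). u x s)" using t by simp
  then show ?thesis by (rule continuous_on_subset) (use t assms in auto)
qed auto

lemma weak_solution_slice:
  assumes "weak_solution m p \<sigma> u0 T u" "0 < t" "t < T"
  shows "continuous_on UNIV (\<lambda>x. u x t)"
proof -
  have "continuous_on UNIV (\<lambda>x. (\<lambda>(x, s). u x s) (x, t))"
    by (rule continuous_on_compose2[OF weak_solution_continuous[OF assms(1,2,3), of UNIV]])
      (auto intro!: continuous_intros)
  then show ?thesis by simp
qed

lemma weak_solution_slice_measurable:
  assumes "weak_solution m p \<sigma> u0 T u" "0 < t" "t < T"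
  shows "(\<lambda>x. u x t) \<in> borel_measurable borel"
  using weak_solution_slice[OF assms] by (rule borel_measurable_continuous_onI)

lemma compact_bound:
  fixes f :: "'b::topological_space \<Rightarrow> real"
  assumes "compact K" "continuous_on K f"
  shows "\<exists>M\<ge>0. \<forall>x\<in>K. \<bar>f x\<bar> \<le> M"
proof -
  have "bounded (f ` K)" using compact_continuous_image[OF assms(2,1)] by (rule compact_imp_bounded)
  then obtain M where "\<forall>y\<in>f ` K. \<bar>y\<bar> \<le> M" unfolding bounded_real by auto
  then show ?thesis by (intro exI[of _ "\<bar>M\<bar>"]) force
qed

text \<open>\<open>\<zeta>\<close> and \<open>Y\<close> are the averages of \<open>u\<close> and
  \<open>u powr m\<close> against a normalised bump. The equation is used in its time-integrated
  form, so only increments of \<open>\<zeta>\<close> occur and no time derivative is needed. The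
  lower inequality drops the nonnegative source and serves the comparison with a subsolution; the
  upper one keeps the bound \<Phi> and serves the comparison with a supersolution.\<close>

lemma regularized_equation:
  fixes u :: "'a::euclidean_space \<Rightarrow> real \<Rightarrow> real"
  assumes ws: "weak_solution m p \<sigma> u0 T u" and m: "0 < m" and t: "0 < t0" "t1 < T" and R: "0 \<le> R"
    and \<eta>: "0 < \<eta>"
    and \<Phi>: "\<And>y r. norm y \<le> R + 2 \<Longrightarrow> t0 \<le> r \<Longrightarrow> r \<le> t1 \<Longrightarrow> norm y powr \<sigma> * u y r powr p \<le> \<Phi>"
  shows "\<exists>\<zeta> Y. approximates R t0 t1 \<eta> \<zeta> u \<and> approximates R t0 t1 \<eta> Y (\<lambda>x t. u x t powr m) \<and>
     eventually_steps R t0 t1 (\<lambda>\<delta> s t x.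
        (t - s) * (discrete_laplacian \<delta> (\<lambda>x. Y x s) x - \<eta>) \<le> \<zeta> x t - \<zeta> x s \<and>
        \<zeta> x t - \<zeta> x s \<le> (t - s) * (discrete_laplacian \<delta> (\<lambda>x. Y x s) x + \<eta> + \<Phi>))"
proof -
  define U where "U x s = u x s powr m" for x s
  define K where "K = cball (0::'a) (R + 2) \<times> {t0..t1}"
  have cK: "compact K" unfolding K_def by (intro compact_Times) auto
  have u0: "0 \<le> u x s" if "t0 \<le> s" "s \<le> t1" for x s
    using weak_solution_nonneg[OF ws, of s x] that t by auto
  have cu: "continuous_on K (\<lambda>(x, s). u x s)" unfolding K_def by (rule weak_solution_continuous[OF ws t])
  have cU: "continuous_on K (\<lambda>(x, s). U x s)"
    using cu u0 m unfolding U_def case_prod_beta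
    by (intro continuous_on_powr') (auto intro!: continuous_intros simp: K_def)
  have uu: "uniformly_continuous_on K (\<lambda>(x, s). u x s)" and uU: "uniformly_continuous_on K (\<lambda>(x, s). U x s)"
    by (rule compact_uniformly_continuous[OF cu cK], rule compact_uniformly_continuous[OF cU cK])
  have mu: "(\<lambda>x. u x s) \<in> borel_measurable borel" if "t0 \<le> s" "s \<le> t1" for s
    by (rule weak_solution_slice_measurable[OF ws]) (use that t in auto)
  have mU: "(\<lambda>x. U x s) \<in> borel_measurable borel" if "t0 \<le> s" "s \<le> t1" for s
    unfolding U_def using mu[OF that] by measurable
  have ext: "\<exists>d>0. \<forall>x s y r. (x, s) \<in> K \<longrightarrow> (y, r) \<in> K \<longrightarrow> dist (y, r) (x, s) < d \<longrightarrow> \<bar>g y r - g x s\<bar> < e"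
    if "uniformly_continuous_on K (\<lambda>(x, s). g x s)" "0 < e" for g :: "'a \<Rightarrow> real \<Rightarrow> real" and e
  proof -
    from that obtain d where "d > 0"
      "\<forall>a\<in>K. \<forall>b\<in>K. dist b a < d \<longrightarrow> dist ((\<lambda>(x, s). g x s) b) ((\<lambda>(x, s). g x s) a) < e"
      unfolding uniformly_continuous_on_def by blast
    then show ?thesis by (intro exI[of _ d]) (force simp: dist_real_def)
  qed
  obtain d1 where d1: "d1 > 0" "\<forall>x s y r. (x, s) \<in> K \<longrightarrow> (y, r) \<in> K \<longrightarrow> dist (y, r) (x, s) < d1 \<longrightarrow> \<bar>u y r - u x s\<bar> < \<eta>"
    using ext[OF uu \<eta>] by blast
  obtain d2 where d2: "d2 > 0" "\<forall>x s y r. (x, s) \<in> K \<longrightarrow> (y, r) \<in> K \<longrightarrow> dist (y, r) (x, s) < d2 \<longrightarrow> \<bar>U y r - U x s\<bar> < \<eta>"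
    using ext[OF uU \<eta>] by blast
  \<comment> \<open>Below the moduli of continuity of \<open>u\<close> and \<open>U\<close> for
    \<eta>, an average differs from the value at the centre by at most \<eta>. The bound 1 keeps the
    averaging balls inside radius \<open>R + 2\<close>.\<close>
  define \<epsilon> where "\<epsilon> = min 1 (min d1 d2)"
  have \<epsilon>: "0 < \<epsilon>" "\<epsilon> \<le> 1" "\<epsilon> \<le> d1" "\<epsilon> \<le> d2" using d1 d2 by (auto simp: \<epsilon>_def)
  define c where "c = (LINT y|lborel. bump \<epsilon> (y::'a))"
  have c: "0 < c" unfolding c_def by (rule integral_bump_pos[OF \<epsilon>(1)])
  define \<zeta> where "\<zeta> x s = (LINT y|lborel. u y s * bump \<epsilon> (y - x)) / c" for x s
  define Y where "Y x s = (LINT y|lborel. U y s * bump \<epsilon> (y - x)) / c" for x s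
  have meas: "(\<lambda>x. \<zeta> x s) \<in> borel_measurable borel" "(\<lambda>x. Y x s) \<in> borel_measurable borel" if "s \<in> {t0..t1}" for s
  proof -
    have [measurable]: "(\<lambda>x. u x s) \<in> borel_measurable borel" "(\<lambda>x. U x s) \<in> borel_measurable borel"
      using mu mU that by auto
    show "(\<lambda>x. \<zeta> x s) \<in> borel_measurable borel" 
      unfolding \<zeta>_def by (intro borel_measurable_divide lborel.borel_measurable_lebesgue_integral; measurable)
    show "(\<lambda>x. Y x s) \<in> borel_measurable borel"
      unfolding Y_def by (intro borel_measurable_divide lborel.borel_measurable_lebesgue_integral; measurable)
  qed
  have close: "\<bar>\<zeta> x s - u x s\<bar> \<le> \<eta> \<and> \<bar>Y x s - u x s powr m\<bar> \<le> \<eta>" if s: "s \<in> {t0..t1}" and x: "x \<in> cball 0 (R + 1)" for s x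
  proof -
    have near: "(y, s) \<in> K \<and> (x, s) \<in> K \<and> dist (y, s) (x, s) < \<epsilon>" if "dist y x < \<epsilon>" for y
      using that s x \<epsilon> norm_triangle_ineq2[of y x] by (auto simp: K_def dist_Pair_Pair dist_norm)
    have "\<bar>u y s - u x s\<bar> \<le> \<eta>" if "dist y x < \<epsilon>" for y
      using d1(2)[rule_format, of x s y s] near[OF that] \<epsilon> by simp
    then have "\<bar>\<zeta> x s - u x s\<bar> \<le> \<eta>" unfolding \<zeta>_def c_def
      by (intro bump_average_close) (use s mu \<epsilon> in auto)
    moreover have "\<bar>U y s - U x s\<bar> \<le> \<eta>" if "dist y x < \<epsilon>" for y
      using d2(2)[rule_format, of x s y s] near[OF that] \<epsilon> by simp
    then have "\<bar>Y x s - U x s\<bar> \<le> \<eta>" unfolding Y_def c_def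
      by (intro bump_average_close) (use s mU \<epsilon> in auto)
    ultimately show ?thesis by (simp add: U_def)
  qed
  obtain BU where BU: "0 \<le> BU" "\<And>x s. (x, s) \<in> K \<Longrightarrow> \<bar>U x s\<bar> \<le> BU"
  proof -
    obtain M where "0 \<le> M" "\<forall>x\<in>K. \<bar>(\<lambda>(x, s). U x s) x\<bar> \<le> M" using compact_bound[OF cK cU] by blast
    then show ?thesis by (intro that[of M]) force+
  qed
  obtain BL where BL: "0 \<le> BL" "\<And>y. \<bar>lap_bump \<epsilon> (y::'a)\<bar> \<le> BL"
  proof -
    obtain M where M: "0 \<le> M" "\<forall>y\<in>cball (0::'a) \<epsilon>. \<bar>lap_bump \<epsilon> y\<bar> \<le> M"
      using compact_bound[OF compact_cball continuous_bump(4)] by blast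
    have "\<bar>lap_bump \<epsilon> y\<bar> \<le> M" for y :: 'a
      using M \<epsilon> bump_outside(4)[of \<epsilon> y] by (cases "norm y \<le> \<epsilon>") auto
    with M(1) show ?thesis by (rule that)
  qed
  define V where "V = measure lborel (cball (0::'a) (R + 2))"
  have V0: "0 \<le> V" by (simp add: V_def)
  have finV: "emeasure lborel (cball (0::'a) (R + 2)) < \<infinity>" by (intro emeasure_bounded_finite) auto
  have small: "\<exists>e>0. M * e * V \<le> \<eta> * c / 2" if "0 \<le> M" for M
  proof (intro exI conjI)
    have p: "0 < M * V + 1" using that V0 by (simp add: add_nonneg_pos)
    then show "0 < \<eta> * c / (2 * (M * V + 1))" using \<eta> c by simp
    have "M * V / (M * V + 1) \<le> 1" using p by simp
    then have "M * V / (M * V + 1) * (\<eta> * c / 2) \<le> 1 * (\<eta> * c / 2)" using \<eta> c by (intro mult_right_mono) auto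
    then show "M * (\<eta> * c / (2 * (M * V + 1))) * V \<le> \<eta> * c / 2" by (simp add: mult_ac)
  qed
  \<comment> \<open>Half of the allowed error \<open>\<eta> * c\<close> goes to replacing the
    Laplacian of the kernel by its discrete version (\<open>\<eta>1\<close>), the other half to
    freezing \<open>U\<close> at the left end \<open>s\<close> of the time step
    (\<open>\<eta>2\<close>).\<close>
  obtain \<eta>1 where \<eta>1: "0 < \<eta>1" "BU * \<eta>1 * V \<le> \<eta> * c / 2" using small[OF BU(1)] by blast
  obtain \<eta>2 where \<eta>2: "0 < \<eta>2" "BL * \<eta>2 * V \<le> \<eta> * c / 2" using small[OF BL(1)] by blast
  obtain h0 where h0: "h0 > 0" "\<forall>x s y r. (x, s) \<in> K \<longrightarrow> (y, r) \<in> K \<longrightarrow> dist (y, r) (x, s) < h0 \<longrightarrow> \<bar>U y r - U x s\<bar> < \<eta>2"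
    using ext[OF uU \<eta>2(1)] by blast
  obtain \<delta>1 where \<delta>1: "\<delta>1 > 0" "\<And>\<delta> x. 0 < \<delta> \<Longrightarrow> \<delta> < \<delta>1 \<Longrightarrow> \<bar>discrete_laplacian \<delta> (bump \<epsilon>) (x::'a) - lap_bump \<epsilon> x\<bar> \<le> \<eta>1"
    using discrete_laplacian_bump_tendsto[of \<epsilon> \<eta>1] \<epsilon> \<eta>1(1) by force
  have evol: "(t - s) * (discrete_laplacian \<delta> (\<lambda>x. Y x s) x - \<eta>) \<le> \<zeta> x t - \<zeta> x s \<and>
        \<zeta> x t - \<zeta> x s \<le> (t - s) * (discrete_laplacian \<delta> (\<lambda>x. Y x s) x + \<eta> + \<Phi>)"
    if \<delta>: "0 < \<delta>" "\<delta> < min 1 \<delta>1" and st: "t0 \<le> s" "s < t" "t \<le> t1" "t - s < h0" and x: "x \<in> cball 0 R" for \<delta> s t x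
  proof -
    let ?X = "cball (0::'a) (R + 2)"
    define f where "f r y = norm y powr \<sigma> * u y r powr p" for r y
    define I where "I r = (LINT y|lborel. U y r * lap_bump \<epsilon> (y - x) + f r y * bump \<epsilon> (y - x))" for r
    note W = weak_solution_bump[OF ws, of s t \<epsilon> x]
    have I: "set_integrable lborel {s..<t} I" "c * (\<zeta> x t - \<zeta> x s) = (LINT r:{s..<t}|lborel. I r)"
      using W st t \<epsilon> c by (simp_all add: I_def[abs_def] U_def f_def \<zeta>_def diff_divide_distrib[symmetric])
    have sub: "cball x (\<epsilon> + \<delta>) \<subseteq> ?X"
    proof
      fix y assume "y \<in> cball x (\<epsilon> + \<delta>)"
      then show "y \<in> ?X" using x \<delta> \<epsilon> norm_triangle_ineq2[of y x] by (auto simp: dist_norm norm_minus_commute)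
    qed
    have out: "\<epsilon> + \<delta> < norm (y - x)" if "y \<notin> ?X" for y
    proof (rule ccontr)
      assume "\<not> \<epsilon> + \<delta> < norm (y - x)"
      then have "y \<in> cball x (\<epsilon> + \<delta>)" by (simp add: dist_norm norm_minus_commute)
      then show False using sub that by blast
    qed
    have lap0: "lap_bump \<epsilon> (y - x) = 0" "bump \<epsilon> (y - x) = 0" if "y \<notin> ?X" for y
      using out[OF that] \<delta> \<epsilon> by (auto intro!: bump_outside)
    have abump: "\<bar>bump \<epsilon> y\<bar> \<le> (\<epsilon>\<^sup>2)^3" for y :: 'a
      using bump_nonneg[of \<epsilon> y] bump_le[of \<epsilon> y] by simp
    have sd0: "discrete_laplacian \<delta> (bump \<epsilon>) (y - x) = 0" if "y \<notin> ?X" for y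
    proof -
      have n: "\<epsilon> + \<delta> < norm (y - x)" using out[OF that] by simp
      have "bump \<epsilon> (y - x + \<delta> *\<^sub>R b) = 0" "bump \<epsilon> (y - x - \<delta> *\<^sub>R b) = 0" if "b \<in> Basis" for b
        using n that \<delta> \<epsilon> norm_triangle_ineq2[of "y - x" "- (\<delta> *\<^sub>R b)"] norm_triangle_ineq2[of "y - x" "\<delta> *\<^sub>R b"]
        by (auto intro!: bump_outside)
      then show ?thesis using lap0[OF that] by (simp add: discrete_laplacian_def)
    qed
    have sdb: "\<bar>discrete_laplacian \<delta> (bump \<epsilon>) (y::'a)\<bar> \<le> BL + \<eta>1" for y
      using \<delta>1(2)[of \<delta> y] BL(2)[of y] \<delta> by (auto simp: abs_le_iff)
    have UX: "\<bar>U y r\<bar> \<le> BU" if "y \<in> ?X" "s \<le> r" "r \<le> t" for y r using BU(2)[of y r] that st by (auto simp: K_def)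
    have fX: "\<bar>f r y\<bar> \<le> \<Phi>" "f r y \<le> \<Phi>" if "y \<in> ?X" "s \<le> r" "r \<le> t" for y r
      using \<Phi>[of y r] that st by (auto simp: f_def)
    have sdY: "discrete_laplacian \<delta> (\<lambda>x. Y x s) x = (LINT y|lborel. U y s * discrete_laplacian \<delta> (bump \<epsilon>) (y - x)) / c"
    proof -
      have "discrete_laplacian \<delta> (\<lambda>x. (1 / c) * (LINT y|lborel. U y s * bump \<epsilon> (y - x))) x
          = (1 / c) * discrete_laplacian \<delta> (\<lambda>x. (LINT y|lborel. U y s * bump \<epsilon> (y - x))) x"
        by (rule discrete_laplacian_cmult)
      also have "discrete_laplacian \<delta> (\<lambda>x. (LINT y|lborel. U y s * bump \<epsilon> (y - x))) x = (LINT y|lborel. U y s * discrete_laplacian \<delta> (bump \<epsilon>) (y - x))"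
      proof (rule discrete_laplacian_integral_kernel[where X="?X" and P=BU and Q="(\<epsilon>\<^sup>2)^3" and \<epsilon>=\<epsilon>])
        show "(\<lambda>y. U y s) \<in> borel_measurable borel" using mU[of s] st by simp
        show "\<bar>U y s\<bar> \<le> BU" if "y \<in> ?X" for y using UX[OF that, of s] st by simp
        show "bump \<epsilon> y = 0" if "\<epsilon> < norm y" for y :: 'a using that \<epsilon> by (auto intro!: bump_outside)
      qed (use abump \<delta> sub in auto)
      finally show ?thesis by (simp add: Y_def)
    qed
    \<comment> \<open>Pointwise in time the right-hand side of the tested equation is already close
      to its value with \<open>U\<close> frozen at \<open>s\<close>; integrating these constants
      over the step gives the claim.\<close>
    have bnd: "c * (discrete_laplacian \<delta> (\<lambda>x. Y x s) x - \<eta>) \<le> I r \<and> I r \<le> c * (discrete_laplacian \<delta> (\<lambda>x. Y x s) x + \<eta> + \<Phi>)"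
      if r: "s \<le> r" "r < t" for r
    proof -
      have r': "t0 \<le> r" "r \<le> t1" "r \<le> t" and s': "s \<le> t1" using r st by auto
      have [measurable]: "(\<lambda>x. u x r) \<in> borel_measurable borel" "(\<lambda>x. U x r) \<in> borel_measurable borel"
        "(\<lambda>x. U x s) \<in> borel_measurable borel"
        using mu[OF r'(1,2)] mU[OF r'(1,2)] mU[OF st(1) s'] by auto
      have [measurable]: "f r \<in> borel_measurable borel" unfolding f_def[abs_def] by measurable
      have i1: "integrable lborel (\<lambda>y. U y r * lap_bump \<epsilon> (y - x))"
        by (rule integrable_mult_bounded_support[where X="?X" and P=BU and Q=BL]) (use UX r BL lap0 in auto)
      have i2: "integrable lborel (\<lambda>y. f r y * bump \<epsilon> (y - x))"
        by (rule integrable_mult_bounded_support[where X="?X" and P=\<Phi> and Q="(\<epsilon>\<^sup>2)^3"]) (use fX(1) r abump lap0 in auto)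
      have i3: "integrable lborel (\<lambda>y. U y s * discrete_laplacian \<delta> (bump \<epsilon>) (y - x))"
        by (rule integrable_mult_bounded_support[where X="?X" and P=BU and Q="BL + \<eta>1"]) (use UX st sdb sd0 in auto)
      have i4: "integrable lborel (\<lambda>y. \<Phi> * bump \<epsilon> (y - x))"
        by (rule integrable_mult_bounded_support[where X="?X" and P="\<bar>\<Phi>\<bar>" and Q="(\<epsilon>\<^sup>2)^3"]) (use abump lap0 in auto)
      have Ieq: "I r = (LINT y|lborel. U y r * lap_bump \<epsilon> (y - x)) + (LINT y|lborel. f r y * bump \<epsilon> (y - x))"
        using i1 i2 by (simp add: I_def)
      have F: "0 \<le> (LINT y|lborel. f r y * bump \<epsilon> (y - x))" "(LINT y|lborel. f r y * bump \<epsilon> (y - x)) \<le> c * \<Phi>"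
      proof -
        show "0 \<le> (LINT y|lborel. f r y * bump \<epsilon> (y - x))"
          using bump_nonneg by (intro integral_nonneg_AE AE_I2 mult_nonneg_nonneg) (auto simp: f_def)
        have "(LINT y|lborel. f r y * bump \<epsilon> (y - x)) \<le> (LINT y|lborel. \<Phi> * bump \<epsilon> (y - x))"
        proof (rule integral_mono[OF i2 i4])
          show "f r y * bump \<epsilon> (y - x) \<le> \<Phi> * bump \<epsilon> (y - x)" for y
          proof (cases "y \<in> ?X")
            case True
            then show ?thesis using fX(2)[OF True r(1) r'(3)] bump_nonneg[of \<epsilon> "y - x"] by (intro mult_right_mono)
          qed (simp add: lap0)
        qed
        also have "\<dots> = c * \<Phi>" using integral_shift[of "bump \<epsilon>" "- x"] by (simp add: c_def)
        finally show "(LINT y|lborel. f r y * bump \<epsilon> (y - x)) \<le> c * \<Phi>" .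
      qed
      have "\<bar>(LINT y|lborel. U y r * lap_bump \<epsilon> (y - x) - U y s * discrete_laplacian \<delta> (bump \<epsilon>) (y - x))\<bar>
          \<le> (LINT y|lborel. (BL * \<eta>2 + BU * \<eta>1) * indicator ?X y)"
      proof (rule integral_abs_bound_integral)
        fix y
        show "\<bar>U y r * lap_bump \<epsilon> (y - x) - U y s * discrete_laplacian \<delta> (bump \<epsilon>) (y - x)\<bar> \<le> (BL * \<eta>2 + BU * \<eta>1) * indicator ?X y"
        proof (cases "y \<in> ?X")
          case y: True
          have eq: "U y r * lap_bump \<epsilon> (y - x) - U y s * discrete_laplacian \<delta> (bump \<epsilon>) (y - x)
             = lap_bump \<epsilon> (y - x) * (U y r - U y s) - U y s * (discrete_laplacian \<delta> (bump \<epsilon>) (y - x) - lap_bump \<epsilon> (y - x))"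
            by (simp add: algebra_simps)
          have "\<bar>U y r - U y s\<bar> \<le> \<eta>2"
            using h0(2)[rule_format, of y s y r] y r st by (auto simp: K_def dist_Pair_Pair dist_real_def)
          then have a: "\<bar>lap_bump \<epsilon> (y - x) * (U y r - U y s)\<bar> \<le> BL * \<eta>2"
            unfolding abs_mult using BL(2)[of "y - x"] BL(1) by (intro mult_mono) auto
          have b: "\<bar>U y s * (discrete_laplacian \<delta> (bump \<epsilon>) (y - x) - lap_bump \<epsilon> (y - x))\<bar> \<le> BU * \<eta>1"
            unfolding abs_mult using UX[OF y, of s] st \<delta>1(2)[of \<delta> "y - x"] \<delta> BU(1) by (intro mult_mono) auto
          show ?thesis unfolding eq using a b y by (auto simp: abs_le_iff)
        qed (simp add: lap0 sd0)
      qed (use i1 i3 finV in auto)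
      also have "\<dots> = BL * \<eta>2 * V + BU * \<eta>1 * V" using finV by (simp add: V_def algebra_simps)
      also have "\<dots> \<le> \<eta> * c" using \<eta>1(2) \<eta>2(2) by linarith
      finally have "\<bar>(LINT y|lborel. U y r * lap_bump \<epsilon> (y - x)) - c * discrete_laplacian \<delta> (\<lambda>x. Y x s) x\<bar> \<le> \<eta> * c"
        using i1 i3 c by (simp add: sdY)
      then show ?thesis unfolding Ieq using F by (auto simp: abs_le_iff algebra_simps)
    qed
    have const: "(LINT r:{s..<t}|lborel. k) = (t - s) * k" "set_integrable lborel {s..<t} (\<lambda>r. k)" for k :: real
      using st unfolding set_lebesgue_integral_def set_integrable_def by auto
    have "(LINT r:{s..<t}|lborel. c * (discrete_laplacian \<delta> (\<lambda>x. Y x s) x - \<eta>)) \<le> (LINT r:{s..<t}|lborel. I r)"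
      by (rule set_integral_mono[OF const(2) I(1)]) (use bnd in auto)
    moreover have "(LINT r:{s..<t}|lborel. I r) \<le> (LINT r:{s..<t}|lborel. c * (discrete_laplacian \<delta> (\<lambda>x. Y x s) x + \<eta> + \<Phi>))"
      by (rule set_integral_mono[OF I(1) const(2)]) (use bnd in auto)
    ultimately have "c * ((t - s) * (discrete_laplacian \<delta> (\<lambda>x. Y x s) x - \<eta>)) \<le> c * (\<zeta> x t - \<zeta> x s)"
      "c * (\<zeta> x t - \<zeta> x s) \<le> c * ((t - s) * (discrete_laplacian \<delta> (\<lambda>x. Y x s) x + \<eta> + \<Phi>))"
      unfolding const I(2) by (simp_all add: mult_ac)
    then show ?thesis using c by simp
  qed
  have "eventually_steps R t0 t1 (\<lambda>\<delta> s t x.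
        (t - s) * (discrete_laplacian \<delta> (\<lambda>x. Y x s) x - \<eta>) \<le> \<zeta> x t - \<zeta> x s \<and>
        \<zeta> x t - \<zeta> x s \<le> (t - s) * (discrete_laplacian \<delta> (\<lambda>x. Y x s) x + \<eta> + \<Phi>))"
    unfolding eventually_steps_def
  proof (rule exI[of _ "min 1 \<delta>1"], intro conjI allI impI)
    show "0 < min 1 \<delta>1" using \<delta>1 by simp
    show "\<exists>h0>0. \<forall>s t x. t0 \<le> s \<longrightarrow> s < t \<longrightarrow> t \<le> t1 \<longrightarrow> t - s < h0 \<longrightarrow> x \<in> cball 0 R \<longrightarrow>
        (t - s) * (discrete_laplacian \<delta> (\<lambda>x. Y x s) x - \<eta>) \<le> \<zeta> x t - \<zeta> x s \<and>
        \<zeta> x t - \<zeta> x s \<le> (t - s) * (discrete_laplacian \<delta> (\<lambda>x. Y x s) x + \<eta> + \<Phi>)"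
      if "0 < \<delta>" "\<delta> < min 1 \<delta>1" for \<delta>
      using evol[OF that] h0(1) by blast
  qed
  moreover have "approximates R t0 t1 \<eta> \<zeta> u" "approximates R t0 t1 \<eta> Y (\<lambda>x t. u x t powr m)"
    using meas close by (auto simp: approximates_def)
  ultimately show ?thesis by blast
qed

section \<open>Comparison\<close>

text \<open>
  Here $z$ is the difference of a sub- and a supersolution and $Z$ that of their $m$-th powers, so that
  $z_t \le \Delta Z$ and $Z = \alpha z$ with $0 \le \alpha \le A$. The quotient is regularised to
  $\alpha + \nu$ with $\nu = \kappa^2$; this costs $\nu B$ under the Laplacian, which the energy estimate
  turns into $O(\nu B/\kappa) = O(\kappa)$.
\<close>
lemma comparison_principle:
  fixes z Z :: "'a::euclidean_space \<Rightarrow> real \<Rightarrow> real"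
  assumes t01: "t0 < t1" and R: "0 < R" and A: "0 \<le> A"
    and zcont: "\<And>t. t \<in> {t0..t1} \<Longrightarrow> continuous_on UNIV (\<lambda>x. z x t)"
    and Zmeas: "\<And>t. t \<in> {t0..t1} \<Longrightarrow> (\<lambda>x. Z x t) \<in> borel_measurable borel"
    and zB: "\<And>x t. x \<in> cball 0 (R + 1) \<Longrightarrow> t \<in> {t0..t1} \<Longrightarrow> \<bar>z x t\<bar> \<le> B"
    and Zz: "\<And>x t. x \<in> cball 0 (R + 1) \<Longrightarrow> t \<in> {t0..t1} \<Longrightarrow> \<bar>Z x t\<bar> \<le> A * \<bar>z x t\<bar>"
      "\<And>x t. x \<in> cball 0 (R + 1) \<Longrightarrow> t \<in> {t0..t1} \<Longrightarrow> 0 \<le> Z x t * z x t"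
    and Zout: "\<And>x t. x \<in> cball 0 (R + 1) - ball 0 R \<Longrightarrow> t \<in> {t0..t1} \<Longrightarrow> Z x t \<le> 0"
    and init: "\<And>x. x \<in> ball 0 R \<Longrightarrow> z x t0 \<le> 0"
    and evol: "\<And>\<eta>. 0 < \<eta> \<Longrightarrow> \<exists>\<zeta> Y. approximates R t0 t1 \<eta> \<zeta> z \<and> approximates R t0 t1 \<eta> Y Z \<and>
       eventually_steps R t0 t1 (\<lambda>\<delta> s t x. \<zeta> x t - \<zeta> x s \<le> (t - s) * (discrete_laplacian \<delta> (\<lambda>x. Y x s) x + \<eta>))"
    and x0: "x0 \<in> ball 0 R"
  shows "z x0 t1 \<le> 0"
proof (rule ccontr)
  assume "\<not> z x0 t1 \<le> 0"
  then have pos: "0 < z x0 t1" by simp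
  define q where "q = z x0 t1 / 2"
  have q: "0 < q" using pos by (simp add: q_def)
  define \<Omega> where "\<Omega> = ball (0::'a) R"
  define V where "V = measure lborel \<Omega>"
  have V0: "0 \<le> V" by (simp add: V_def)
  have [measurable]: "\<Omega> \<in> sets borel" by (simp add: \<Omega>_def)
  have fin: "emeasure lborel \<Omega> < \<infinity>" unfolding \<Omega>_def by (intro emeasure_bounded_finite) auto
  have "isCont (\<lambda>x. z x t1) x0" using zcont[of t1] t01 by (auto simp: continuous_on_eq_continuous_at)
  then have "((\<lambda>x. z x t1) \<longlongrightarrow> z x0 t1) (nhds x0)"
    by (simp add: isCont_def tendsto_nhds_iff)
  then have "\<forall>\<^sub>F x in nhds x0. q < z x t1"
    by (rule order_tendstoD(1)) (use pos in \<open>simp add: q_def\<close>)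
  moreover have "\<forall>\<^sub>F x in nhds x0. x \<in> \<Omega>" using x0 by (intro eventually_nhds_in_open) (auto simp: \<Omega>_def)
  ultimately have "\<forall>\<^sub>F x in nhds x0. q < z x t1 \<and> x \<in> \<Omega>" by (rule eventually_conj)
  then obtain r where r: "0 < r" "\<And>x. dist x x0 < r \<Longrightarrow> q < z x t1 \<and> x \<in> \<Omega>"
    unfolding eventually_nhds_metric by blast
  \<comment> \<open>The terminal datum of the dual problem is supported where \<open>z\<close>
    exceeds \<open>q\<close> at time \<open>t1\<close>. Hence \<open>z\<close> tested with it is at
    least \<open>Q > 0\<close>, and the rest of the proof bounds the same quantity by
    \<open>Q / 2\<close> up to errors already included.\<close>
  define \<theta> where "\<theta> x = bump r (x - x0)" for x
  define \<Theta> where "\<Theta> = (r\<^sup>2)^3"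
  have [measurable]: "\<theta> \<in> borel_measurable borel" unfolding \<theta>_def[abs_def] by measurable
  have \<theta>: "0 \<le> \<theta> x" "\<theta> x \<le> \<Theta>" for x unfolding \<theta>_def \<Theta>_def by (rule bump_nonneg bump_le)+
  have \<theta>r: "\<theta> x = 0" if "\<not> dist x x0 < r" for x
    using that r(1) by (auto simp: \<theta>_def dist_norm intro!: bump_outside)
  have \<theta>out: "\<theta> x = 0" if "x \<notin> \<Omega>" for x using r(2)[of x] \<theta>r[of x] that by blast
  have \<Theta>: "0 \<le> \<Theta>" by (simp add: \<Theta>_def)
  have i\<theta>: "integrable lborel (\<lambda>x. 1 * \<theta> x)"
    by (rule integrable_mult_bounded_support[where X=\<Omega> and P=1 and Q=\<Theta>]) (use \<theta> \<theta>out in \<open>auto simp: \<Omega>_def\<close>)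
  define Q where "Q = q * (LINT x|lborel. \<theta> x)"
  have "0 < (LINT x|lborel. \<theta> x)"
    using integral_bump_pos[OF r(1), where 'a='a] integral_shift[of "bump r" "- x0"] by (simp add: \<theta>_def)
  then have Q: "0 < Q" using q by (simp add: Q_def)
  obtain L where L: "0 \<le> L" "\<And>y. \<bar>lap_bump r (y::'a)\<bar> \<le> L"
  proof -
    obtain M where M: "0 \<le> M" "\<forall>y\<in>cball (0::'a) r. \<bar>lap_bump r y\<bar> \<le> M"
      using compact_bound[OF compact_cball continuous_bump(4)] by blast
    have "\<bar>lap_bump r y\<bar> \<le> M" for y :: 'a
      using M r(1) bump_outside(4)[of r y] by (cases "norm y \<le> r") auto
    with M(1) show ?thesis by (rule that)
  qed
  obtain \<delta>1 where \<delta>1: "0 < \<delta>1" "\<And>\<delta> x. 0 < \<delta> \<Longrightarrow> \<delta> < \<delta>1 \<Longrightarrow> \<bar>discrete_laplacian \<delta> (bump r) (x::'a) - lap_bump r x\<bar> \<le> 1"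
    using discrete_laplacian_bump_tendsto[of r 1] r(1) by force
  \<comment> \<open>Bound for the Dirichlet form of \<theta>, uniform in small \<delta> because
    discrete Laplacians of the bump stay within 1 of the true one.\<close>
  define Cd where "Cd = \<Theta> * (L + 1) * V"
  have Cd0: "0 \<le> Cd" using \<Theta> L V0 by (simp add: Cd_def)
  define \<tau> where "\<tau> = t1 - t0"
  have \<tau>: "0 < \<tau>" using t01 by (simp add: \<tau>_def)
  \<comment> \<open>The factor of \<open>E * \<mu>\<close> in the final estimate:
    \<open>\<tau> * V / 2\<close> comes from Young's inequality, \<open>Cd / 2\<close> from the
    energy.\<close>
  define G where "G = \<tau> * V / 2 + Cd / 2"
  have G0: "0 \<le> G" using \<tau> V0 Cd0 by (simp add: G_def)
  have B0: "0 \<le> B" using zB[of x0 t0] x0 t01 by auto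
  \<comment> \<open>Chosen so that the cost of \<nu> takes at most a quarter of \<open>Q\<close>;
    the added 1 avoids division by zero.\<close>
  define \<kappa> where "\<kappa> = min 1 (Q / (4 * (B * G + 1)))"
  have BG: "0 < B * G + 1" using B0 G0 by (simp add: add_nonneg_pos)
  have cancel: "Q / (4 * X) * X = Q / 4" if "0 < X" for X using that by (simp add: field_simps)
  have \<kappa>: "0 < \<kappa>" "\<kappa> \<le> 1" "\<kappa> * (B * G) \<le> Q / 4"
  proof -
    show "0 < \<kappa>" "\<kappa> \<le> 1" using BG Q by (auto simp: \<kappa>_def)
    have "\<kappa> * (B * G) \<le> Q / (4 * (B * G + 1)) * (B * G)" using B0 G0 by (intro mult_right_mono) (auto simp: \<kappa>_def)
    also have "\<dots> \<le> Q / (4 * (B * G + 1)) * (B * G + 1)" using BG Q by (intro mult_left_mono) auto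
    also have "\<dots> = Q / 4" by (rule cancel[OF BG])
    finally show "\<kappa> * (B * G) \<le> Q / 4" .
  qed
  \<comment> \<open>Upper bound for the regularised quotient, as \<nu> is at most 1.\<close>
  define A' where "A' = A + 1"
  \<comment> \<open>The factor of \<eta> in the final estimate. It contains
    \<open>1 / \<kappa>\<close>, so \<eta> can be fixed only after \<kappa>.\<close>
  define H where "H = 2 * \<Theta> * V + \<tau> * \<Theta> * V + (2 + A') * G / \<kappa>"
  have H0: "0 \<le> H" using \<Theta> V0 \<tau> A G0 \<kappa> by (simp add: H_def A'_def)
  define \<eta> where "\<eta> = Q / (4 * (H + 1))"
  have \<eta>: "0 < \<eta>" "\<eta> * H \<le> Q / 4"
  proof -
    show "0 < \<eta>" using Q H0 by (simp add: \<eta>_def)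
    then have "\<eta> * H \<le> \<eta> * (H + 1)" by (intro mult_left_mono) auto
    also have "\<dots> = Q / 4" unfolding \<eta>_def using H0 by (intro cancel) auto
    finally show "\<eta> * H \<le> Q / 4" .
  qed
  define \<nu> where "\<nu> = \<kappa>\<^sup>2"
  \<comment> \<open>With this weight \<open>1 / (\<nu> * \<mu>)\<close> equals \<mu>, so the Young
    term and the energy term carry the same factor \<open>E * \<mu>\<close>.\<close>
  define \<mu> where "\<mu> = 1 / \<kappa>"
  have \<nu>: "0 < \<nu>" "\<nu> \<le> 1" using \<kappa> by (auto simp: \<nu>_def power_le_one)
  have \<mu>: "0 < \<mu>" using \<kappa> by (simp add: \<mu>_def)
  from evol[OF \<eta>(1)] obtain \<zeta> Y where \<zeta>: "approximates R t0 t1 \<eta> \<zeta> z" and Y: "approximates R t0 t1 \<eta> Y Z"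
    and e: "eventually_steps R t0 t1 (\<lambda>\<delta> s t x. \<zeta> x t - \<zeta> x s \<le> (t - s) * (discrete_laplacian \<delta> (\<lambda>x. Y x s) x + \<eta>))"
    by blast
  have meas: "(\<lambda>x. \<zeta> x t) \<in> borel_measurable borel" "(\<lambda>x. Y x t) \<in> borel_measurable borel" if "t \<in> {t0..t1}" for t
    using \<zeta> Y that unfolding approximates_def by blast+
  have close: "\<bar>\<zeta> x t - z x t\<bar> \<le> \<eta>" "\<bar>Y x t - Z x t\<bar> \<le> \<eta>" if "t \<in> {t0..t1}" "x \<in> cball 0 (R + 1)" for t x
    using \<zeta> Y that unfolding approximates_def by blast+
  from e obtain \<delta>0 where \<delta>0: "0 < \<delta>0" "\<forall>\<delta>. 0 < \<delta> \<longrightarrow> \<delta> < \<delta>0 \<longrightarrow> (\<exists>h0>0. \<forall>s t x. t0 \<le> s \<longrightarrow> s < t \<longrightarrow> t \<le> t1 \<longrightarrow> t - s < h0 \<longrightarrow> x \<in> cball 0 R \<longrightarrow>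
        \<zeta> x t - \<zeta> x s \<le> (t - s) * (discrete_laplacian \<delta> (\<lambda>x. Y x s) x + \<eta>))"
    unfolding eventually_steps_def by blast
  define \<delta> where "\<delta> = min 1 (min \<delta>0 \<delta>1) / 2"
  have \<delta>: "0 < \<delta>" "\<delta> \<le> 1" "\<delta> < \<delta>0" "\<delta> < \<delta>1" using \<delta>0 \<delta>1 by (auto simp: \<delta>_def min_def)
  obtain h0 where h0: "0 < h0" "\<And>s t x. t0 \<le> s \<Longrightarrow> s < t \<Longrightarrow> t \<le> t1 \<Longrightarrow> t - s < h0 \<Longrightarrow> x \<in> cball 0 R \<Longrightarrow>
        \<zeta> x t - \<zeta> x s \<le> (t - s) * (discrete_laplacian \<delta> (\<lambda>x. Y x s) x + \<eta>)"
    using \<delta>0(2) \<delta>(1,3) by blast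
  define h1 where "h1 = min h0 (\<delta>\<^sup>2 / (4 * DIM('a) * A'))"
  have A'0: "0 < A'" using A by (simp add: A'_def)
  have h1: "0 < h1" using h0 \<delta> A'0 by (simp add: h1_def)
  obtain n :: nat where n: "\<tau> / h1 < real n" using reals_Archimedean2 by blast
  have n0: "0 < real n" using n \<tau> h1 by (meson divide_pos_pos order_less_trans)
  define h where "h = \<tau> / n"
  have h: "0 < h" "h < h1" using n n0 \<tau> h1 by (auto simp: h_def field_simps)
  have hh0: "h < h0" and hA: "h * (4 * DIM('a) * A') \<le> \<delta>\<^sup>2"
  proof -
    show "h < h0" using h by (simp add: h1_def)
    have "h \<le> \<delta>\<^sup>2 / (4 * DIM('a) * A')" using h by (simp add: h1_def)
    then show "h * (4 * DIM('a) * A') \<le> \<delta>\<^sup>2" using A'0 by (simp add: pos_le_divide_eq)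
  qed
  define T where "T k = t0 + real k * h" for k :: nat
  have T: "T k \<in> {t0..t1}" if "k \<le> n" for k
  proof -
    have "real k * h \<le> real n * h" using that h by (intro mult_right_mono) auto
    also have "\<dots> = t1 - t0" using n0 by (simp add: h_def \<tau>_def)
    finally have "real k * h \<le> t1 - t0" .
    moreover have "0 \<le> real k * h" using h by simp
    ultimately show ?thesis by (simp add: T_def)
  qed
  have Tn: "T n = t1" using n0 by (simp add: T_def h_def \<tau>_def)
  define E where "E = 2 * \<eta> + A' * \<eta> + \<nu> * B"
  define c1 where "c1 = E * \<mu> * V / 2 + \<eta> * \<Theta> * V"
  define c2 where "c2 = E / (2 * \<nu> * \<mu>)"
  have E0: "0 \<le> E" using \<eta> A'0 \<nu> B0 by (simp add: E_def)
  have c20: "0 \<le> c2" using E0 \<nu> \<mu> by (simp add: c2_def)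
  have sub: "\<Omega> \<subseteq> cball 0 (R + 1)" by (auto simp: \<Omega>_def)
  have ind: "integrable lborel (\<lambda>x. k * indicator \<Omega> x :: real)" "(LINT x|lborel. k * indicator \<Omega> x :: real) = k * V" for k
    using fin by (auto simp: V_def)
  have \<zeta>B: "\<bar>\<zeta> x (T k)\<bar> \<le> A' * B + \<eta>" "\<bar>Y x (T k)\<bar> \<le> A' * B + \<eta>" if "k \<le> n" "x \<in> cball 0 (R + 1)" for k x
  proof -
    have zb: "\<bar>z x (T k)\<bar> \<le> B" by (rule zB[OF that(2) T[OF that(1)]])
    have "\<bar>Z x (T k)\<bar> \<le> A * \<bar>z x (T k)\<bar>" by (rule Zz(1)[OF that(2) T[OF that(1)]])
    also have "\<dots> \<le> A * B" using A zb by (intro mult_left_mono)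
    finally have "\<bar>Z x (T k)\<bar> \<le> A * B" .
    moreover have "0 \<le> A * B" using A B0 by simp
    ultimately show "\<bar>\<zeta> x (T k)\<bar> \<le> A' * B + \<eta>" "\<bar>Y x (T k)\<bar> \<le> A' * B + \<eta>"
      using close[OF T[OF that(1)] that(2)] zb B0 by (auto simp: A'_def algebra_simps abs_le_iff)
  qed
  \<comment> \<open>Induction on the number of backward steps from \<open>T k\<close> to
    \<open>t0\<close>, for every admissible terminal datum, since a step replaces \<psi> by its
    successor. The Dirichlet forms telescope; the one left at \<open>t0\<close> is nonnegative and
    is dropped.\<close>
  have main: "(LINT x|lborel. \<zeta> x (T k) * \<psi> x) \<le> \<eta> * \<Theta> * V + real k * h * c1 + c2 * dirichlet_form \<delta> \<psi>"
    if "k \<le> n" "\<psi> \<in> borel_measurable borel" "\<And>x. 0 \<le> \<psi> x" "\<And>x. \<psi> x \<le> \<Theta>" "\<And>x. x \<notin> \<Omega> \<Longrightarrow> \<psi> x = 0"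
    for k \<psi>
    using that
  proof (induction k arbitrary: \<psi>)
    case 0
    note [measurable] = \<open>\<psi> \<in> borel_measurable borel\<close>
    have T0: "T 0 = t0" by (simp add: T_def)
    have "(LINT x|lborel. \<zeta> x (T 0) * \<psi> x) \<le> (LINT x|lborel. (\<eta> * \<Theta>) * indicator \<Omega> x)"
    proof (rule integral_mono)
      show "integrable lborel (\<lambda>x. \<zeta> x (T 0) * \<psi> x)"
        by (rule integrable_mult_bounded_support[where X=\<Omega> and P="A' * B + \<eta>" and Q=\<Theta>])
          (use meas(1)[OF T[of 0]] \<zeta>B(1)[of 0] 0 sub in \<open>auto simp: \<Omega>_def\<close>)
      show "\<zeta> x (T 0) * \<psi> x \<le> \<eta> * \<Theta> * indicator \<Omega> x" for x
      proof (cases "x \<in> \<Omega>")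
        case True
        have "z x t0 \<le> 0" using init True by (simp add: \<Omega>_def)
        moreover have "\<bar>\<zeta> x (T 0) - z x t0\<bar> \<le> \<eta>" unfolding T0 using close(1)[of t0 x] t01 True sub by auto
        ultimately have "\<zeta> x (T 0) \<le> \<eta>" by linarith
        then have "\<zeta> x (T 0) * \<psi> x \<le> \<eta> * \<Theta>"
          using 0 \<eta> by (intro order_trans[OF mult_right_mono[of _ \<eta>] mult_left_mono]) auto
        then show ?thesis using True by simp
      qed (use 0 in auto)
    qed (use ind in auto)
    also have "\<dots> = \<eta> * \<Theta> * V" by (rule ind(2))
    also have "\<dots> \<le> \<eta> * \<Theta> * V + real 0 * h * c1 + c2 * dirichlet_form \<delta> \<psi>"
      using c20 dirichlet_form_bounds(1)[of \<psi> \<Theta> \<Omega> \<delta>] 0 by (simp add: \<Omega>_def)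
    finally show ?case .
  next
    case (Suc k)
    have k: "k \<le> n" using Suc by simp
    \<comment> \<open>The value 0 for the quotient at \<open>z = 0\<close> is consistent, because
      \<open>Z\<close> vanishes there too.\<close>
    define a where "a x = (if z x (T k) = 0 then 0 else Z x (T k) / z x (T k)) + \<nu>" for x
    have [measurable]: "(\<lambda>x. z x (T k)) \<in> borel_measurable borel" "(\<lambda>x. Z x (T k)) \<in> borel_measurable borel"
      using zcont[OF T[OF k]] Zmeas[OF T[OF k]] by (auto intro: borel_measurable_continuous_onI)
    have am: "a \<in> borel_measurable borel" unfolding a_def[abs_def] by measurable
    have a: "\<nu> \<le> a x" "a x \<le> A'" "Z x (T k) = (a x - \<nu>) * z x (T k)" if "x \<in> \<Omega>" for x
    proof -
      have x: "x \<in> cball 0 (R + 1)" using that sub by blast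
      have 1: "\<bar>Z x (T k)\<bar> \<le> A * \<bar>z x (T k)\<bar>" "0 \<le> Z x (T k) * z x (T k)" using Zz[OF x T[OF k]] by auto
      have 2: "0 \<le> Z x (T k) / z x (T k)" "Z x (T k) / z x (T k) \<le> A" if "z x (T k) \<noteq> 0"
      proof -
        show p: "0 \<le> Z x (T k) / z x (T k)" using 1(2) by (simp add: zero_le_divide_iff zero_le_mult_iff)
        have "\<bar>Z x (T k) / z x (T k)\<bar> \<le> A" using 1(1) that by (simp add: abs_divide pos_divide_le_eq)
        then show "Z x (T k) / z x (T k) \<le> A" using p by linarith
      qed
      show "\<nu> \<le> a x" "a x \<le> A'" "Z x (T k) = (a x - \<nu>) * z x (T k)"
        using 1 2 A \<nu> by (auto simp: a_def A'_def)
    qed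
    define \<psi>' where "\<psi>' x = (if x \<in> \<Omega> then \<psi> x + h * a x * discrete_laplacian \<delta> \<psi> x else 0)" for x
    have TS: "T (Suc k) = T k + h" by (simp add: T_def algebra_simps)
    have ev: "\<zeta> x (T (Suc k)) - \<zeta> x (T k) \<le> h * (discrete_laplacian \<delta> (\<lambda>x. Y x (T k)) x + \<eta>)" if "x \<in> \<Omega>" for x
      using h0(2)[of "T k" "T (Suc k)" x] T[OF k] T[OF Suc.prems(1)] TS hh0 h(1) that by (simp add: \<Omega>_def)
    note D = dual_step[OF Suc.prems(2) meas(1)[OF T[OF k]] meas(1)[OF T[OF Suc.prems(1)]] meas(2)[OF T[OF k]] am
        Suc.prems(3,4) Suc.prems(5)[unfolded \<Omega>_def] a(1,2)[unfolded \<Omega>_def] \<nu>(1) h(1) hA \<delta>(1,2) less_imp_le[OF \<eta>(1)] \<mu>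
        zB[OF _ T[OF k]] a(3)[unfolded \<Omega>_def] Zout[OF _ T[OF k]] \<zeta>B(1)[OF Suc.prems(1)] \<zeta>B(2)[OF k]
        close(1)[OF T[OF k]] close(2)[OF T[OF k]] ev[unfolded \<Omega>_def]]
    have step: "\<psi>' \<in> borel_measurable borel" "\<And>x. 0 \<le> \<psi>' x" "\<And>x. \<psi>' x \<le> \<Theta>" "\<And>x. x \<notin> \<Omega> \<Longrightarrow> \<psi>' x = 0"
      "(LINT x|lborel. \<zeta> x (T (Suc k)) * \<psi> x) \<le> (LINT x|lborel. \<zeta> x (T k) * \<psi>' x) + h * c1 + c2 * (dirichlet_form \<delta> \<psi> - dirichlet_form \<delta> \<psi>')"
      unfolding \<psi>'_def[abs_def] c1_def c2_def E_def V_def \<Omega>_def by (rule D; assumption)+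
    have "(LINT x|lborel. \<zeta> x (T k) * \<psi>' x) \<le> \<eta> * \<Theta> * V + real k * h * c1 + c2 * dirichlet_form \<delta> \<psi>'"
      by (rule Suc.IH) (use k step(1-4) in auto)
    then show ?case using step(5) by (simp add: algebra_simps)
  qed
  have fin0: "(LINT x|lborel. \<zeta> x t1 * \<theta> x) \<le> \<eta> * \<Theta> * V + \<tau> * c1 + c2 * Cd"
  proof -
    have "dirichlet_form \<delta> \<theta> \<le> Cd"
    proof -
      have "- (\<theta> x * discrete_laplacian \<delta> \<theta> x) \<le> (\<Theta> * (L + 1)) * indicator \<Omega> x" for x
      proof (cases "x \<in> \<Omega>")
        case True
        have "discrete_laplacian \<delta> \<theta> x = discrete_laplacian \<delta> (bump r) (x - x0)" by (simp add: discrete_laplacian_def \<theta>_def algebra_simps)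
        then have "\<bar>discrete_laplacian \<delta> \<theta> x\<bar> \<le> L + 1" using \<delta>1(2)[OF \<delta>(1,4), of "x - x0"] L(2)[of "x - x0"] by linarith
        then have "\<bar>\<theta> x * discrete_laplacian \<delta> \<theta> x\<bar> \<le> \<Theta> * (L + 1)"
          unfolding abs_mult using \<theta>[of x] by (intro mult_mono) auto
        then show ?thesis using True by simp
      qed (simp add: \<theta>out)
      moreover have "integrable lborel (\<lambda>x. \<theta> x * discrete_laplacian \<delta> \<theta> x)"
        by (rule discrete_laplacian_by_parts(2)[where X="cball 0 (R + 1)" and \<Omega>=\<Omega> and P=\<Theta> and Q=\<Theta>])
          (use \<theta> \<theta>out sub \<delta> in \<open>auto simp: \<Omega>_def intro!: norm_triangle_le norm_triangle_le_diff\<close>)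
      ultimately have "dirichlet_form \<delta> \<theta> \<le> (LINT x|lborel. (\<Theta> * (L + 1)) * indicator \<Omega> x)"
        unfolding dirichlet_form_def integral_minus[symmetric] using ind by (intro integral_mono) auto
      then show ?thesis unfolding ind by (simp add: Cd_def)
    qed
    then have "c2 * dirichlet_form \<delta> \<theta> \<le> c2 * Cd" using c20 by (rule mult_left_mono)
    moreover have "real n * h = \<tau>" using n0 by (simp add: h_def)
    moreover have "(LINT x|lborel. \<zeta> x (T n) * \<theta> x) \<le> \<eta> * \<Theta> * V + real n * h * c1 + c2 * dirichlet_form \<delta> \<theta>"
      by (rule main) (use \<theta> \<theta>out in auto)
    ultimately show ?thesis by (simp add: Tn)
  qed
  have low: "Q - \<eta> * \<Theta> * V \<le> (LINT x|lborel. \<zeta> x t1 * \<theta> x)"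
  proof -
    have "Q - \<eta> * \<Theta> * V = (LINT x|lborel. q * \<theta> x - \<eta> * \<Theta> * indicator \<Omega> x)"
      using i\<theta> ind(1)[of 1] by (simp add: Q_def V_def)
    also have "\<dots> \<le> (LINT x|lborel. \<zeta> x t1 * \<theta> x)"
    proof (rule integral_mono)
      show "integrable lborel (\<lambda>x. \<zeta> x t1 * \<theta> x)"
        by (rule integrable_mult_bounded_support[where X=\<Omega> and P="A' * B + \<eta>" and Q=\<Theta>])
          (use meas(1)[of t1] t01 \<zeta>B(1)[of n] \<theta> \<theta>out sub in \<open>auto simp: \<Omega>_def Tn\<close>)
      fix x
      show "q * \<theta> x - \<eta> * \<Theta> * indicator \<Omega> x \<le> \<zeta> x t1 * \<theta> x"
      proof (cases "dist x x0 < r")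
        case True
        then have x: "x \<in> \<Omega>" and qz: "q < z x t1" using r(2)[OF True] by auto
        have "\<bar>\<zeta> x t1 - z x t1\<bar> \<le> \<eta>" using close(1)[of t1 x] t01 x sub by auto
        then have "(q - \<eta>) * \<theta> x \<le> \<zeta> x t1 * \<theta> x" using qz \<theta>(1)[of x] by (intro mult_right_mono) auto
        moreover have "\<eta> * \<theta> x \<le> \<eta> * \<Theta>" using \<theta>(2)[of x] \<eta> by (intro mult_left_mono) auto
        ultimately show ?thesis using x by (simp add: algebra_simps)
      qed (use \<theta>r \<eta> \<Theta> in \<open>auto simp: indicator_def\<close>)
    qed (use i\<theta> ind in auto)
    finally show ?thesis .
  qed
  have eqs: "E * \<mu> = (2 + A') * \<eta> / \<kappa> + \<kappa> * B" "c2 = E * \<mu> / 2"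
    using \<kappa> by (auto simp: E_def \<mu>_def \<nu>_def c2_def field_simps power2_eq_square)
  \<comment> \<open>One \<open>\<eta> * \<Theta> * V\<close> is the initial error, the other the
    error of testing \<open>\<zeta>\<close> instead of \<open>z\<close> at time
    \<open>t1\<close>.\<close>
  have "Q \<le> 2 * \<eta> * \<Theta> * V + \<tau> * \<eta> * \<Theta> * V + E * \<mu> * G"
    using fin0 low unfolding c1_def eqs(2) G_def by (simp add: algebra_simps)
  also have "\<dots> = \<eta> * H + \<kappa> * (B * G)" unfolding eqs(1) H_def by (simp add: algebra_simps)
  also have "\<dots> \<le> Q / 4 + Q / 4" using \<eta>(2) \<kappa>(3) by (rule add_mono)
  finally show False using Q by simp
qed

section \<open>Explicit sub- and supersolutions\<close>

lemma approximates_diff: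
  assumes "approximates R t0 t1 \<eta> \<zeta> z" "\<eta> \<le> \<eta>'" and w: "\<And>t. (\<lambda>x. w x t) \<in> borel_measurable borel"
  shows "approximates R t0 t1 \<eta>' (\<lambda>x t. w x t - \<zeta> x t) (\<lambda>x t. w x t - z x t)"
    "approximates R t0 t1 \<eta>' (\<lambda>x t. \<zeta> x t - w x t) (\<lambda>x t. z x t - w x t)"
proof -
  have *: "(\<lambda>x. \<zeta> x t) \<in> borel_measurable borel" "x \<in> cball 0 (R + 1) \<Longrightarrow> \<bar>\<zeta> x t - z x t\<bar> \<le> \<eta>'"
    if "t \<in> {t0..t1}" for x t
    using assms(1,2) that unfolding approximates_def by force+
  have "\<bar>w x t - \<zeta> x t - (w x t - z x t)\<bar> = \<bar>\<zeta> x t - z x t\<bar>"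
    "\<bar>\<zeta> x t - w x t - (z x t - w x t)\<bar> = \<bar>\<zeta> x t - z x t\<bar>" for x t by linarith+
  then show "approximates R t0 t1 \<eta>' (\<lambda>x t. w x t - \<zeta> x t) (\<lambda>x t. w x t - z x t)"
    "approximates R t0 t1 \<eta>' (\<lambda>x t. \<zeta> x t - w x t) (\<lambda>x t. z x t - w x t)"
    unfolding approximates_def using * w by (simp_all add: borel_measurable_diff)
qed

text \<open>Mean value theorem. Together the two bounds place the quotient of the differences
  between 0 and \<open>m * M powr (m - 1)\<close>, as the comparison requires.\<close>

lemma powr_diff_bounds:
  fixes a b m M :: real
  assumes "0 \<le> a" "a \<le> M" "0 \<le> b" "b \<le> M" and m: "1 \<le> m"
  shows "\<bar>a powr m - b powr m\<bar> \<le> m * M powr (m - 1) * \<bar>a - b\<bar>"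
    "0 \<le> (a powr m - b powr m) * (a - b)"
proof -
  have *: "0 \<le> y powr m - x powr m \<and> y powr m - x powr m \<le> m * M powr (m - 1) * (y - x)"
    if "0 \<le> x" "x < y" "y \<le> M" for x y
  proof -
    have "continuous_on {x..y} (\<lambda>s. s powr m)"
      using that m by (intro continuous_on_powr' continuous_intros) auto
    moreover have d: "((\<lambda>s. s powr m) has_real_derivative m * s powr (m - 1)) (at s)" if "x < s" for s
      using that \<open>0 \<le> x\<close> by (intro has_real_derivative_powr) auto
    ultimately obtain l s where s: "x < s" "s < y" "((\<lambda>s. s powr m) has_real_derivative l) (at s)"
      and eq: "y powr m - x powr m = (y - x) * l"
      using MVT[of x y "\<lambda>s. s powr m"] \<open>x < y\<close> by (auto simp: real_differentiable_def)
    have l: "l = m * s powr (m - 1)" using DERIV_unique[OF s(3) d[OF s(1)]] .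
    have "s powr (m - 1) \<le> M powr (m - 1)" using s that m by (intro powr_mono2) auto
    then have "0 \<le> l" "l \<le> m * M powr (m - 1)" using m by (auto simp: l)
    then show ?thesis unfolding eq using that by (auto simp: mult.commute intro!: mult_left_mono)
  qed
  consider "a < b" | "a = b" | "b < a" by linarith
  then show "\<bar>a powr m - b powr m\<bar> \<le> m * M powr (m - 1) * \<bar>a - b\<bar>" "0 \<le> (a powr m - b powr m) * (a - b)"
    using *[of a b] *[of b a] assms by (cases; auto simp: zero_le_mult_iff)+
qed

text \<open>Near the edge of its support the bump is subharmonic: for \<open>p\<close> below the
  threshold \<open>p0\<close> the gradient term, of first order in \<open>p\<close>, beats the
  quadratic one. Away from the edge the bump is bounded below, so a multiple of its root absorbs the
  bounded negative part. This makes \<open>g * b powr (1 / m)\<close> a subsolution once the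
  derivative of \<open>g\<close> is at most \<open>- C * g powr m\<close>.\<close>

lemma lap_bump_lower_bound:
  fixes r m :: real
  assumes r: "0 < r" and m: "0 < m"
  shows "\<exists>C\<ge>0. \<forall>y::'a::euclidean_space. - C * bump r y powr (1 / m) \<le> lap_bump r y"
proof -
  define N where "N = real DIM('a)"
  have N: "0 < N" by (simp add: N_def)
  define p0 where "p0 = 24 * r\<^sup>2 / (24 + 6 * N)"
  have p0: "0 < p0" using r N by (simp add: p0_def)
  define C where "C = 6 * N * (r\<^sup>2)\<^sup>2 / (p0 ^ 3) powr (1 / m)"
  have C: "0 \<le> C" using N by (simp add: C_def)
  have "- C * bump r y powr (1 / m) \<le> lap_bump r y" for y :: 'a
  proof -
    define p where "p = max 0 (r\<^sup>2 - y \<bullet> y)"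
    have lap: "lap_bump r y = - 6 * N * p\<^sup>2 + 24 * p * (y \<bullet> y)" by (simp add: lap_bump_eq p_def N_def)
    have b: "bump r y = p ^ 3" by (simp add: bump_def p_def)
    have pr: "0 \<le> p" "p \<le> r\<^sup>2" by (auto simp: p_def)
    show ?thesis
    proof (cases "p < p0")
      case True
      have "0 \<le> - 6 * N * p\<^sup>2 + 24 * p * (y \<bullet> y)"
      proof (cases "p = 0")
        case False
        then have y: "y \<bullet> y = r\<^sup>2 - p" by (auto simp: p_def max_def split: if_splits)
        have "p * (24 + 6 * N) \<le> 24 * r\<^sup>2" using True N by (simp add: p0_def field_simps)
        then have "0 \<le> p * (24 * r\<^sup>2 - p * (24 + 6 * N))" using pr by simp
        then show ?thesis by (simp add: y power2_eq_square algebra_simps)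
      qed simp
      moreover have "- C * bump r y powr (1 / m) \<le> 0" using C by simp
      ultimately show ?thesis unfolding lap by linarith
    next
      case False
      have "(p0 ^ 3) powr (1 / m) \<le> (p ^ 3) powr (1 / m)"
        using False p0 m by (intro powr_mono2 power_mono) auto
      then have "C * (p0 ^ 3) powr (1 / m) \<le> C * (p ^ 3) powr (1 / m)" using C by (rule mult_left_mono)
      moreover have "C * (p0 ^ 3) powr (1 / m) = 6 * N * (r\<^sup>2)\<^sup>2" using p0 by (simp add: C_def)
      moreover have "6 * N * p\<^sup>2 \<le> 6 * N * (r\<^sup>2)\<^sup>2" using pr N by (intro mult_left_mono power_mono) auto
      moreover have "0 \<le> 24 * p * (y \<bullet> y)" using pr by simp
      ultimately show ?thesis unfolding lap b by linarith
    qed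
  qed
  with C show ?thesis by blast
qed

lemma weak_solution_bounded_on_compact:
  fixes u :: "'a::euclidean_space \<Rightarrow> real \<Rightarrow> real"
  assumes ws: "weak_solution m p \<sigma> u0 T u" and t: "0 < t0" "t1 < T"
  shows "\<exists>M\<ge>0. \<forall>x\<in>cball 0 R. \<forall>t\<in>{t0..t1}. u x t \<le> M"
proof -
  have "compact (cball (0::'a) R \<times> {t0..t1})" by (intro compact_Times) auto
  from compact_bound[OF this weak_solution_continuous[OF ws t]]
  obtain M where M: "0 \<le> M" "\<forall>x\<in>cball (0::'a) R \<times> {t0..t1}. \<bar>(\<lambda>(x, s). u x s) x\<bar> \<le> M" by blast
  have "u x t \<le> M" if "x \<in> cball 0 R" "t \<in> {t0..t1}" for x t
    using M(2)[rule_format, of "(x, t)"] that by simp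
  with M(1) show ?thesis by blast
qed

text \<open>Comparison from below with $g(t)\,b(x)^{1/m}$, where $b$ is a bump around \<open>x0\<close> and $g$ is affine.\<close>
lemma positivity_retained:
  fixes u :: "'a::euclidean_space \<Rightarrow> real \<Rightarrow> real"
  assumes ws: "weak_solution m p \<sigma> u0 T u" and m: "1 < m" and p: "0 \<le> p" and \<sigma>: "0 \<le> \<sigma>"
    and t: "0 < t0" "t0 < t1" "t1 < T" and pos: "0 < u x0 t0"
  shows "0 < u x0 t1"
proof -
  define c where "c = u x0 t0 / 2"
  have c: "0 < c" using pos by (simp add: c_def)
  have "isCont (\<lambda>x. u x t0) x0"
    using weak_solution_slice[OF ws, of t0] t by (auto simp: continuous_on_eq_continuous_at)
  then have "((\<lambda>x. u x t0) \<longlongrightarrow> u x0 t0) (nhds x0)" by (simp add: isCont_def tendsto_nhds_iff)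
  then have "\<forall>\<^sub>F x in nhds x0. c < u x t0" by (rule order_tendstoD(1)) (use pos in \<open>simp add: c_def\<close>)
  then obtain r where r: "0 < r" "\<And>x. dist x x0 < r \<Longrightarrow> c < u x t0" unfolding eventually_nhds_metric by blast
  \<comment> \<open>The bump around \<open>x0\<close> has to vanish on the collar beyond radius
    \<open>R\<close>.\<close>
  define R where "R = norm x0 + r + 1"
  have R: "0 < R" "0 \<le> R" using r(1) by (simp_all add: R_def add_nonneg_pos)
  define \<tau> where "\<tau> = t1 - t0"
  have \<tau>: "0 < \<tau>" using t by (simp add: \<tau>_def)
  have u0: "0 \<le> u x s" if "s \<in> {t0..t1}" for x s
    using weak_solution_nonneg[OF ws, of s x] that t by auto
  obtain C where C: "0 \<le> C" "\<And>y::'a. - C * bump r y powr (1 / m) \<le> lap_bump r y"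
    using lap_bump_lower_bound[of r m, where 'a='a] r(1) m by auto
  define b where "b x = bump r (x - x0)" for x
  have b0: "0 \<le> b x" and br: "b x \<le> (r\<^sup>2)^3" for x unfolding b_def by (rule bump_nonneg bump_le)+
  have bout: "b x = 0" if "\<not> dist x x0 < r" for x
    using that r(1) by (auto simp: b_def dist_norm intro!: bump_outside)
  have bcont: "continuous_on UNIV b"
    unfolding b_def[abs_def] by (rule continuous_on_compose2[OF continuous_bump(1)]) (auto intro!: continuous_intros)
  define K1 where "K1 = ((r\<^sup>2)^3) powr (1 / m)"
  have K1: "0 < K1" using r(1) by (simp add: K1_def)
  have bK: "b x powr (1 / m) \<le> K1" for x unfolding K1_def using b0 br m by (intro powr_mono2) auto
  \<comment> \<open>Two demands on the amplitude \<open>g0\<close>: \<open>c / K1\<close> puts the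
    subsolution below \<open>u\<close> at \<open>t0\<close>, and the bound by a power of
    \<open>D\<close> gives \<open>C * g0 powr m \<le> g0 / (2 * \<tau>)\<close>, minus the slope of
    \<open>g\<close>. Writing \<open>C + 1\<close> allows \<open>C = 0\<close>.\<close>
  define D where "D = 1 / (2 * \<tau> * (C + 1))"
  have D: "0 < D" using \<tau> C by (simp add: D_def)
  define g0 where "g0 = min (c / K1) (D powr (1 / (m - 1)))"
  have g0: "0 < g0" using c K1 D by (simp add: g0_def)
  have g0K: "g0 * K1 \<le> c" using K1 by (simp add: g0_def min_def field_simps)
  have g0m: "g0 powr m * C \<le> g0 / (2 * \<tau>)"
  proof -
    have "g0 powr (m - 1) \<le> (D powr (1 / (m - 1))) powr (m - 1)"
      using g0 m by (intro powr_mono2) (auto simp: g0_def)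
    also have "\<dots> = D" using m D by (simp add: powr_powr)
    finally have "g0 powr (m - 1) * C \<le> D * (C + 1)" using C D by (intro mult_mono) auto
    also have "\<dots> = 1 / (2 * \<tau>)"
    proof -
      have "C + 1 \<noteq> 0" using C by simp
      then show ?thesis by (simp add: D_def)
    qed
    finally have "g0 * (g0 powr (m - 1) * C) \<le> g0 * (1 / (2 * \<tau>))" using g0 by (intro mult_left_mono) auto
    moreover have "g0 powr m = g0 * g0 powr (m - 1)" using g0 by (simp add: powr_mult_base)
    ultimately show ?thesis by (simp add: mult_ac)
  qed
  \<comment> \<open>Falls from \<open>g0\<close> to \<open>g0 / 2\<close> on the time interval, so
    the subsolution is still positive at \<open>x0\<close> at the end.\<close>
  define g where "g t = g0 * (1 - (t - t0) / (2 * \<tau>))" for t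
  have g: "0 < g t" "g t \<le> g0" if "t \<in> {t0..t1}" for t
  proof -
    have "0 \<le> (t - t0) / (2 * \<tau>)" "(t - t0) / (2 * \<tau>) \<le> 1 / 2" using that \<tau> by (auto simp: \<tau>_def field_simps)
    then have "0 < 1 - (t - t0) / (2 * \<tau>)" "1 - (t - t0) / (2 * \<tau>) \<le> 1" by linarith+
    then show "0 < g t" "g t \<le> g0" unfolding g_def using g0 mult_left_mono[of _ 1 g0] by auto
  qed
  define v where "v x t = g t * b x powr (1 / m)" for x t
  define V where "V x t = g t powr m * b x" for x t
  have vV: "v x t powr m = V x t" if "t \<in> {t0..t1}" for x t
    using g[OF that] b0[of x] m by (simp add: v_def V_def powr_mult powr_powr)
  have v0: "0 \<le> v x t" and vc: "v x t \<le> c" if "t \<in> {t0..t1}" for x t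
  proof -
    show "0 \<le> v x t" using g(1)[OF that] by (simp add: v_def)
    have "v x t \<le> g0 * K1" unfolding v_def using g[OF that] bK by (intro mult_mono) auto
    then show "v x t \<le> c" using g0K by simp
  qed
  obtain Mu where Mu: "0 \<le> Mu" "\<And>x t. x \<in> cball 0 (R + 2) \<Longrightarrow> t \<in> {t0..t1} \<Longrightarrow> u x t \<le> Mu"
    using weak_solution_bounded_on_compact[OF ws t(1,3), of "R + 2"] by blast
  define M where "M = max c Mu"
  have uM: "u x t \<le> M" if "x \<in> cball 0 (R + 1)" "t \<in> {t0..t1}" for x t
    using Mu(2)[of x t] that by (auto simp: M_def)
  have vM: "v x t \<le> M" if "t \<in> {t0..t1}" for x t using vc[OF that, of x] by (auto simp: M_def)
  have "v x0 t1 - u x0 t1 \<le> 0"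
  proof (rule comparison_principle[where z="\<lambda>x t. v x t - u x t" and Z="\<lambda>x t. V x t - u x t powr m"
        and R=R and B=M and A="m * M powr (m - 1)" and ?t0.0=t0])
    show "0 \<le> m * M powr (m - 1)" using m by simp
    show "continuous_on UNIV (\<lambda>x. v x t - u x t)" if "t \<in> {t0..t1}" for t
      unfolding v_def using weak_solution_slice[OF ws, of t] that t bcont b0 m
      by (intro continuous_intros continuous_on_powr') auto
    show "(\<lambda>x. V x s - u x s powr m) \<in> borel_measurable borel" if "s \<in> {t0..t1}" for s
    proof -
      have [measurable]: "(\<lambda>x. u x s) \<in> borel_measurable borel" "b \<in> borel_measurable borel"
        using weak_solution_slice_measurable[OF ws, of s] that t bcont by (auto intro: borel_measurable_continuous_onI)
      show ?thesis unfolding V_def by measurable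
    qed
    show "\<bar>v x s - u x s\<bar> \<le> M" if "x \<in> cball 0 (R + 1)" "s \<in> {t0..t1}" for x s
      using uM[OF that] vM[OF that(2), of x] v0[OF that(2), of x] u0[OF that(2), of x] by (simp add: abs_le_iff)
    show "\<bar>V x s - u x s powr m\<bar> \<le> m * M powr (m - 1) * \<bar>v x s - u x s\<bar>"
      "0 \<le> (V x s - u x s powr m) * (v x s - u x s)" if "x \<in> cball 0 (R + 1)" "s \<in> {t0..t1}" for x s
      using powr_diff_bounds[of "v x s" M "u x s" m] uM[OF that] vM[OF that(2), of x] v0[OF that(2), of x] u0[OF that(2), of x] m
        vV[OF that(2), of x] by auto
    show "V x s - u x s powr m \<le> 0" if "x \<in> cball 0 (R + 1) - ball 0 R" "s \<in> {t0..t1}" for x s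
    proof -
      have "\<not> dist x x0 < r" using that norm_triangle_ineq2[of x x0] by (auto simp: R_def dist_norm)
      then show ?thesis using bout[of x] by (simp add: V_def)
    qed
    show "v x t0 - u x t0 \<le> 0" for x
    proof (cases "dist x x0 < r")
      case True
      then show ?thesis using r(2)[OF True] vc[of t0 x] t by simp
    next
      case False
      then show ?thesis using bout[of x] u0[of t0 x] t by (simp add: v_def)
    qed
    show "x0 \<in> ball 0 R" using r(1) by (simp add: R_def)
    fix \<eta> :: real assume \<eta>: "0 < \<eta>"
    have f: "norm y powr \<sigma> * u y s powr p \<le> (R + 2) powr \<sigma> * Mu powr p"
      if "norm y \<le> R + 2" "t0 \<le> s" "s \<le> t1" for y s
      using that Mu(2)[of y s] u0[of s y] p \<sigma> by (intro mult_mono powr_mono2) auto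
    from regularized_equation[OF ws _ t(1,3) R(2), of "\<eta>/2", OF _ _ f] \<eta> m
    obtain \<zeta> Y where close: "approximates R t0 t1 (\<eta>/2) \<zeta> u" "approximates R t0 t1 (\<eta>/2) Y (\<lambda>x t. u x t powr m)"
      and ev: "eventually_steps R t0 t1 (\<lambda>\<delta> s t x. (t - s) * (discrete_laplacian \<delta> (\<lambda>x. Y x s) x - \<eta>/2) \<le> \<zeta> x t - \<zeta> x s \<and>
        \<zeta> x t - \<zeta> x s \<le> (t - s) * (discrete_laplacian \<delta> (\<lambda>x. Y x s) x + \<eta>/2 + (R + 2) powr \<sigma> * Mu powr p))"
      by auto
    \<comment> \<open>The discretisation error of the bump is multiplied by at most
      \<open>g0 powr m\<close> and then costs half of \<eta>.\<close>
    define \<eta>1 where "\<eta>1 = \<eta> / (2 * g0 powr m)"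
    have \<eta>1: "0 < \<eta>1" using \<eta> g0 by (simp add: \<eta>1_def)
    obtain \<delta>1 where \<delta>1: "0 < \<delta>1" "\<And>\<delta> x. 0 < \<delta> \<Longrightarrow> \<delta> < \<delta>1 \<Longrightarrow> \<bar>discrete_laplacian \<delta> (bump r) (x::'a) - lap_bump r x\<bar> \<le> \<eta>1"
      using discrete_laplacian_bump_tendsto[of r \<eta>1] r(1) \<eta>1 by force
    show "\<exists>\<zeta> Y. approximates R t0 t1 \<eta> \<zeta> (\<lambda>x t. v x t - u x t) \<and>
       approximates R t0 t1 \<eta> Y (\<lambda>x t. V x t - u x t powr m) \<and>
       eventually_steps R t0 t1 (\<lambda>\<delta> s t x. \<zeta> x t - \<zeta> x s \<le> (t - s) * (discrete_laplacian \<delta> (\<lambda>x. Y x s) x + \<eta>))"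
    proof (intro exI conjI)
      have [measurable]: "b \<in> borel_measurable borel" using bcont by (rule borel_measurable_continuous_onI)
      have [measurable]: "(\<lambda>x. v x s) \<in> borel_measurable borel" "(\<lambda>x. V x s) \<in> borel_measurable borel" for s
        unfolding v_def V_def by measurable
      show "approximates R t0 t1 \<eta> (\<lambda>x t. v x t - \<zeta> x t) (\<lambda>x t. v x t - u x t)"
        using \<eta> by (intro approximates_diff[OF close(1)]) auto
      show "approximates R t0 t1 \<eta> (\<lambda>x t. V x t - Y x t) (\<lambda>x t. V x t - u x t powr m)"
        using \<eta> by (intro approximates_diff[OF close(2)]) auto
      show "eventually_steps R t0 t1 (\<lambda>\<delta> s t x. (v x t - \<zeta> x t) - (v x s - \<zeta> x s)
          \<le> (t - s) * (discrete_laplacian \<delta> (\<lambda>x. V x s - Y x s) x + \<eta>))"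
      proof (rule eventually_steps_mono[OF ev \<delta>1(1)])
        fix \<delta> s t x
        assume \<delta>: "0 < \<delta>" "\<delta> < \<delta>1" and st: "t0 \<le> s" "s < t" "t \<le> t1"
          and *: "(t - s) * (discrete_laplacian \<delta> (\<lambda>x. Y x s) x - \<eta>/2) \<le> \<zeta> x t - \<zeta> x s \<and>
            \<zeta> x t - \<zeta> x s \<le> (t - s) * (discrete_laplacian \<delta> (\<lambda>x. Y x s) x + \<eta>/2 + (R + 2) powr \<sigma> * Mu powr p)"
        have s: "s \<in> {t0..t1}" using st by simp
        define B where "B = b x powr (1 / m)"
        have B: "0 \<le> B" by (simp add: B_def)
        have gm: "g s powr m \<le> g0 powr m" using g[OF s] m by (intro powr_mono2) auto
        have "discrete_laplacian \<delta> b x = discrete_laplacian \<delta> (bump r) (x - x0)" by (simp add: discrete_laplacian_def b_def algebra_simps)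
        then have "- C * B - \<eta>1 \<le> discrete_laplacian \<delta> b x"
          using \<delta>1(2)[OF \<delta>, of "x - x0"] C(2)[of "x - x0"] unfolding B_def b_def by (simp add: abs_le_iff)
        then have "g s powr m * (- C * B - \<eta>1) \<le> g s powr m * discrete_laplacian \<delta> b x" by (intro mult_left_mono) auto
        also have "\<dots> = discrete_laplacian \<delta> (\<lambda>x. V x s) x" unfolding V_def by (rule discrete_laplacian_cmult[symmetric])
        finally have 1: "- (g s powr m * (C * B)) - g s powr m * \<eta>1 \<le> discrete_laplacian \<delta> (\<lambda>x. V x s) x"
          by (simp add: algebra_simps)
        have "g s powr m * \<eta>1 \<le> g0 powr m * \<eta>1" using gm \<eta>1 by (intro mult_right_mono) auto
        also have "\<dots> = \<eta> / 2" using g0 by (simp add: \<eta>1_def)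
        finally have 2: "g s powr m * \<eta>1 \<le> \<eta> / 2" .
        have "g s powr m * (C * B) \<le> g0 powr m * (C * B)" using gm C B by (intro mult_right_mono) auto
        also have "\<dots> \<le> g0 / (2 * \<tau>) * B" using mult_right_mono[OF g0m B] by (simp add: mult_ac)
        finally have 3: "- (g0 / (2 * \<tau>) * B) - \<eta> / 2 \<le> discrete_laplacian \<delta> (\<lambda>x. V x s) x" using 1 2 by linarith
        \<comment> \<open>Since \<open>g\<close> is affine, the time increment is exact and adds no
          error.\<close>
        have "g t - g s = (t - s) * (- (g0 / (2 * \<tau>)))"
          using \<tau> by (simp add: g_def field_simps)
        then have "v x t - v x s = (t - s) * (- (g0 / (2 * \<tau>) * B))"
          unfolding v_def B_def[symmetric] left_diff_distrib[symmetric] by (simp add: mult_ac)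
        also have "\<dots> \<le> (t - s) * (discrete_laplacian \<delta> (\<lambda>x. V x s) x + \<eta> / 2)"
          using 3 st by (intro mult_left_mono) auto
        finally have "v x t - v x s \<le> (t - s) * (discrete_laplacian \<delta> (\<lambda>x. V x s) x + \<eta> / 2)" .
        moreover have "(t - s) * (discrete_laplacian \<delta> (\<lambda>x. V x s - Y x s) x + \<eta>)
            = (t - s) * (discrete_laplacian \<delta> (\<lambda>x. V x s) x + \<eta> / 2) - (t - s) * (discrete_laplacian \<delta> (\<lambda>x. Y x s) x - \<eta> / 2)"
          by (simp add: discrete_laplacian_diff algebra_simps)
        ultimately show "(v x t - \<zeta> x t) - (v x s - \<zeta> x s) \<le> (t - s) * (discrete_laplacian \<delta> (\<lambda>x. V x s - Y x s) x + \<eta>)"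
          using conjunct1[OF *] by linarith
      qed
    qed
  qed (use R t in auto)
  moreover have "0 < v x0 t1"
    using g(1)[of t1] t bump_pos[of "0::'a" r] r(1) by (simp add: v_def b_def)
  ultimately show ?thesis by simp
qed

text \<open>The barrier is the stationary supersolution with $w^m = A\,((c+3)^2 - |x|^2)$.\<close>
lemma bounded_by_barrier:
  fixes u :: "'a::euclidean_space \<Rightarrow> real \<Rightarrow> real" and A c :: real
  assumes ws: "weak_solution m p \<sigma> u0 T u" and m: "1 < m" and t: "0 < t0" "t0 < t1" "t1 < T" and c: "0 \<le> c" and A: "0 < A"
    and supp: "\<And>x t. c < norm x \<Longrightarrow> t \<in> {t0..t1} \<Longrightarrow> u x t = 0"
    and init: "\<And>x. u x t0 powr m \<le> A"
    and apriori: "\<And>x t. t \<in> {t0..t1} \<Longrightarrow> u x t powr m \<le> 2 * A * (c + 3)\<^sup>2"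
    and source: "\<And>x t. t \<in> {t0..t1} \<Longrightarrow> norm x powr \<sigma> * u x t powr p \<le> 2 * DIM('a) * A"
  shows "u x t1 powr m \<le> A * (c + 3)\<^sup>2"
proof (cases "norm x < c + 1")
  case False
  then show ?thesis using supp[of x t1] c t A by simp
next
  case x: True
  \<comment> \<open>\<open>u\<close> vanishes on the collar beyond \<open>R\<close>, and with
    \<open>K\<close> the square of \<open>R + 2\<close> the barrier satisfies
    \<open>W \<ge> A\<close> up to radius \<open>R + 1\<close>; thus it lies above \<open>u\<close>
    initially.\<close>
  define R where "R = c + 1"
  have R: "0 < R" "0 \<le> R" using c by (auto simp: R_def)
  define K where "K = (R + 2)\<^sup>2"
  have K: "K = (c + 3)\<^sup>2" by (simp add: K_def R_def add.commute)
  define W where "W y = A * (K - y \<bullet> y)" for y :: 'a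
  \<comment> \<open>The cut at 0 keeps the root continuous far away. In the relevant ball
    \<open>W\<close> is positive, so \<open>W\<close> itself, with its exact discrete Laplacian, can
    stand for the m-th power.\<close>
  define w where "w y = max 0 (W y) powr (1 / m)" for y :: 'a
  have u0: "0 \<le> u x s" if "s \<in> {t0..t1}" for x s
    using weak_solution_nonneg[OF ws, of s x] that t by auto
  have W: "A \<le> W y" "W y \<le> A * K" if "norm y \<le> R + 1" for y
  proof -
    have "y \<bullet> y \<le> (R + 1)\<^sup>2" using power_mono[OF that, of 2] by (simp add: power2_norm_eq_inner)
    then have "1 \<le> K - y \<bullet> y" using R by (simp add: K_def power2_eq_square algebra_simps)
    then have "A * 1 \<le> A * (K - y \<bullet> y)" using A by (intro mult_left_mono) auto
    then show "A \<le> W y" by (simp add: W_def)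
    show "W y \<le> A * K" using A by (simp add: W_def)
  qed
  have wW: "w y powr m = W y" if "norm y \<le> R + 1" for y
    using W(1)[OF that] A m by (simp add: w_def powr_powr)
  have inv: "u y s = (u y s powr m) powr (1 / m)" if "s \<in> {t0..t1}" for y s
    using u0[OF that] m by (simp add: powr_powr)
  define M where "M = (2 * A * K) powr (1 / m)"
  have uM: "u y s \<le> M" if "s \<in> {t0..t1}" for y s
  proof -
    have "(u y s powr m) powr (1 / m) \<le> M"
      unfolding M_def using apriori[OF that, of y] m K by (intro powr_mono2) auto
    then show ?thesis by (simp only: inv[OF that, of y, symmetric])
  qed
  have wM: "0 \<le> w y" "w y \<le> M" if "norm y \<le> R + 1" for y
  proof -
    show "0 \<le> w y" by (simp add: w_def)
    have "0 \<le> A * K" using W[OF that] A by linarith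
    then show "w y \<le> M" unfolding w_def M_def using W[OF that] A m by (intro powr_mono2) auto
  qed
  have wcont: "continuous_on UNIV w"
    unfolding w_def[abs_def] W_def[abs_def] using m by (intro continuous_on_powr' continuous_intros) auto
  have [measurable]: "w \<in> borel_measurable borel" using wcont by (rule borel_measurable_continuous_onI)
  have [measurable]: "W \<in> borel_measurable borel" unfolding W_def[abs_def] by measurable
  \<comment> \<open>Exact for a quadratic function; it cancels the bound
    \<open>2 * DIM('a) * A\<close> of the source.\<close>
  have sdW: "discrete_laplacian \<delta> W y = - 2 * DIM('a) * A" if "0 < \<delta>" for \<delta> y
  proof -
    have "W (y + \<delta> *\<^sub>R b) + W (y - \<delta> *\<^sub>R b) - 2 * W y = - 2 * A * \<delta>\<^sup>2" if "b \<in> Basis" for b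
      using that by (simp add: W_def inner_simps inner_commute algebra_simps power2_eq_square)
    then show ?thesis using that by (simp add: discrete_laplacian_def)
  qed
  have "u x t1 - w x \<le> 0"
  proof (rule comparison_principle[where z="\<lambda>x t. u x t - w x" and Z="\<lambda>x t. u x t powr m - W x"
        and R=R and B=M and A="m * M powr (m - 1)" and ?t0.0=t0])
    show "0 \<le> m * M powr (m - 1)" using m by simp
    show "continuous_on UNIV (\<lambda>x. u x t - w x)" if "t \<in> {t0..t1}" for t
      using weak_solution_slice[OF ws, of t] that t wcont by (intro continuous_intros) auto
    show "(\<lambda>x. u x s powr m - W x) \<in> borel_measurable borel" if "s \<in> {t0..t1}" for s
    proof -
      have [measurable]: "(\<lambda>x. u x s) \<in> borel_measurable borel"
        using weak_solution_slice_measurable[OF ws, of s] that t by auto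
      show ?thesis by measurable
    qed
    show "\<bar>u x s - w x\<bar> \<le> M" if "x \<in> cball 0 (R + 1)" "s \<in> {t0..t1}" for x s
      using uM[OF that(2), of x] wM[of x] u0[OF that(2), of x] that(1) by (simp add: abs_le_iff)
    show "\<bar>u x s powr m - W x\<bar> \<le> m * M powr (m - 1) * \<bar>u x s - w x\<bar>"
      "0 \<le> (u x s powr m - W x) * (u x s - w x)" if "x \<in> cball 0 (R + 1)" "s \<in> {t0..t1}" for x s
      using powr_diff_bounds[of "u x s" M "w x" m] uM[OF that(2), of x] wM[of x] u0[OF that(2), of x] m
        wW[of x] that(1) by auto
    show "u x s powr m - W x \<le> 0" if "x \<in> cball 0 (R + 1) - ball 0 R" "s \<in> {t0..t1}" for x s
      using W(1)[of x] A supp[of x s] that by (simp add: R_def)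
    show "u x t0 - w x \<le> 0" if "x \<in> ball 0 R" for x
    proof -
      have "u x t0 powr m \<le> max 0 (W x)" using init[of x] W(1)[of x] that by simp
      then have "(u x t0 powr m) powr (1 / m) \<le> w x" unfolding w_def using m by (intro powr_mono2) auto
      moreover have "u x t0 = (u x t0 powr m) powr (1 / m)" using inv[of t0 x] t by simp
      ultimately show ?thesis by linarith
    qed
    show "x \<in> ball 0 R" using x by (simp add: R_def)
    fix \<eta> :: real assume \<eta>: "0 < \<eta>"
    have f: "norm y powr \<sigma> * u y s powr p \<le> real (2 * DIM('a)) * A" if "norm y \<le> R + 2" "t0 \<le> s" "s \<le> t1" for y s
      using source[of s y] that by simp
    from regularized_equation[OF ws _ t(1,3) R(2) \<eta>, OF _ f] m
    obtain \<zeta> Y where close: "approximates R t0 t1 \<eta> \<zeta> u" "approximates R t0 t1 \<eta> Y (\<lambda>x t. u x t powr m)"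
      and ev: "eventually_steps R t0 t1 (\<lambda>\<delta> s t x. (t - s) * (discrete_laplacian \<delta> (\<lambda>x. Y x s) x - \<eta>) \<le> \<zeta> x t - \<zeta> x s \<and>
        \<zeta> x t - \<zeta> x s \<le> (t - s) * (discrete_laplacian \<delta> (\<lambda>x. Y x s) x + \<eta> + real (2 * DIM('a)) * A))"
      by auto
    show "\<exists>\<zeta> Y. approximates R t0 t1 \<eta> \<zeta> (\<lambda>x t. u x t - w x) \<and>
       approximates R t0 t1 \<eta> Y (\<lambda>x t. u x t powr m - W x) \<and>
       eventually_steps R t0 t1 (\<lambda>\<delta> s t x. \<zeta> x t - \<zeta> x s \<le> (t - s) * (discrete_laplacian \<delta> (\<lambda>x. Y x s) x + \<eta>))"
    proof (intro exI conjI)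
      show "approximates R t0 t1 \<eta> (\<lambda>x t. \<zeta> x t - w x) (\<lambda>x t. u x t - w x)"
        by (intro approximates_diff(2)[OF close(1)]) auto
      show "approximates R t0 t1 \<eta> (\<lambda>x t. Y x t - W x) (\<lambda>x t. u x t powr m - W x)"
        by (intro approximates_diff(2)[OF close(2)]) auto
      show "eventually_steps R t0 t1 (\<lambda>\<delta> s t x. (\<zeta> x t - w x) - (\<zeta> x s - w x)
          \<le> (t - s) * (discrete_laplacian \<delta> (\<lambda>x. Y x s - W x) x + \<eta>))"
        by (rule eventually_steps_mono[OF ev zero_less_one]) (simp add: discrete_laplacian_diff sdW algebra_simps)
    qed
  qed (use R t in auto)
  then have "u x t1 powr m \<le> w x powr m" using u0[of t1 x] t m by (intro powr_mono2) auto
  then show ?thesis using wW[of x] W(2)[of x] x K by (simp add: R_def)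
qed

text \<open>Continuation argument. As long as \<open>u powr m\<close> stays below
  \<open>2 * A * K\<close>, the source in the ball of radius \<open>c\<close> is small enough for
  the barrier, which yields the better bound \<open>A * K\<close>. By continuity in time the level
  \<open>2 * A * K\<close> is never reached.\<close>

lemma bounded_if_support_bounded:
  fixes u :: "'a::euclidean_space \<Rightarrow> real \<Rightarrow> real" and c :: real
  assumes ws: "weak_solution m p \<sigma> u0 T u" and p: "0 \<le> p" "p < m" and m: "1 < m" and \<sigma>: "0 \<le> \<sigma>"
    and t0: "0 < t0" "t0 < T" and c: "0 \<le> c"
    and supp: "\<And>x t. c < norm x \<Longrightarrow> 0 < t \<Longrightarrow> t < T \<Longrightarrow> u x t = 0"
  shows "\<exists>M. \<forall>x. \<forall>t\<in>{t0..<T}. u x t \<le> M"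
proof -
  define K where "K = (c + 3)\<^sup>2"
  have K: "1 \<le> K" using c by (simp add: K_def one_le_power)
  define N where "N = real DIM('a)"
  have N: "0 < N" by (simp add: N_def)
  define q where "q = p / m"
  have q: "0 \<le> q" "q < 1" using p m by (auto simp: q_def)
  obtain M0 where M0: "0 \<le> M0" "\<And>x. x \<in> cball 0 c \<Longrightarrow> u x t0 \<le> M0"
    using weak_solution_bounded_on_compact[OF ws t0, of c] by auto
  \<comment> \<open>Under the provisional bound the source is at most
    \<open>2 * N * \<kappa> * A powr q\<close>. As \<open>q < 1\<close>, this is below
    \<open>2 * N * A\<close> once \<open>A\<close> is at least
    \<open>\<kappa> powr (1 / (1 - q))\<close>; the other entries of the maximum cover positivity
    and the data at \<open>t0\<close>.\<close>
  define \<kappa> where "\<kappa> = c powr \<sigma> * (2 * K) powr q / (2 * N)"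
  have \<kappa>: "0 \<le> \<kappa>" using N by (simp add: \<kappa>_def)
  define A where "A = max 1 (max (M0 powr m) (\<kappa> powr (1 / (1 - q))))"
  have A: "1 \<le> A" "M0 powr m \<le> A" "\<kappa> powr (1 / (1 - q)) \<le> A" by (auto simp: A_def)
  have u0: "0 \<le> u x s" if "0 < s" "s < T" for x s
    using weak_solution_nonneg[OF ws, of s x] that by auto
  \<comment> \<open>This is where $p < m$ enters.\<close>
  have scale: "c powr \<sigma> * (2 * A * K) powr q \<le> 2 * N * A"
  proof -
    have "\<kappa> = (\<kappa> powr (1 / (1 - q))) powr (1 - q)" using \<kappa> q by (simp add: powr_powr)
    also have "\<dots> \<le> A powr (1 - q)" using A(3) q by (intro powr_mono2) auto
    finally have "2 * N * (\<kappa> * A powr q) \<le> 2 * N * (A powr (1 - q) * A powr q)"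
      using N by (intro mult_left_mono mult_right_mono) auto
    also have "A powr (1 - q) * A powr q = A" using A(1) by (simp add: powr_add[symmetric])
    also have "2 * N * (\<kappa> * A powr q) = c powr \<sigma> * ((2 * K) powr q * A powr q)"
      using N by (simp add: \<kappa>_def)
    also have "(2 * K) powr q * A powr q = (2 * A * K) powr q"
      using A(1) K by (simp add: powr_mult[symmetric] mult_ac)
    finally show ?thesis .
  qed
  define U where "U x t = u x t powr m" for x t
  have AK: "A \<le> A * K" "0 < A * K" using A(1) K mult_left_mono[of 1 K A] by auto
  have barrier: "U x t1 \<le> A * K"
    if t1: "t0 < t1" "t1 < T" and le: "\<And>x t. t \<in> {t0..t1} \<Longrightarrow> U x t \<le> 2 * A * K" for x t1
    unfolding U_def K_def
  proof (rule bounded_by_barrier[OF ws m t0(1) t1 c])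
    show "0 < A" using A by simp
    show "u x t = 0" if "c < norm x" "t \<in> {t0..t1}" for x t using supp that t0 t1 by auto
    show "u x t0 powr m \<le> A" for x
    proof (cases "norm x \<le> c")
      case True
      then have "u x t0 powr m \<le> M0 powr m" using M0(2)[of x] u0[of t0 x] t0 m by (intro powr_mono2) auto
      then show ?thesis using A by linarith
    next
      case False
      then show ?thesis using supp[of x t0] t0 A by simp
    qed
    show "u x t powr m \<le> 2 * A * (c + 3)\<^sup>2" if "t \<in> {t0..t1}" for x t
      using le[OF that, of x] by (simp add: U_def K_def)
    show "norm x powr \<sigma> * u x t powr p \<le> real (2 * DIM('a)) * A" if t: "t \<in> {t0..t1}" for x t
    proof (cases "norm x \<le> c")
      case True
      have "u x t powr p = U x t powr q" using m by (simp add: U_def q_def powr_powr)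
      also have "\<dots> \<le> (2 * A * K) powr q" using le[OF t, of x] q by (intro powr_mono2) (auto simp: U_def)
      finally have "norm x powr \<sigma> * u x t powr p \<le> c powr \<sigma> * (2 * A * K) powr q"
        using True \<sigma> by (intro mult_mono powr_mono2) auto
      then show ?thesis using scale by (simp add: N_def)
    next
      case False
      then show ?thesis using supp[of x t] t t0 t1 A by simp
    qed
  qed
  have bound: "U x t2 < 2 * A * K" if t2: "t0 \<le> t2" "t2 < T" for x t2
  proof (rule ccontr)
    assume "\<not> U x t2 < 2 * A * K"
    then have x: "2 * A * K \<le> U x t2" by simp
    have cont: "continuous_on (cball 0 c \<times> {t0..t2}) (\<lambda>(x, t). U x t)"
    proof -
      have "continuous_on (cball 0 c \<times> {t0..t2}) (\<lambda>(x, s). u x s)"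
        by (rule weak_solution_continuous[OF ws t0(1) t2(2)])
      then show ?thesis using u0 m t0 t2 unfolding U_def case_prod_beta
        by (intro continuous_on_powr') (auto intro!: continuous_intros)
    qed
    \<comment> \<open>Outside the ball of radius \<open>c\<close> the solution vanishes, so every
      point where the level is reached lies in this compact set, and its time projection has a least
      element \<open>ts\<close>.\<close>
    define S where "S = (cball 0 c \<times> {t0..t2}) \<inter> (\<lambda>(x, t). U x t) -` {2 * A * K..}"
    have "closed S" unfolding S_def
      by (rule continuous_closed_preimage[OF cont]) (auto intro!: closed_Times)
    moreover have "compact (cball (0::'a) c \<times> {t0..t2})" by (intro compact_Times) auto
    ultimately have "compact ((cball (0::'a) c \<times> {t0..t2}) \<inter> S)" by (rule compact_Int_closed[rotated])
    moreover have "(cball (0::'a) c \<times> {t0..t2}) \<inter> S = S" by (auto simp: S_def)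
    ultimately have "compact S" by simp
    have "norm x \<le> c"
    proof (rule ccontr)
      assume "\<not> norm x \<le> c"
      then have "U x t2 = 0" using supp[of x t2] t0 t2 by (simp add: U_def)
      then show False using x AK by simp
    qed
    then have "(x, t2) \<in> S" using x t2 by (simp add: S_def)
    then obtain xs ts where xs: "(xs, ts) \<in> S" and least: "\<And>y t. (y, t) \<in> S \<Longrightarrow> ts \<le> t"
    proof -
      have "compact (snd ` S)" using \<open>compact S\<close> by (intro compact_continuous_image continuous_intros)
      moreover have "snd ` S \<noteq> {}" using \<open>(x, t2) \<in> S\<close> by blast
      ultimately obtain a where "a \<in> snd ` S" "\<forall>b\<in>snd ` S. a \<le> b"
        using compact_attains_inf by blast
      moreover from this obtain y where "(y, a) \<in> S" by auto
      ultimately show ?thesis by (intro that[of y a]) force+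
    qed
    have ts: "t0 \<le> ts" "ts \<le> t2" "norm xs \<le> c" "2 * A * K \<le> U xs ts" using xs by (auto simp: S_def)
    have "U xs t0 \<le> A"
    proof -
      have "U xs t0 \<le> M0 powr m" unfolding U_def using M0(2)[of xs] ts u0[of t0 xs] t0 m by (intro powr_mono2) auto
      then show ?thesis using A by linarith
    qed
    then have "ts \<noteq> t0" using ts(4) AK by auto
    then have tst: "t0 < ts" using ts by simp
    have before: "U y t \<le> 2 * A * K" if "t0 \<le> t" "t < ts" for y t
    proof (cases "norm y \<le> c")
      case True
      then show ?thesis using least[of y t] that ts by (force simp: S_def)
    next
      case False
      then have "U y t = 0" using supp[of y t] that ts t0 t2 by (simp add: U_def)
      then show ?thesis using AK by simp
    qed
    \<comment> \<open>Strictly before \<open>ts\<close> the provisional bound holds on the whole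
      interval, so the barrier applies; the limit from the left carries its bound to
      \<open>ts\<close>.\<close>
    have "U xs t \<le> A * K" if "t0 < t" "t < ts" for t
      by (rule barrier) (use that before ts t2 in auto)
    then have ev: "\<forall>\<^sub>F t in at_left ts. U xs t \<le> A * K"
      using tst by (auto simp: eventually_at_left)
    have "continuous_on {t0..t2} (\<lambda>t. (\<lambda>(x, t). U x t) (xs, t))"
      by (rule continuous_on_compose2[OF cont]) (use ts in \<open>auto intro!: continuous_intros\<close>)
    then have "continuous_on {t0..ts} (\<lambda>t. U xs t)" using ts by (auto intro: continuous_on_subset)
    then have "((\<lambda>t. U xs t) \<longlongrightarrow> U xs ts) (at_left ts)" using tst by (rule continuous_on_Icc_at_leftD)
    then have "U xs ts \<le> A * K" using ev by (rule tendsto_upperbound) simp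
    then show False using ts(4) AK by simp
  qed
  have "u x t \<le> (2 * A * K) powr (1 / m)" if "t \<in> {t0..<T}" for x t
  proof -
    have "u x t = U x t powr (1 / m)" using u0[of t x] that t0 m by (simp add: U_def powr_powr)
    also have "\<dots> \<le> (2 * A * K) powr (1 / m)" using bound[of t x] that m by (intro powr_mono2) (auto simp: U_def)
    finally show ?thesis .
  qed
  then show ?thesis by blast
qed

section \<open>Divergence of the edge of the support\<close>

theorem theorem1p6:
  fixes u0 :: "'a::euclidean_space \<Rightarrow> real"
    and u :: "'a \<Rightarrow> real \<Rightarrow> real"
    and m p \<sigma> T :: real
  assumes "1 < p" and "p < m" and "\<sigma> > 0"
    and "continuous_on UNIV u0" and "u0 \<in> Linf"
    and "\<And>x. u0 x \<ge> 0" and "\<exists>x. u0 x \<noteq> 0"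
    and "compact (closure {x. u0 x \<noteq> 0})"
    and "weak_solution m p \<sigma> u0 T u"
    and "blow_up_time u T"
  shows "(support_edge u \<longlongrightarrow> \<infinity>) (at_left T)"
proof (rule ccontr)
  assume "\<not> ?thesis"
  then obtain r where r: "\<not> (\<forall>\<^sub>F t in at_left T. ereal r < support_edge u t)"
    unfolding tendsto_PInfty by blast
  note ws = \<open>weak_solution m p \<sigma> u0 T u\<close>
  have T: "0 < T" using \<open>blow_up_time u T\<close> by (simp add: blow_up_time_def)
  \<comment> \<open>The level \<open>r\<close> that the edge fails to stay above may be negative,
    whereas a radius may not.\<close>
  define c where "c = max 0 r"
  have supp: "u x t = 0" if x: "c < norm x" and t: "0 < t" "t < T" for x t
  proof (rule ccontr)
    assume "u x t \<noteq> 0"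
    then have pos: "0 < u x t" using weak_solution_nonneg[OF ws t, of x] by simp
    have "ereal r < support_edge u t'" if "t < t'" "t' < T" for t'
    proof -
      have "0 < u x t'"
        by (rule positivity_retained[where ?t0.0=t, OF ws]) (use assms that t pos in auto)
      then have "ereal (norm x) \<le> support_edge u t'"
        unfolding support_edge_def by (intro SUP_upper) auto
      moreover have "ereal r < ereal (norm x)" using x by (simp add: c_def)
      ultimately show ?thesis by (rule order_less_le_trans[rotated])
    qed
    then have "\<forall>\<^sub>F t in at_left T. ereal r < support_edge u t"
      using t by (auto simp: eventually_at_left)
    with r show False by contradiction
  qed
  \<comment> \<open>Any start inside (0,T) would do: continuity of \<open>u\<close> is available for
    positive times only, and blow-up concerns times near \<open>T\<close>.\<close>
  have "\<exists>M. \<forall>x. \<forall>t\<in>{T/2..<T}. u x t \<le> M"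
    by (rule bounded_if_support_bounded[OF ws, where c=c]) (use supp \<open>1 < p\<close> \<open>p < m\<close> \<open>\<sigma> > 0\<close> T in \<open>auto simp: c_def\<close>)
  then obtain M where M: "\<And>x t. t \<in> {T/2..<T} \<Longrightarrow> u x t \<le> M" by blast
  have "Linf_norm (\<lambda>x. u x t) \<le> ereal M" if "T / 2 < t" "t < T" for t
    unfolding Linf_norm_def
  proof (rule esssup_I)
    have "(\<lambda>x. u x t) \<in> borel_measurable borel"
      using weak_solution_slice_measurable[OF ws] that T by simp
    then show "(\<lambda>x. ereal \<bar>u x t\<bar>) \<in> borel_measurable lebesgue"
      by (intro borel_measurable_ereal borel_measurable_abs measurable_completion) simp
    show "AE x in lebesgue. ereal \<bar>u x t\<bar> \<le> ereal M"
      using M[of t] weak_solution_nonneg[OF ws, of t] that T by auto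
  qed
  then have "\<forall>\<^sub>F t in at_left T. Linf_norm (\<lambda>x. u x t) \<le> ereal M"
    using T by (auto simp: eventually_at_left intro!: exI[of _ "T/2"])
  then show False using \<open>blow_up_time u T\<close> by (auto simp: blow_up_time_def)
qed

end
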